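(* Let $X=Y/G$ be the $R$-model of $X_K=\mathbb P^1_K$ constructed in the context, with its singular point $\xi\in X$, and let $U=X\setminus D$, where $D\subset X$ is the closure of the divisor of zeroes $D_K\subset X_K$ of $\phi$. (i) We have $U=\mathrm{Spec}\,A$, where $A\subset K(x)$ is the sub-$R$-algebra generated by the elements $x_0,\ldots,x_{p-1}$ with $$x_i:=\pi_K^m\,x^i\,\phi^{-1},\qquad i=0,\ldots,p-1.$$ The point $\xi$ lies on $U$ and corresponds to the maximal ideal $$\mathfrak m:=(\pi_K,x_0,\ldots,x_{p-1})\lhd A.$$ (ii) The ideal of relations between the generators $x_0,\ldots,x_{p-1}$ (i.e. the kernel of the surjective $R$-algebra homomorphism from the polynomial ring over $R$ in $p$ indeterminates, again denoted $x_0,\ldots,x_{p-1}$, onto $A$) is generated by the $2\times 2$ minors of the $p\times 2$ matrix $$M:=\begin{pmatrix} x_0 & x_1\\ x_1 & x_2\\ \vdots & \vdots\\ x_{p-2} & x_{p-1}\\ x_{p-1} & z\end{pmatrix},\qquad\text{where } z:=\pi_K^m-\sum_{i=0}^{p-1}a_ix_i .$$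
   Context: **Models.** For a discrete valuation ring $R$ with fraction field $K$ and a smooth projective curve $X_K$ over $K$, an $R$-model of $X_K$ is a normal integral (excellent, noetherian) scheme $X$ of dimension $2$, proper, faithfully flat and of finite type over $\mathrm{Spec}\,R$, together with an identification $X\otimes_R K=X_K$. $X_s$ denotes its special fiber. **Setting.** Let $p$ be a prime number, $K$ a number field, $\mathfrak p\mid p$ a prime ideal of $\mathcal O_K$, $v_K$ the corresponding discrete valuation, $R$ the valuation ring of $v_K$, and $k$ its residue field. Let $L/K$ be a Galois extension of degree $p$ which is totally ramified at $\mathfrak p$, so $v_K$ has a unique extension $v_L$ to $L$. Let $R_L$ be the valuation ring of $v_L$, $\pi_L$ a uniformizer of $v_L$, and normalize $v_L$ by $v_L(\pi_L)=1$. Let $\sigma$ be a generator of $G=\mathrm{Gal}(L/K)$ and $m:=v_L(\sigma(\pi_L)-\pi_L)$ (an integer $\ge 2$). Let $\phi\in K[x]$ be the minimal polynomial of $\pi_L$ over $K$, $$\phi=x^p+\sum_{i=0}^{p-1}a_ix^i=\prod_{j=0}^{p-1}(x-\sigma^j(\pi_L)).$$ It is an Eisenstein polynomial over $R$, and $\pi_K:=a_0$ is a uniformizer of $R$. Let $X_K=\mathbb P^1_K$ with function field $K(x)$, and $X_L=\mathbb P^1_L$ with function field $L(x)$, on which $G$ acts through its action on $L$, fixing $x$. Put $y:=(x-\pi_L)/\pi_L^m\in L(x)$, so $L(x)=L(y)$, and let $Y$ be the smooth $R_L$-model of $X_L$ such that $y$ extends to an isomorphism $Y\cong\mathbb P^1_{R_L}$.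 The action of $G$ on $X_L$ extends to $Y$; its restriction to the special fiber $Y_s\cong\mathbb P^1_k$ is fixed point free on the affine line $\mathrm{Spec}\,k[y]$ and fixes the point $\eta\in Y_s$ given by $y=\infty$. Let $X:=Y/G$ be the quotient scheme, which is an $R$-model of $X_K$, and let $\xi\in X_s$ be the image of $\eta$; it is the only singular (non-regular) point of $X$. *)

theory Defs
  imports
    "HOL-Analysis.Abstract_Topology"
    "HOL-Algebra.Generated_Rings"
    "HOL-Algebra.Algebraic_Closure_Type"
    "HOL-Computational_Algebra.Fraction_Field"
    "HOL-Library.Poly_Mapping"
begin

section \<open>Rings inside a fixed ambient ring\<close>

text \<open>
  All rings below are subrings of a type; \<open>sub_ring A\<close> is the HOL-Algebra ring with carrier
  \<open>A\<close>, so that ideals, prime ideals, homomorphisms etc. are those of HOL-Algebra.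
\<close>

abbreviation amb :: "'a::comm_ring_1 ring" where
  "amb \<equiv> ring_of_type_algebra"

abbreviation sub_ring :: "'a::comm_ring_1 set \<Rightarrow> 'a ring" where
  "sub_ring A \<equiv> ring_of_type_algebra\<lparr>carrier := A\<rparr>"

definition adjoin :: "'a::comm_ring_1 set \<Rightarrow> 'a set \<Rightarrow> 'a set" where
  "adjoin R S = generate_ring amb (R \<union> S)"

definition localization :: "'f::field set \<Rightarrow> 'f set \<Rightarrow> 'f set" where
  "localization A P = {a / b | a b. a \<in> A \<and> b \<in> A - P}"


section \<open>Integral schemes inside their function field\<close>

text \<open>
  An integral scheme is given by its underlying topological space and its structure sheaf, the
  latter realised as a sheaf of subrings of the function field (which may be a subfield of the
  ambient field \<open>'f\<close>); restriction maps are the inclusions. The value on the empty open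
  set is the zero ring \<open>{0}\<close>.
\<close>

record ('p, 'f) scheme_in =
  space_of :: "'p topology"
  sections :: "'p set \<Rightarrow> 'f set"

abbreviation points :: "('p, 'f, 'z) scheme_in_scheme \<Rightarrow> 'p set" where
  "points \<X> \<equiv> topspace (space_of \<X>)"

text \<open>For a domain \<open>A\<close> and nonempty open \<open>W\<close>, the ring of sections of
  the structure sheaf over \<open>W\<close> is the intersection of the localizations of
  \<open>A\<close> at the points of \<open>W\<close>.\<close>

definition Spec :: "'f::field set \<Rightarrow> ('f set, 'f) scheme_in" where
  "Spec A = \<lparr>
     space_of = topology_generated_by
       {{P. primeideal P (sub_ring A) \<and> f \<notin> P} | f. f \<in> A},
     sections = (\<lambda>W. if W = {} then {0} else \<Inter>P\<in>W. localization A P) \<rparr>"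

text \<open>
  The scheme obtained from the affine schemes \<open>Spec B\<close>, \<open>B \<in> \<B>\<close>, by
  identifying two points precisely when they have the same local ring in the function field.
  A point of the glued scheme is represented by this local ring, and the images of the open
  sets of the charts form a basis of the topology.
\<close>

definition glue_Spec :: "'f::field set set \<Rightarrow> ('f set, 'f) scheme_in" where
  "glue_Spec \<B> = \<lparr>
     space_of = topology_generated_by
       {localization B ` W | B W. B \<in> \<B> \<and> openin (space_of (Spec B)) W},
     sections = (\<lambda>W. if W = {} then {0} else \<Inter>W) \<rparr>"

text \<open>The projective line over \<open>R\<close> with coordinate \<open>t\<close>. The points common to
  the two charts are those of \<open>Spec R[t, 1/t]\<close>.\<close>

definition proj_line :: "'f::field set \<Rightarrow> 'f \<Rightarrow> ('f set, 'f) scheme_in" where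
  "proj_line R t = glue_Spec {adjoin R {t}, adjoin R {inverse t}}"

definition stalk :: "('p, 'f) scheme_in \<Rightarrow> 'p \<Rightarrow> 'f set" where
  "stalk \<X> P = (\<Union>W\<in>{W. openin (space_of \<X>) W \<and> P \<in> W}. sections \<X> W)"

definition open_subscheme :: "('p, 'f) scheme_in \<Rightarrow> 'p set \<Rightarrow> ('p, 'f) scheme_in" where
  "open_subscheme \<X> U = \<lparr> space_of = subtopology (space_of \<X>) U, sections = sections \<X> \<rparr>"

text \<open>An isomorphism of schemes that induces the identity on function fields: it identifies
  the two structure sheaves as sheaves of subrings of the function field.\<close>

definition scheme_iso ::
  "('p, 'f) scheme_in \<Rightarrow> ('q, 'f) scheme_in \<Rightarrow> ('p \<Rightarrow> 'q) \<Rightarrow> bool" where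
  "scheme_iso \<X> \<Z> h \<longleftrightarrow>
     homeomorphic_map (space_of \<X>) (space_of \<Z>) h \<and>
     (\<forall>V. openin (space_of \<Z>) V \<longrightarrow> sections \<X> {P \<in> points \<X>. h P \<in> V} = sections \<Z> V)"


subsection \<open>Quotients by groups of automorphisms\<close>

text \<open>\<open>G\<close> is a group of automorphisms of the function field; on a scheme whose points
  are represented by their local rings it acts by taking images.\<close>

definition point_orbit :: "('f \<Rightarrow> 'f) set \<Rightarrow> 'f set \<Rightarrow> 'f set set" where
  "point_orbit G P = {g ` P | g. g \<in> G}"

definition quotient_space :: "'p topology \<Rightarrow> ('p \<Rightarrow> 'q) \<Rightarrow> 'q topology" where
  "quotient_space T q =
     topology (\<lambda>W. W \<subseteq> q ` topspace T \<and> openin T {x \<in> topspace T. q x \<in> W})"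

lemma openin_quotient_space:
  "openin (quotient_space T q) W \<longleftrightarrow>
     W \<subseteq> q ` topspace T \<and> openin T {x \<in> topspace T. q x \<in> W}"
proof -
  have "istopology (\<lambda>W. W \<subseteq> q ` topspace T \<and> openin T {x \<in> topspace T. q x \<in> W})"
    unfolding istopology_def
  proof (rule conjI; intro allI impI)
    fix S U
    assume "S \<subseteq> q ` topspace T \<and> openin T {x \<in> topspace T. q x \<in> S}"
      and "U \<subseteq> q ` topspace T \<and> openin T {x \<in> topspace T. q x \<in> U}"
    moreover have "{x \<in> topspace T. q x \<in> S \<inter> U} =
        {x \<in> topspace T. q x \<in> S} \<inter> {x \<in> topspace T. q x \<in> U}"
      by blast
    ultimately show "S \<inter> U \<subseteq> q ` topspace T \<and> openin T {x \<in> topspace T. q x \<in> S \<inter> U}"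
      by auto
  next
    fix K
    assume K: "\<forall>S\<in>K. S \<subseteq> q ` topspace T \<and> openin T {x \<in> topspace T. q x \<in> S}"
    have "{x \<in> topspace T. q x \<in> \<Union>K} = (\<Union>S\<in>K. {x \<in> topspace T. q x \<in> S})"
      by blast
    with K show "\<Union>K \<subseteq> q ` topspace T \<and> openin T {x \<in> topspace T. q x \<in> \<Union>K}"
      by auto
  qed
  then show ?thesis
    by (simp add: quotient_space_def)
qed

text \<open>Sections of the quotient over \<open>W\<close> are the invariant sections over the preimage
  of \<open>W\<close>.\<close>

definition quotient_scheme ::
  "('f set, 'f) scheme_in \<Rightarrow> ('f \<Rightarrow> 'f) set \<Rightarrow> ('f set set, 'f) scheme_in" where
  "quotient_scheme \<Y> G = \<lparr>
     space_of = quotient_space (space_of \<Y>) (point_orbit G),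
     sections = (\<lambda>W. {f \<in> sections \<Y> {P \<in> points \<Y>. point_orbit G P \<in> W}. \<forall>g\<in>G. g f = f}) \<rparr>"


subsection \<open>Generic fibre and zeroes\<close>

text \<open>Points of an \<open>R\<close>-scheme lying over the generic point of \<open>Spec R\<close>:
  every nonzero element of \<open>R\<close> is a unit in the local ring.\<close>

definition generic_fibre :: "'f::field set \<Rightarrow> ('p, 'f) scheme_in \<Rightarrow> 'p set" where
  "generic_fibre R \<X> = {P \<in> points \<X>. \<forall>a\<in>R - {0}. inverse a \<in> stalk \<X> P}"

text \<open>Support of the divisor of zeroes, on the generic fibre, of a nonzero rational function
  \<open>f\<close>: the points whose local ring contains \<open>f\<close> as a non-unit.\<close>

definition zeroes :: "'f::field set \<Rightarrow> ('p, 'f) scheme_in \<Rightarrow> 'f \<Rightarrow> 'p set" where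
  "zeroes R \<X> f = {P \<in> generic_fibre R \<X>. f \<in> stalk \<X> P \<and> inverse f \<notin> stalk \<X> P}"


section \<open>Number fields, valuations and Galois groups\<close>

text \<open>The field \<open>L\<close> is a type, \<open>K\<close> a subset of it.\<close>

definition number_field :: "'l::field_char_0 set \<Rightarrow> bool" where
  "number_field K \<longleftrightarrow> subfield K amb \<and> ring.finite_dimension amb \<rat> K"

definition ring_of_integers :: "'l::field_char_0 set \<Rightarrow> 'l set" where
  "ring_of_integers K = {a \<in> K. algebraic_int a}"

text \<open>Normalized discrete valuations; the value at 0 is irrelevant.\<close>

definition discrete_valuation :: "'l::field set \<Rightarrow> ('l \<Rightarrow> int) \<Rightarrow> bool" where
  "discrete_valuation F v \<longleftrightarrow>
     (\<forall>a\<in>F - {0}. \<forall>b\<in>F - {0}. v (a * b) = v a + v b) \<and>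
     (\<forall>a\<in>F - {0}. \<forall>b\<in>F - {0}. a + b \<noteq> 0 \<longrightarrow> min (v a) (v b) \<le> v (a + b)) \<and>
     v ` (F - {0}) = UNIV"

definition valuation_ring :: "'l::field set \<Rightarrow> ('l \<Rightarrow> int) \<Rightarrow> 'l set" where
  "valuation_ring F v = {a \<in> F. a = 0 \<or> 0 \<le> v a}"

text \<open>The Galois group of the whole type over \<open>K\<close>.\<close>

definition Gal :: "'l::field set \<Rightarrow> ('l \<Rightarrow> 'l) set" where
  "Gal K = {\<tau> \<in> ring_iso amb amb. \<forall>a\<in>K. \<tau> a = a}"

definition galois_over :: "'l::field set \<Rightarrow> bool" where
  "galois_over K \<longleftrightarrow> {a. \<forall>\<tau>\<in>Gal K. \<tau> a = a} = K"

definition is_min_poly :: "'l::field set \<Rightarrow> 'l \<Rightarrow> 'l poly \<Rightarrow> bool" where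
  "is_min_poly K a f \<longleftrightarrow>
     lead_coeff f = 1 \<and> (\<forall>i. poly.coeff f i \<in> K) \<and> poly f a = 0 \<and>
     (\<forall>g. g \<noteq> 0 \<longrightarrow> (\<forall>i. poly.coeff g i \<in> K) \<longrightarrow> poly g a = 0 \<longrightarrow>
        Polynomial.degree f \<le> Polynomial.degree g)"


section \<open>The rational function field\<close>

text \<open>\<open>L(x)\<close> is the type \<open>'l poly fract\<close>.\<close>

abbreviation of_poly :: "'l::field poly \<Rightarrow> 'l poly fract" where
  "of_poly f \<equiv> Fraction_Field.Fract f 1"

abbreviation of_const :: "'l::field \<Rightarrow> 'l poly fract" where
  "of_const c \<equiv> of_poly [:c:]"

abbreviation var_x :: "'l::field poly fract" where
  "var_x \<equiv> of_poly [:0, 1:]"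

text \<open>The action on \<open>L(x)\<close> of an automorphism of \<open>L\<close>, fixing
  \<open>x\<close>.\<close>

definition extend_aut :: "('l::field \<Rightarrow> 'l) \<Rightarrow> 'l poly fract \<Rightarrow> 'l poly fract" where
  "extend_aut \<tau> f = (THE g. \<exists>a b. b \<noteq> 0 \<and> f = Fraction_Field.Fract a b \<and>
     g = Fraction_Field.Fract (map_poly \<tau> a) (map_poly \<tau> b))"


section \<open>Polynomial rings in finitely many variables\<close>

text \<open>Monomials are finitely supported exponent functions \<open>nat \<Rightarrow>\<^sub>0 nat\<close>;
  \<open>mv_poly_ring R n\<close> consists of the polynomials with coefficients in \<open>R\<close> in the
  variables with indices below \<open>n\<close>.\<close>

type_synonym 'l mvpoly = "(nat \<Rightarrow>\<^sub>0 nat) \<Rightarrow>\<^sub>0 'l"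

definition mv_const :: "'l::comm_ring_1 \<Rightarrow> 'l mvpoly" where
  "mv_const c = Poly_Mapping.single 0 c"

definition mv_var :: "nat \<Rightarrow> 'l::comm_ring_1 mvpoly" where
  "mv_var i = Poly_Mapping.single (Poly_Mapping.single i 1) 1"

definition mv_poly_ring :: "'l::comm_ring_1 set \<Rightarrow> nat \<Rightarrow> 'l mvpoly set" where
  "mv_poly_ring R n =
    {q. \<forall>t\<in>Poly_Mapping.keys q. Poly_Mapping.lookup q t \<in> R \<and> Poly_Mapping.keys t \<subseteq> {..<n}}"

definition mv_eval ::
  "('l \<Rightarrow> 'f) \<Rightarrow> (nat \<Rightarrow> 'f) \<Rightarrow> 'l::comm_ring_1 mvpoly \<Rightarrow> 'f::comm_ring_1" where
  "mv_eval c s q = (\<Sum>t\<in>Poly_Mapping.keys q.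
     c (Poly_Mapping.lookup q t) * (\<Prod>i\<in>Poly_Mapping.keys t. s i ^ Poly_Mapping.lookup t i))"

text \<open>The 2 x 2 minors of an \<open>n\<close> x 2 matrix, with rows and columns numbered from 0.\<close>

definition minors2 :: "nat \<Rightarrow> (nat \<Rightarrow> nat \<Rightarrow> 'a::comm_ring_1) \<Rightarrow> 'a set" where
  "minors2 n M = {M i 0 * M j 1 - M i 1 * M j 0 | i j. i < j \<and> j < n}"

text \<open>The relation matrix; here \<open>a i\<close> are the lower coefficients of the minimal
  polynomial and \<open>c\<close> is the constant \<open>a 0 ^ m\<close>.\<close>

definition rel_z :: "nat \<Rightarrow> 'l::comm_ring_1 \<Rightarrow> (nat \<Rightarrow> 'l) \<Rightarrow> 'l mvpoly" where
  "rel_z p c a = mv_const c - (\<Sum>i<p. mv_const (a i) * mv_var i)"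

definition rel_matrix ::
  "nat \<Rightarrow> 'l::comm_ring_1 \<Rightarrow> (nat \<Rightarrow> 'l) \<Rightarrow> nat \<Rightarrow> nat \<Rightarrow> 'l mvpoly" where
  "rel_matrix p c a i j =
     (if i + j < p then mv_var (i + j) else rel_z p c a)"

end

theory Submission
  imports Defs
begin

text \<open>
  A point of \<open>Y\<close> is its local ring inside \<open>L(x)\<close>, and the topology of \<open>Y\<close> is generated by the
  domains of definition of rational functions. A \<open>G\<close>-stable affine open subset \<open>Spec C\<close> of
  \<open>Y\<close> therefore has the image \<open>Spec C\<^sup>G\<close> in \<open>X = Y/G\<close>.

  Up to a unit, \<open>N = \<phi> / \<pi>K\<^sup>m\<close> is the product of the conjugates of \<open>y\<close>. The preimage in \<open>Y\<close> of
  \<open>X - D\<close> is the locus where \<open>1/N\<close> is regular; as \<open>y\<close> is a factor of \<open>N\<close>, it lies in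
  \<open>Spec RL[1/y]\<close> and equals \<open>Spec C\<close>, where \<open>C\<close> consists of the fractions \<open>f(y) / N\<^sup>n\<close> with
  \<open>deg f \<le> p n\<close>.

  To see that \<open>C\<^sup>G = A\<close>, expand the numerator of an invariant \<open>h(x) / N\<^sup>n\<close> in powers of \<open>N\<close>. The
  coefficients \<open>r \<in> K[x]\<close> of this expansion have degree below \<open>p\<close>, and they lie in \<open>RL[y]\<close>
  because \<open>N\<close> has a unit as leading coefficient in \<open>y\<close>; at \<open>y = 0\<close> this gives
  \<open>r(\<pi>L) \<in> RL\<close>. The terms of \<open>r(\<pi>L)\<close> have distinct valuations modulo \<open>p\<close>, so
  \<open>r \<in> R[x]\<close>. Hence \<open>A\<close> is free over \<open>R\<close> on \<open>1\<close> and the products \<open>x\<^sub>i x\<^sub>0\<^sup>k\<close>. Modulo the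
  minors the product of the entries number \<open>i\<close> and \<open>j\<close> of \<open>x\<^sub>0, \<dots>, x\<^sub>p\<^sub>-\<^sub>1, z\<close> depends only on
  \<open>i + j\<close>, which reduces every polynomial to a combination of these basis elements.
\<close>

section \<open>Subrings of a field and their localizations\<close>

text \<open>Two normalisations make the computation work. The exponent \<open>m\<close> is chosen so
  that every \<open>(g \<pi> - \<pi>) / \<pi> ^ m\<close> is integral, hence the group acts on
  \<open>RL[y]\<close> by affine substitutions in \<open>y\<close>. The substitution
  \<open>x = \<pi> + \<pi> ^ m * y\<close> pulls a factor \<open>\<pi> ^ (m * p)\<close> out of
  \<phi>; dividing by the power \<open>m\<close> of the constant coefficient, which has valuation
  \<open>p\<close>, compensates it exactly, and this is why \<open>N\<close> has a unit as leading
  coefficient in \<open>y\<close>. The obstacle is that \<open>C\<close> is described by integrality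
  over \<open>RL\<close> in the coordinate \<open>y\<close>, whereas \<open>A\<close> asks for
  coefficients in \<open>R\<close> in the coordinate \<open>x\<close>. Division by \<open>N\<close>
  is the operation that can be read in both coordinates at once. The chart \<open>RL[1/y]\<close>
  itself is in general not preserved by the group, so no quotient of it can be formed. Its
  localization \<open>C\<close> at \<open>N / y ^ p\<close> is preserved, and this function is a
  unit wherever \<open>1/y\<close> vanishes, so the point at infinity is not lost. Neither integral
  extensions nor quotients of schemes are taken from elsewhere: lying over, conjugacy of primes and
  localization of invariants are derived from norms and orbit polynomials.\<close>

lemma amb_simps [simp]:
  "carrier (amb :: 'a::comm_ring_1 ring) = UNIV"
  "monoid.mult (amb :: 'a ring) = (*)"
  "one (amb :: 'a ring) = 1"
  "ring.zero (amb :: 'a ring) = 0"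
  "add (amb :: 'a ring) = (+)"
  by (auto simp: ring_of_type_algebra_def)

lemma a_inv_amb [simp]: "a_inv (amb :: 'a::comm_ring_1 ring) x = - x"
proof -
  interpret ring "amb :: 'a ring" by rule
  show ?thesis by (rule minus_equality) auto
qed

lemma subring_amb_iff:
  "subring A (amb :: 'a::comm_ring_1 ring) \<longleftrightarrow> 1 \<in> A \<and> (\<forall>a\<in>A. \<forall>b\<in>A. a - b \<in> A \<and> a * b \<in> A)"
proof
  assume A: "subring A amb"
  have "a - b \<in> A" if "a \<in> A" "b \<in> A" for a b
    using subringE(7)[OF A that(1) subringE(5)[OF A that(2)]] by simp
  then show "1 \<in> A \<and> (\<forall>a\<in>A. \<forall>b\<in>A. a - b \<in> A \<and> a * b \<in> A)"
    using subringE(3,6)[OF A] by auto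
next
  assume A: "1 \<in> A \<and> (\<forall>a\<in>A. \<forall>b\<in>A. a - b \<in> A \<and> a * b \<in> A)"
  interpret ring "amb :: 'a ring" by rule
  have 0: "0 \<in> A" using A by (metis cancel_comm_monoid_add_class.diff_cancel)
  have m: "- a \<in> A" if "a \<in> A" for a
    using A 0 that by (metis diff_0)
  show "subring A amb"
  proof (rule subringI)
    show "h1 \<oplus>\<^bsub>amb\<^esub> h2 \<in> A" if "h1 \<in> A" "h2 \<in> A" for h1 h2
      using A m[OF that(2)] that(1) by (metis amb_simps(5) diff_minus_eq_add)
  qed (use A m in auto)
qed

lemma subring_amb_closed:
  assumes "subring A (amb :: 'a::comm_ring_1 ring)"
  shows "0 \<in> A" "1 \<in> A"
    "a \<in> A \<Longrightarrow> b \<in> A \<Longrightarrow> a + b \<in> A" "a \<in> A \<Longrightarrow> b \<in> A \<Longrightarrow> a - b \<in> A"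
    "a \<in> A \<Longrightarrow> - a \<in> A" "a \<in> A \<Longrightarrow> b \<in> A \<Longrightarrow> a * b \<in> A" "a \<in> A \<Longrightarrow> a ^ n \<in> A"
    "(\<And>i. i \<in> I \<Longrightarrow> f i \<in> A) \<Longrightarrow> sum f I \<in> A" "(\<And>i. i \<in> I \<Longrightarrow> f i \<in> A) \<Longrightarrow> prod f I \<in> A"
proof -
  note A = assms[unfolded subring_amb_iff]
  show 0: "0 \<in> A" using A by (metis cancel_comm_monoid_add_class.diff_cancel)
  show 1: "1 \<in> A" using A by simp
  have m: "- a \<in> A" if "a \<in> A" for a
    using A 0 that by (metis diff_0)
  have p: "a + b \<in> A" if "a \<in> A" "b \<in> A" for a b
    using A m[OF that(2)] that(1) by (metis diff_minus_eq_add)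
  have t: "a * b \<in> A" if "a \<in> A" "b \<in> A" for a b
    using A that by blast
  show "a \<in> A \<Longrightarrow> b \<in> A \<Longrightarrow> a + b \<in> A" "a \<in> A \<Longrightarrow> - a \<in> A"
    by (fact p m)+
  show "a \<in> A \<Longrightarrow> b \<in> A \<Longrightarrow> a - b \<in> A" using A by blast
  show "a \<in> A \<Longrightarrow> b \<in> A \<Longrightarrow> a * b \<in> A" by (fact t)
  show "a \<in> A \<Longrightarrow> a ^ n \<in> A" by (induction n) (simp_all add: 1 t)
  show "(\<And>i. i \<in> I \<Longrightarrow> f i \<in> A) \<Longrightarrow> sum f I \<in> A"
    by (induction I rule: infinite_finite_induct) (simp_all add: 0 p)
  show "(\<And>i. i \<in> I \<Longrightarrow> f i \<in> A) \<Longrightarrow> prod f I \<in> A"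
    by (induction I rule: infinite_finite_induct) (simp_all add: 1 t)
qed

lemma cring_sub_ring:
  assumes "subring A (amb :: 'a::comm_ring_1 ring)"
  shows "cring (sub_ring A)"
proof -
  interpret cring "amb :: 'a ring" by rule
  show ?thesis
    using subcringI'[OF assms] subcring_iff[of A] by simp
qed

lemma ideal_sub_ring_iff:
  assumes "subring A (amb :: 'a::comm_ring_1 ring)"
  shows "ideal I (sub_ring A) \<longleftrightarrow>
    I \<subseteq> A \<and> 0 \<in> I \<and> (\<forall>a\<in>I. \<forall>b\<in>I. a + b \<in> I) \<and> (\<forall>a\<in>A. \<forall>b\<in>I. a * b \<in> I)" (is "_ \<longleftrightarrow> ?R")
proof
  interpret cring "sub_ring A" by (rule cring_sub_ring[OF assms])
  assume "ideal I (sub_ring A)"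
  then interpret I: ideal I "sub_ring A" .
  show ?R
    using I.a_subset I.zero_closed I.a_closed I.I_l_closed by auto
next
  interpret cring "sub_ring A" by (rule cring_sub_ring[OF assms])
  assume R: ?R
  have inv: "\<ominus>\<^bsub>sub_ring A\<^esub> a = - a" if "a \<in> A" for a
    by (rule minus_equality) (use that subring_amb_closed[OF assms] in auto)
  have neg: "- a \<in> I" if "a \<in> I" for a
    using R that subring_amb_closed(5)[OF assms subring_amb_closed(2)[OF assms]]
    by (metis mult_minus1)
  have comm: "a * x \<in> I" if "a \<in> I" "x \<in> A" for a x
    using R that by (metis mult.commute)
  have "subgroup I (add_monoid (sub_ring A))"
    by (rule add.subgroupI)
      (use R inv neg in \<open>auto simp flip: a_inv_def\<close>)
  then show "ideal I (sub_ring A)"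
    by (rule idealI[OF ring_axioms]) (use R comm in auto)
qed

lemma primeideal_sub_ring_iff:
  assumes "subring A (amb :: 'a::comm_ring_1 ring)"
  shows "primeideal P (sub_ring A) \<longleftrightarrow>
    ideal P (sub_ring A) \<and> 1 \<notin> P \<and> (\<forall>a\<in>A. \<forall>b\<in>A. a * b \<in> P \<longrightarrow> a \<in> P \<or> b \<in> P)" (is "_ \<longleftrightarrow> ?R")
proof
  interpret cring "sub_ring A" by (rule cring_sub_ring[OF assms])
  assume "primeideal P (sub_ring A)"
  then interpret P: primeideal P "sub_ring A" .
  show ?R
    using P.I_prime P.I_notcarr P.one_imp_carrier P.is_ideal by auto
next
  assume ?R
  then show "primeideal P (sub_ring A)"
    using cring_sub_ring[OF assms] subring_amb_closed(2)[OF assms]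
    by (intro primeidealI) auto
qed

lemmas primeideal_ideal = primeideal.axioms(1)

lemma ideal_sub_ring_closed:
  assumes A: "subring A (amb :: 'a::comm_ring_1 ring)" and I: "ideal I (sub_ring A)"
  shows "I \<subseteq> A" "0 \<in> I" "a \<in> I \<Longrightarrow> b \<in> I \<Longrightarrow> a + b \<in> I" "a \<in> I \<Longrightarrow> - a \<in> I"
    "a \<in> I \<Longrightarrow> b \<in> I \<Longrightarrow> a - b \<in> I"
    "a \<in> A \<Longrightarrow> b \<in> I \<Longrightarrow> a * b \<in> I" "a \<in> I \<Longrightarrow> b \<in> A \<Longrightarrow> a * b \<in> I"
    "(\<And>i. i \<in> S \<Longrightarrow> f i \<in> I) \<Longrightarrow> sum f S \<in> I"
proof -
  note R = I[unfolded ideal_sub_ring_iff[OF A]]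
  show "I \<subseteq> A" "0 \<in> I" "a \<in> I \<Longrightarrow> b \<in> I \<Longrightarrow> a + b \<in> I" "a \<in> A \<Longrightarrow> b \<in> I \<Longrightarrow> a * b \<in> I"
    "a \<in> I \<Longrightarrow> b \<in> A \<Longrightarrow> a * b \<in> I"
    using R by (auto simp: mult.commute)
  have neg: "- a \<in> I" if "a \<in> I" for a
    using R that subring_amb_closed(5)[OF A subring_amb_closed(2)[OF A]]
    by (metis mult_minus1)
  then show "a \<in> I \<Longrightarrow> - a \<in> I" .
  show "a \<in> I \<Longrightarrow> b \<in> I \<Longrightarrow> a - b \<in> I"
    using R neg by (metis diff_conv_add_uminus)
  show "(\<And>i. i \<in> S \<Longrightarrow> f i \<in> I) \<Longrightarrow> sum f S \<in> I"
    by (induction S rule: infinite_finite_induct) (use R in auto)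
qed

lemma primeideal_sub_ring_closed:
  assumes A: "subring A (amb :: 'a::comm_ring_1 ring)" and P: "primeideal P (sub_ring A)"
  shows "1 \<notin> P" "a \<in> A \<Longrightarrow> b \<in> A \<Longrightarrow> a * b \<in> P \<longleftrightarrow> a \<in> P \<or> b \<in> P"
    "a \<in> A \<Longrightarrow> a ^ n \<in> P \<Longrightarrow> a \<in> P"
    "finite S \<Longrightarrow> (\<And>i. i \<in> S \<Longrightarrow> f i \<in> A) \<Longrightarrow> prod f S \<in> P \<longleftrightarrow> (\<exists>i\<in>S. f i \<in> P)"
proof -
  note R = P[unfolded primeideal_sub_ring_iff[OF A]]
  have I: "ideal P (sub_ring A)" using R by simp
  show 1: "1 \<notin> P" using R by simp
  show m: "a * b \<in> P \<longleftrightarrow> a \<in> P \<or> b \<in> P" if "a \<in> A" "b \<in> A" for a b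
    using R that ideal_sub_ring_closed(6,7)[OF A I] by blast
  show "a \<in> P" if "a \<in> A" "a ^ n \<in> P"
    using that(2)
  proof (induction n)
    case (Suc n)
    then show ?case using m[OF that(1) subring_amb_closed(7)[OF A that(1)]] by auto
  qed (use 1 in simp)
  show "finite S \<Longrightarrow> (\<And>i. i \<in> S \<Longrightarrow> f i \<in> A) \<Longrightarrow> prod f S \<in> P \<longleftrightarrow> (\<exists>i\<in>S. f i \<in> P)"
  proof (induction S rule: finite_induct)
    case (insert x S)
    then have "prod f S \<in> A" by (intro subring_amb_closed(9)[OF A]) auto
    with insert show ?case using m[of "f x" "prod f S"] by simp
  qed (use 1 in simp)
qed

text \<open>The trace on \<open>B\<close> of the maximal ideal of \<open>\<O>\<close>. As \<open>inverse 0 = 0\<close> belongs to every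
  subring, \<open>0\<close> has to be added by hand.\<close>

definition center :: "'f::field set \<Rightarrow> 'f set \<Rightarrow> 'f set" where
  "center B \<O> = {b \<in> B. b = 0 \<or> inverse b \<notin> \<O>}"

lemma mem_localization_iff:
  "f \<in> localization A P \<longleftrightarrow> (\<exists>a\<in>A. \<exists>b\<in>A - P. f = a / b)"
  by (auto simp: localization_def)

context
  fixes B P :: "'f::field set"
  assumes B: "subring B amb" and P: "primeideal P (sub_ring B)"
begin

lemma zero_mem_prime: "0 \<in> P"
  using ideal_sub_ring_closed(2)[OF B primeideal_ideal[OF P]] .

lemma subset_localization: "B \<subseteq> localization B P"
proof
  fix b assume "b \<in> B"
  then have "b = b / 1 \<and> 1 \<in> B - P"
    using subring_amb_closed(2)[OF B] primeideal_sub_ring_closed(1)[OF B P] by simp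
  with \<open>b \<in> B\<close> show "b \<in> localization B P" unfolding mem_localization_iff by blast
qed

lemma inverse_mem_localization_iff:
  assumes "b \<in> B" "b \<noteq> 0"
  shows "inverse b \<in> localization B P \<longleftrightarrow> b \<notin> P"
proof
  assume "inverse b \<in> localization B P"
  then obtain a c where ac: "a \<in> B" "c \<in> B - P" "inverse b = a / c"
    unfolding mem_localization_iff by blast
  then have "c \<noteq> 0" using zero_mem_prime by auto
  then have "c = a * b" using ac(3) assms by (simp add: field_simps)
  then show "b \<notin> P"
    using ac ideal_sub_ring_closed(6)[OF B primeideal_ideal[OF P]] by auto
next
  assume "b \<notin> P"
  then show "inverse b \<in> localization B P"
    unfolding mem_localization_iff using assms subring_amb_closed(2)[OF B]
    by (intro bexI[of _ 1] bexI[of _ b]) (auto simp: field_simps)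
qed

lemma center_localization: "center B (localization B P) = P"
  using inverse_mem_localization_iff zero_mem_prime ideal_sub_ring_closed(1)[OF B primeideal_ideal[OF P]]
  by (auto simp: center_def)

lemma subring_localization: "subring (localization B P) amb"
proof -
  note cl = subring_amb_closed[OF B]
  note pr = primeideal_sub_ring_closed[OF B P]
  have "f - g \<in> localization B P \<and> f * g \<in> localization B P"
    if "f \<in> localization B P" "g \<in> localization B P" for f g
  proof -
    obtain a b c d where *: "a \<in> B" "b \<in> B - P" "f = a / b" "c \<in> B" "d \<in> B - P" "g = c / d"
      using \<open>f \<in> _\<close> \<open>g \<in> _\<close> unfolding mem_localization_iff by blast
    have "b \<noteq> 0" "d \<noteq> 0" using * zero_mem_prime by auto
    then have "f - g = (a * d - c * b) / (b * d)" "f * g = (a * c) / (b * d)"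
      using * by (simp_all add: field_simps)
    moreover have "b * d \<in> B - P" "a * d - c * b \<in> B" "a * c \<in> B"
      using * pr(2)[of b d] cl by auto
    ultimately show ?thesis unfolding mem_localization_iff by blast
  qed
  moreover have "1 \<in> localization B P"
    using subset_localization cl(2) by blast
  ultimately show ?thesis unfolding subring_amb_iff by blast
qed

text \<open>Every element of the intermediate ring is already a fraction \<open>a / b\<close> with
  \<open>b\<close> outside \<open>P\<close>, so the maximal ideal of the local ring contracts to a
  prime of \<open>C\<close> and no new local ring arises. This is the step from a chart up to a
  larger ring that is still regular at the given point.\<close>

lemma localization_center_intermediate:
  assumes C: "subring C amb" and BC: "B \<subseteq> C" and CO: "C \<subseteq> localization B P"
  shows "primeideal (center C (localization B P)) (sub_ring C)"
    and "localization C (center C (localization B P)) = localization B P"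
proof -
  let ?O = "localization B P" and ?Q = "center C (localization B P)"
  note clO = subring_amb_closed[OF subring_localization]
  note cl = subring_amb_closed[OF C]
  \<comment> \<open>Being a nonunit of the local ring is not visibly additive; having a
    representation with numerator in \<open>P\<close> is, and it is this form that yields the ideal
    properties.\<close>
  have Q: "?Q = {c \<in> C. \<exists>a\<in>P. \<exists>b\<in>B - P. c = a / b}"
  proof safe
    fix c assume "c \<in> ?Q"
    then have c: "c \<in> C" "c = 0 \<or> inverse c \<notin> ?O" by (auto simp: center_def)
    then have "c \<in> ?O" using CO by blast
    then obtain a b where ab: "a \<in> B" "b \<in> B - P" "c = a / b"
      unfolding mem_localization_iff by blast
    have "a \<in> P"
    proof (rule ccontr)
      assume "a \<notin> P"
      then have "inverse c = b / a" "a \<in> B - P" "c \<noteq> 0"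
        using ab zero_mem_prime by auto
      then have "inverse c \<in> ?O" "c \<noteq> 0"
        using ab(2) unfolding mem_localization_iff by blast+
      with c show False by simp
    qed
    with ab show "\<exists>a\<in>P. \<exists>b\<in>B - P. c = a / b" by blast
    show "c \<in> C" using c by simp
  next
    fix a b assume ab: "a / b \<in> C" "a \<in> P" "b \<in> B" "b \<notin> P"
    have aB: "a \<in> B" using ab ideal_sub_ring_closed(1)[OF B primeideal_ideal[OF P]] by auto
    have "b \<in> ?O" using subset_localization ab by auto
    have "b \<noteq> 0" using ab zero_mem_prime by auto
    have "inverse a \<in> ?O" if "inverse (a / b) \<in> ?O" "a \<noteq> 0"
    proof -
      have "inverse b \<in> ?O"
        using inverse_mem_localization_iff[OF ab(3) \<open>b \<noteq> 0\<close>] ab(4) by simp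
      from clO(6)[OF that(1) this] show ?thesis
        using \<open>b \<noteq> 0\<close> by (simp add: field_simps)
    qed
    then have "a / b = 0 \<or> inverse (a / b) \<notin> ?O"
      using ab(2) inverse_mem_localization_iff[OF aB] by auto
    then show "a / b \<in> ?Q"
      using ab(1) by (simp add: center_def)
  qed
  note clB = subring_amb_closed[OF B]
  note pr = primeideal_sub_ring_closed[OF B P]
  note pid = ideal_sub_ring_closed[OF B primeideal_ideal[OF P]]
  have add: "c + c' \<in> ?Q" if "c \<in> ?Q" "c' \<in> ?Q" for c c'
  proof -
    obtain a b a' b' where *: "a \<in> P" "b \<in> B - P" "c = a / b" "a' \<in> P" "b' \<in> B - P" "c' = a' / b'"
      using \<open>c \<in> ?Q\<close> \<open>c' \<in> ?Q\<close> unfolding Q by blast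
    have "b \<noteq> 0" "b' \<noteq> 0" using * zero_mem_prime by auto
    then have "c + c' = (a * b' + a' * b) / (b * b')"
      using * by (simp add: field_simps)
    moreover have "b * b' \<in> B - P"
      using * pr(2)[of b b'] clB(6)[of b b'] by simp
    moreover have "a * b' + a' * b \<in> P"
      using * pid(3,7) by simp
    moreover have "c + c' \<in> C" using that cl(3) unfolding center_def by simp
    ultimately show ?thesis unfolding Q by blast
  qed
  have mult: "c * c' \<in> ?Q" if "c \<in> C" "c' \<in> ?Q" for c c'
  proof -
    obtain a b a' b' where *: "a \<in> B" "b \<in> B - P" "c = a / b" "a' \<in> P" "b' \<in> B - P" "c' = a' / b'"
      using subsetD[OF CO \<open>c \<in> C\<close>] \<open>c' \<in> ?Q\<close> unfolding Q mem_localization_iff by blast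
    then have "c * c' = (a * a') / (b * b')" by simp
    moreover have "b * b' \<in> B - P"
      using * pr(2)[of b b'] clB(6)[of b b'] by simp
    moreover have "a * a' \<in> P"
      using * pid(6) by simp
    moreover have "c * c' \<in> C" using that cl(6) unfolding center_def by simp
    ultimately show ?thesis unfolding Q by blast
  qed
  have prime: "c \<in> ?Q \<or> c' \<in> ?Q" if "c \<in> C" "c' \<in> C" "c * c' \<in> ?Q" for c c'
    using that clO(6)[of "inverse c" "inverse c'"] by (auto simp: center_def)
  show 1: "primeideal ?Q (sub_ring C)"
    unfolding primeideal_sub_ring_iff[OF C] ideal_sub_ring_iff[OF C]
  proof (intro conjI ballI impI)
    show "?Q \<subseteq> C" "0 \<in> ?Q" "1 \<notin> ?Q"
      using cl(1) clO(2) by (auto simp: center_def)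
  qed (fact add mult prime)+
  show "localization C ?Q = ?O"
  proof
    show "localization C ?Q \<subseteq> ?O"
    proof
      fix f assume "f \<in> localization C ?Q"
      then obtain a b where "a \<in> C" "b \<in> C - ?Q" "f = a / b" unfolding mem_localization_iff by blast
      then have "a \<in> ?O" "inverse b \<in> ?O" "f = a * inverse b"
        using CO by (auto simp: center_def field_simps)
      then show "f \<in> ?O" using clO(6) by simp
    qed
    show "?O \<subseteq> localization C ?Q"
    proof
      fix f assume "f \<in> ?O"
      then obtain a b where ab: "a \<in> B" "b \<in> B - P" "f = a / b" unfolding mem_localization_iff by blast
      then have "b \<noteq> 0" using zero_mem_prime by auto
      then have "b \<in> C - ?Q" using ab BC inverse_mem_localization_iff unfolding center_def by blast
      then show "f \<in> localization C ?Q" using ab BC unfolding mem_localization_iff by blast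
    qed
  qed
qed

end

text \<open>Here \<open>C\<close> is a ring of fractions of \<open>B\<close>: its denominators
  become units, so they avoid every prime of \<open>C\<close>, and a fraction of elements of
  \<open>C\<close> can be rewritten over \<open>B\<close>. Combined with the step upwards to a
  larger ring, this carries a point from one chart to another without changing its local
  ring.\<close>

lemma localization_of_fractions:
  fixes B C Q :: "'f::field set"
  assumes B: "subring B amb" and C: "subring C amb" and Q: "primeideal Q (sub_ring C)"
    and BC: "B \<subseteq> C"
    and frac: "\<And>c. c \<in> C \<Longrightarrow> \<exists>b\<in>B. \<exists>s\<in>B - {0}. inverse s \<in> C \<and> c = b / s"
  shows "primeideal (Q \<inter> B) (sub_ring B)" and "localization B (Q \<inter> B) = localization C Q"
proof -
  note clC = subring_amb_closed[OF C]
  note pr = primeideal_sub_ring_closed[OF C Q]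
  note id = ideal_sub_ring_closed[OF C primeideal_ideal[OF Q]]
  show "primeideal (Q \<inter> B) (sub_ring B)"
    unfolding primeideal_sub_ring_iff[OF B] ideal_sub_ring_iff[OF B]
  proof (intro conjI ballI impI)
    show "Q \<inter> B \<subseteq> B" "0 \<in> Q \<inter> B" "1 \<notin> Q \<inter> B"
      using id(2) pr(1) subring_amb_closed(1)[OF B] by auto
    show "a + b \<in> Q \<inter> B" if "a \<in> Q \<inter> B" "b \<in> Q \<inter> B" for a b
      using that id(3) subring_amb_closed(3)[OF B] by simp
    show "a * b \<in> Q \<inter> B" if "a \<in> B" "b \<in> Q \<inter> B" for a b
      using that id(6) subring_amb_closed(6)[OF B] BC by blast
    show "a \<in> Q \<inter> B \<or> b \<in> Q \<inter> B" if "a \<in> B" "b \<in> B" "a * b \<in> Q \<inter> B" for a b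
      using that pr(2) BC by blast
  qed
  show "localization B (Q \<inter> B) = localization C Q"
  proof
    show "localization B (Q \<inter> B) \<subseteq> localization C Q"
      unfolding localization_def using BC by blast
    show "localization C Q \<subseteq> localization B (Q \<inter> B)"
    proof
      fix f assume "f \<in> localization C Q"
      then obtain c d where cd: "c \<in> C" "d \<in> C" "d \<notin> Q" "f = c / d" unfolding mem_localization_iff by blast
      obtain b s where bs: "b \<in> B" "s \<in> B" "s \<noteq> 0" "inverse s \<in> C" "c = b / s" using frac[OF cd(1)] by blast
      obtain b' s' where bs': "b' \<in> B" "s' \<in> B" "s' \<noteq> 0" "inverse s' \<in> C" "d = b' / s'" using frac[OF cd(2)] by blast
      have "s \<notin> Q" using id(6)[OF bs(4), of s] bs(3) pr(1) by auto
      have "b' = d * s'" using bs' by simp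
      moreover have "s' \<notin> Q" using id(6)[OF bs'(4), of s'] bs'(3) pr(1) by auto
      ultimately have "b' \<notin> Q" using pr(2)[of d s'] cd bs' BC by auto
      then have "s * b' \<in> B - (Q \<inter> B)"
        using pr(2)[of s b'] \<open>s \<notin> Q\<close> bs bs' BC subring_amb_closed(6)[OF B] by auto
      moreover have "f = (b * s') / (s * b')" using cd bs bs' by simp
      moreover have "b * s' \<in> B" using bs bs' subring_amb_closed(6)[OF B] by auto
      ultimately show "f \<in> localization B (Q \<inter> B)" unfolding mem_localization_iff by blast
    qed
  qed
qed

section \<open>Invariants of finite groups of automorphisms\<close>

locale finite_field_auts =
  fixes G :: "('f::field \<Rightarrow> 'f) set"
  assumes finite_G: "finite G"
    and id_mem: "id \<in> G"
    and comp_mem: "g \<in> G \<Longrightarrow> h \<in> G \<Longrightarrow> g \<circ> h \<in> G"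
    and inv_mem: "g \<in> G \<Longrightarrow> \<exists>h\<in>G. h \<circ> g = id \<and> g \<circ> h = id"
    and hom_add: "g \<in> G \<Longrightarrow> g (a + b) = g a + g b"
    and hom_mult: "g \<in> G \<Longrightarrow> g (a * b) = g a * g b"
    and hom_one: "g \<in> G \<Longrightarrow> g 1 = 1"
begin

lemma hom_zero: "g \<in> G \<Longrightarrow> g 0 = 0"
  using hom_add[of g 0 0] by (metis add.right_neutral add_left_cancel)

lemma hom_uminus: "g \<in> G \<Longrightarrow> g (- a) = - g a"
  using hom_add[of g a "- a"] hom_zero[of g] by (simp add: eq_neg_iff_add_eq_0 add.commute)

lemma hom_diff: "g \<in> G \<Longrightarrow> g (a - b) = g a - g b"
  using hom_add[of g a "- b"] hom_uminus[of g b] by simp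

lemma hom_eq_zero_iff: "g \<in> G \<Longrightarrow> g a = 0 \<longleftrightarrow> a = 0"
proof
  assume g: "g \<in> G" and "g a = 0"
  then show "a = 0"
    using hom_mult[OF g, of a "inverse a"] hom_one[OF g] by (cases "a = 0") auto
qed (simp add: hom_zero)

lemma hom_inverse: "g \<in> G \<Longrightarrow> g (inverse a) = inverse (g a)"
proof (cases "a = 0")
  case False
  assume g: "g \<in> G"
  have "g a * g (inverse a) = 1"
    using hom_mult[OF g, of a "inverse a"] hom_one[OF g] False by simp
  then show ?thesis by (metis inverse_unique)
qed (simp add: hom_zero)

lemma hom_divide: "g \<in> G \<Longrightarrow> g (a / b) = g a / g b"
  by (simp add: divide_inverse hom_mult hom_inverse)

lemma hom_power: "g \<in> G \<Longrightarrow> g (a ^ n) = g a ^ n"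
  by (induction n) (simp_all add: hom_one hom_mult)

lemma hom_prod: "g \<in> G \<Longrightarrow> g (prod f I) = (\<Prod>i\<in>I. g (f i))"
  by (induction I rule: infinite_finite_induct) (simp_all add: hom_one hom_mult)

lemma hom_sum: "g \<in> G \<Longrightarrow> g (sum f I) = (\<Sum>i\<in>I. g (f i))"
  by (induction I rule: infinite_finite_induct) (simp_all add: hom_zero hom_add)

lemma inj_G: "g \<in> G \<Longrightarrow> inj g"
  using inv_mem[of g] by (metis comp_apply id_apply injI)

lemma comp_left_bij: "h \<in> G \<Longrightarrow> bij_betw ((\<circ>) h) G G"
proof -
  assume h: "h \<in> G"
  then obtain k where k: "k \<in> G" "k \<circ> h = id" "h \<circ> k = id" using inv_mem by blast
  then have "k \<circ> (h \<circ> g) = g" "h \<circ> (k \<circ> g) = g" for g by (simp_all add: o_assoc)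
  then show ?thesis
    by (intro bij_betwI[of _ _ _ "(\<circ>) k"]) (use h k(1) comp_mem in auto)
qed

lemma prod_G_reindex: "h \<in> G \<Longrightarrow> (\<Prod>g\<in>G. f (h \<circ> g)) = (\<Prod>g\<in>G. f g)"
  using prod.reindex_bij_betw[OF comp_left_bij] .

text \<open>Two powers coincide by the pigeonhole principle and injectivity cancels the common part.
  Finite order later turns an inclusion between conjugate primes into an equality.\<close>

lemma finite_order: "g \<in> G \<Longrightarrow> \<exists>n>0. g ^^ n = id"
proof -
  assume g: "g \<in> G"
  have "g ^^ n \<in> G" for n
  proof (induction n)
    case 0
    then show ?case unfolding funpow.simps by (rule id_mem)
  next
    case (Suc n)
    then show ?case unfolding funpow.simps by (rule comp_mem[OF g])
  qed
  then have "\<not> inj (\<lambda>n. g ^^ n)"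
    using finite_G finite_subset[of "range (\<lambda>n. g ^^ n)" G] finite_imageD by blast
  then obtain i j where "i < j" "g ^^ i = g ^^ j"
    by (metis injI linorder_neqE_nat)
  then have "(g ^^ i) \<circ> (g ^^ (j - i)) = (g ^^ i) \<circ> id"
    by (metis add_diff_inverse_nat comp_id funpow_add nat_less_le not_less)
  moreover have "inj (g ^^ i)" by (rule inj_fn[OF inj_G[OF g]])
  ultimately have "g ^^ (j - i) = id" by (meson fun.inj_map injD)
  with \<open>i < j\<close> show ?thesis by (intro exI[of _ "j - i"]) simp
qed

definition norm_G :: "'f \<Rightarrow> 'f" where
  "norm_G c = (\<Prod>g\<in>G. g c)"

lemma norm_G_invariant: "h \<in> G \<Longrightarrow> h (norm_G c) = norm_G c"
  using prod_G_reindex[of h "\<lambda>g. g c"] by (simp add: norm_G_def hom_prod)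

text \<open>For an invariant function, regularity at a point depends only on the orbit of the
  point.\<close>

lemma mem_image_G_iff:
  assumes "g \<in> G" "\<forall>h\<in>G. h f = f"
  shows "f \<in> g ` S \<longleftrightarrow> f \<in> S"
proof
  assume "f \<in> g ` S"
  then obtain s where "s \<in> S" "g s = f" by blast
  then have "s = f" using assms inj_G[of g] by (metis injD)
  with \<open>s \<in> S\<close> show "f \<in> S" by simp
qed (use assms in force)

lemma mem_point_orbit: "S \<in> point_orbit G S"
  unfolding point_orbit_def by (intro CollectI exI[of _ id] conjI id_mem) simp

lemma point_orbit_image:
  assumes "g \<in> G"
  shows "point_orbit G (g ` S) = point_orbit G S"
proof -
  obtain k where k: "k \<in> G" "k \<circ> g = id" using inv_mem[OF assms] by blast
  show ?thesis
  proof (intro equalityI subsetI)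
    fix T assume "T \<in> point_orbit G (g ` S)"
    then obtain h where "h \<in> G" "T = (h \<circ> g) ` S" by (auto simp: point_orbit_def image_comp)
    then show "T \<in> point_orbit G S" using comp_mem assms unfolding point_orbit_def by blast
  next
    fix T assume "T \<in> point_orbit G S"
    then obtain h where "h \<in> G" "T = h ` S" by (auto simp: point_orbit_def)
    moreover have "h = (h \<circ> k) \<circ> g" using k by (metis comp_assoc comp_id)
    ultimately show "T \<in> point_orbit G (g ` S)"
      using comp_mem k(1) unfolding point_orbit_def by (metis (mono_tags, lifting) image_comp mem_Collect_eq)
  qed
qed

text \<open>An element of the group only permutes the linear factors. This serves both as the
  integral equation of an element over its ring of invariants and for the minimal polynomial of
  \<pi>.\<close>

lemma poly_prod_orbit_invariant:
  assumes "h \<in> G"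
  shows "h (poly.coeff (\<Prod>g\<in>G. [:- g c, 1:]) i) = poly.coeff (\<Prod>g\<in>G. [:- g c, 1:]) i"
proof -
  have mult: "map_poly h (p * q) = map_poly h p * map_poly h q" for p q
    by (rule poly_eqI) (simp add: coeff_map_poly hom_zero[OF assms] coeff_mult hom_sum[OF assms] hom_mult[OF assms])
  have "map_poly h (\<Prod>g\<in>S. [:- g c, 1:]) = (\<Prod>g\<in>S. [:- (h \<circ> g) c, 1:])" for S
    by (induction S rule: infinite_finite_induct)
      (simp_all add: mult map_poly_pCons hom_zero[OF assms] hom_one[OF assms] hom_uminus[OF assms]
        flip: one_pCons del: mult_pCons_left)
  then have "map_poly h (\<Prod>g\<in>G. [:- g c, 1:]) = (\<Prod>g\<in>G. [:- g c, 1:])"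
    using prod_G_reindex[OF assms, of "\<lambda>g. [:- g c, 1:]"] by simp
  then show ?thesis
    by (metis coeff_map_poly hom_zero[OF assms])
qed

end

locale invariant_subring = finite_field_auts G for G :: "('f::field \<Rightarrow> 'f) set" +
  fixes C A :: "'f set"
  assumes subring_C: "subring C amb"
    and stable_C: "g \<in> G \<Longrightarrow> c \<in> C \<Longrightarrow> g c \<in> C"
    and A_eq: "A = {c \<in> C. \<forall>g\<in>G. g c = c}"
begin

lemmas C_closed = subring_amb_closed[OF subring_C]

lemma A_subset: "A \<subseteq> C"
  by (auto simp: A_eq)

lemma subring_A: "subring A amb"
  unfolding subring_amb_iff A_eq using C_closed
  by (auto simp: hom_one hom_diff hom_mult)

lemmas A_closed = subring_amb_closed[OF subring_A]

lemma norm_G_mem: "c \<in> C \<Longrightarrow> norm_G c \<in> A"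
  unfolding A_eq using norm_G_invariant C_closed(9)[of G "\<lambda>g. g c"] stable_C by (simp add: norm_G_def)

lemma prime_inter: 
  assumes "primeideal Q (sub_ring C)"
  shows "primeideal (Q \<inter> A) (sub_ring A)"
proof -
  note i = ideal_sub_ring_closed[OF subring_C primeideal_ideal[OF assms]]
  note p = primeideal_sub_ring_closed[OF subring_C assms]
  show ?thesis
    unfolding primeideal_sub_ring_iff[OF subring_A] ideal_sub_ring_iff[OF subring_A]
  proof (intro conjI ballI impI)
    show "Q \<inter> A \<subseteq> A" "0 \<in> Q \<inter> A" "1 \<notin> Q \<inter> A"
      using i(2) p(1) A_closed(1) by auto
    show "a + b \<in> Q \<inter> A" if "a \<in> Q \<inter> A" "b \<in> Q \<inter> A" for a b
      using that i(3) A_closed(3) by simp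
    show "a * b \<in> Q \<inter> A" if "a \<in> A" "b \<in> Q \<inter> A" for a b
      using that i(6) A_closed(6) A_subset by blast
    show "a \<in> Q \<inter> A \<or> b \<in> Q \<inter> A" if "a \<in> A" "b \<in> A" "a * b \<in> Q \<inter> A" for a b
      using that p(2) A_subset by blast
  qed
qed

text \<open>Up to sign the coefficients are elementary symmetric functions of the roots, and all of
  them except the leading one contain at least one root in each summand.\<close>

lemma coeff_prod_linear_mem:
  assumes J: "ideal J (sub_ring C)" and "finite S" "\<And>g. g \<in> S \<Longrightarrow> f g \<in> J"
  shows "poly.coeff (\<Prod>g\<in>S. [:- f g, 1:]) i \<in> (if i < card S then J else C)"
    and "poly.coeff (\<Prod>g\<in>S. [:- f g, 1:]) (card S) = 1"
    and "Polynomial.degree (\<Prod>g\<in>S. [:- f g, 1:]) = card S"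
proof -
  note J_closed = ideal_sub_ring_closed[OF subring_C J]
  show "poly.coeff (\<Prod>g\<in>S. [:- f g, 1:]) i \<in> (if i < card S then J else C)"
    using assms(2,3)
  proof (induction S arbitrary: i rule: finite_induct)
    case empty
    then show ?case using C_closed(1,2) by (cases i) (auto simp: coeff_pCons)
  next
    case (insert x S)
    let ?p = "\<Prod>g\<in>S. [:- f g, 1:]"
    have IH: "poly.coeff ?p i \<in> (if i < card S then J else C)" for i
      using insert by simp
    then have IHC: "poly.coeff ?p i \<in> C" for i
      using J_closed(1) by (metis subsetD)
    have 1: "- f x * poly.coeff ?p i \<in> J"
      using J_closed(7)[OF J_closed(4)[OF insert(4)[of x]] IHC] by simp
    have eq: "poly.coeff (\<Prod>g\<in>insert x S. [:- f g, 1:]) i =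
        - f x * poly.coeff ?p i + (case i of 0 \<Rightarrow> 0 | Suc j \<Rightarrow> poly.coeff ?p j)"
      using insert(1,2) by (simp add: coeff_pCons split: nat.split)
    have 2: "(case i of 0 \<Rightarrow> 0 | Suc j \<Rightarrow> poly.coeff ?p j) \<in> (if i < card (insert x S) then J else C)"
    proof (cases i)
      case (Suc j)
      then show ?thesis using IH[of j] insert(1,2) by simp
    qed (use J_closed(2) insert(1,2) in simp)
    from 1 2 show ?case
      unfolding eq using J_closed(3) C_closed(3) J_closed(1) by (metis subsetD)
  qed
  have "Polynomial.degree (\<Prod>g\<in>S. [:- f g, 1:]) = (\<Sum>g\<in>S. Polynomial.degree [:- f g, 1:])"
    by (rule degree_prod_eq_sum_degree) simp
  then show d: "Polynomial.degree (\<Prod>g\<in>S. [:- f g, 1:]) = card S" by simp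
  show "poly.coeff (\<Prod>g\<in>S. [:- f g, 1:]) (card S) = 1"
    using lead_coeff_prod[of "\<lambda>g. [:- f g, 1:]" S] d by simp
qed

text \<open>Every element of an invariant ideal is a root of a monic polynomial whose lower coefficients
  are invariant elements of that ideal.\<close>

lemma invariant_ideal_subset_prime:
  assumes J: "ideal J (sub_ring C)" and stable: "\<And>g c. g \<in> G \<Longrightarrow> c \<in> J \<Longrightarrow> g c \<in> J"
    and Q: "primeideal Q (sub_ring C)" and JA: "J \<inter> A \<subseteq> Q"
  shows "J \<subseteq> Q"
proof
  fix c assume c: "c \<in> J"
  note i = ideal_sub_ring_closed[OF subring_C primeideal_ideal[OF Q]]
  have cC: "c \<in> C" using c ideal_sub_ring_closed(1)[OF subring_C J] by auto
  define p where "p = (\<Prod>g\<in>G. [:- g c, 1:])"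
  have p: "poly.coeff p i \<in> Q" if "i < card G" for i
    using coeff_prod_linear_mem(1)[OF J finite_G, of "\<lambda>g. g c" i] stable c that
      poly_prod_orbit_invariant[of _ c i] JA ideal_sub_ring_closed(1)[OF subring_C J]
    unfolding p_def A_eq by auto
  have "poly p c = 0"
    unfolding p_def poly_prod using id_mem finite_G by (intro prod_zero bexI[of _ id]) auto
  then have "(\<Sum>i\<le>card G. poly.coeff p i * c ^ i) = 0"
    using coeff_prod_linear_mem(3)[OF J finite_G, of "\<lambda>g. g c"] stable c
    by (simp add: poly_altdef p_def)
  then have "c ^ card G = - (\<Sum>i<card G. poly.coeff p i * c ^ i)"
    using coeff_prod_linear_mem(2)[OF J finite_G, of "\<lambda>g. g c"] stable c
    by (simp add: p_def lessThan_Suc_atMost[symmetric] eq_neg_iff_add_eq_0 add.commute)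
  also have "\<dots> \<in> Q"
    by (intro i(4,8) i(7) p C_closed(7) cC) auto
  finally show "c \<in> Q" using primeideal_sub_ring_closed(3)[OF subring_C Q cC] by blast
qed

lemma image_prime:
  assumes Q: "primeideal Q (sub_ring C)" and g: "g \<in> G"
  shows "primeideal (g ` Q) (sub_ring C)"
proof -
  obtain k where k: "k \<in> G" "g \<circ> k = id" "k \<circ> g = id" using inv_mem[OF g] by blast
  note i = ideal_sub_ring_closed[OF subring_C primeideal_ideal[OF Q]]
  note p = primeideal_sub_ring_closed[OF subring_C Q]
  have gk: "g (k x) = x" "k (g x) = x" for x using k by (metis comp_apply id_apply)+
  have mem: "x \<in> g ` Q \<longleftrightarrow> k x \<in> Q" for x
    using gk by (metis image_iff)
  show ?thesis
    unfolding primeideal_sub_ring_iff[OF subring_C] ideal_sub_ring_iff[OF subring_C]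
  proof (intro conjI ballI impI)
    show "g ` Q \<subseteq> C" using i(1) stable_C[OF g] by auto
    show "0 \<in> g ` Q" "1 \<notin> g ` Q"
      unfolding mem using i(2) p(1) hom_zero[OF k(1)] hom_one[OF k(1)] by auto
    show "a + b \<in> g ` Q" if "a \<in> g ` Q" "b \<in> g ` Q" for a b
      using that unfolding mem hom_add[OF k(1)] by (rule i(3))
    show "a * b \<in> g ` Q" if "a \<in> C" "b \<in> g ` Q" for a b
      using that stable_C[OF k(1)] i(6) unfolding mem hom_mult[OF k(1)] by auto
    show "a \<in> g ` Q \<or> b \<in> g ` Q" if "a \<in> C" "b \<in> C" "a * b \<in> g ` Q" for a b
      using that stable_C[OF k(1)] p(2) unfolding mem hom_mult[OF k(1)] by auto
  qed
qed

lemma image_localization: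
  assumes g: "g \<in> G"
  shows "g ` localization C Q = localization C (g ` Q)"
proof -
  obtain k where k: "k \<in> G" "g \<circ> k = id" using inv_mem[OF g] by blast
  have gk: "g (k x) = x" for x using k by (metis comp_apply id_apply)
  have C: "g ` C = C"
    using stable_C[OF g] stable_C[OF k(1)] gk by (metis image_iff image_subsetI subsetI subset_antisym)
  have "f \<in> g ` localization C Q \<longleftrightarrow> f \<in> localization (g ` C) (g ` Q)" for f
    unfolding localization_def using inj_G[OF g]
    by (auto simp: hom_divide[OF g] inj_image_mem_iff image_iff) (metis hom_divide[OF g] inj_image_mem_iff)+
  then show ?thesis unfolding C by blast
qed

text \<open>Zorn's lemma gives an ideal \<open>Q\<close> that is maximal with \<open>Q \<inter> A \<subseteq> P\<close>.
  If \<open>s = q + a c\<close> with \<open>q \<in> Q\<close>, \<open>a \<in> P\<close>, \<open>s \<in> A - P\<close>, then the norm of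
  \<open>q = s - a c\<close> lies in \<open>P\<close> and is congruent to a power of \<open>s\<close> modulo
  \<open>a A\<close>.\<close>

lemma lying_over:
  assumes P: "primeideal P (sub_ring A)"
  shows "\<exists>Q. primeideal Q (sub_ring C) \<and> Q \<inter> A = P"
proof -
  note iP = ideal_sub_ring_closed[OF subring_A primeideal_ideal[OF P]]
  note pP = primeideal_sub_ring_closed[OF subring_A P]
  define \<I> where "\<I> = {Q. ideal Q (sub_ring C) \<and> Q \<inter> A \<subseteq> P}"
  have "\<exists>Q\<in>\<I>. \<forall>Q'\<in>\<I>. Q \<subseteq> Q' \<longrightarrow> Q' = Q"
  proof (rule subset_Zorn_nonempty)
    have "{0} \<in> \<I>"
      unfolding \<I>_def ideal_sub_ring_iff[OF subring_C] using iP(2) C_closed(1) by auto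
    then show "\<I> \<noteq> {}" by blast
  next
    fix \<C> assume ne: "\<C> \<noteq> {}" and ch: "subset.chain \<I> \<C>"
    have mem: "ideal Q (sub_ring C) \<and> Q \<inter> A \<subseteq> P" if "Q \<in> \<C>" for Q
      using ch that unfolding subset_chain_def \<I>_def by blast
    have tot: "Q \<subseteq> Q' \<or> Q' \<subseteq> Q" if "Q \<in> \<C>" "Q' \<in> \<C>" for Q Q'
      using ch that unfolding subset_chain_def by blast
    note m = ideal_sub_ring_closed[OF subring_C conjunct1[OF mem]]
    have "ideal (\<Union>\<C>) (sub_ring C)"
      unfolding ideal_sub_ring_iff[OF subring_C]
    proof (intro conjI ballI)
      show "\<Union>\<C> \<subseteq> C" using m(1) by blast
      show "0 \<in> \<Union>\<C>" using m(2) ne by blast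
      show "a + b \<in> \<Union>\<C>" if ab: "a \<in> \<Union>\<C>" "b \<in> \<Union>\<C>" for a b
      proof -
        obtain Q Q' where "Q \<in> \<C>" "a \<in> Q" "Q' \<in> \<C>" "b \<in> Q'" using ab by blast
        then show ?thesis using tot[of Q Q'] m(3) by blast
      qed
      show "a * b \<in> \<Union>\<C>" if "a \<in> C" "b \<in> \<Union>\<C>" for a b
        using that m(6) by blast
    qed
    moreover have "\<Union>\<C> \<inter> A \<subseteq> P" using mem by blast
    ultimately show "\<Union>\<C> \<in> \<I>" unfolding \<I>_def by simp
  qed
  then obtain Q where Q_max: "Q \<in> \<I>" "\<forall>Q'\<in>\<I>. Q \<subseteq> Q' \<longrightarrow> Q' = Q" by blast
  have Q: "ideal Q (sub_ring C)" "Q \<inter> A \<subseteq> P"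
    using Q_max(1) by (simp_all add: \<I>_def)
  have max: "Q' = Q" if "ideal Q' (sub_ring C)" "Q' \<inter> A \<subseteq> P" "Q \<subseteq> Q'" for Q'
  proof -
    have "Q' \<in> \<I>" unfolding \<I>_def using that(1,2) by blast
    then show ?thesis using Q_max(2) that(3) by blast
  qed
  note iQ = ideal_sub_ring_closed[OF subring_C Q(1)]
  \<comment> \<open>Otherwise the ideal \<open>Q + a C\<close>, which contains \<open>a\<close>,
    would still have its trace on \<open>A\<close> inside \<open>P\<close>, against maximality of
    \<open>Q\<close>.\<close>
  have enlarge: "\<exists>q\<in>Q. \<exists>c\<in>C. q + a * c \<in> A - P" if a: "a \<in> C" "a \<notin> Q" for a
  proof (rule ccontr)
    assume none: "\<not> ?thesis"
    define Q' where "Q' = {q + a * c | q c. q \<in> Q \<and> c \<in> C}"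
    have "ideal Q' (sub_ring C)"
      unfolding ideal_sub_ring_iff[OF subring_C]
    proof (intro conjI ballI)
      show "Q' \<subseteq> C" unfolding Q'_def using subsetD[OF iQ(1)] a(1) by (auto intro!: C_closed(3,6))
      have "0 = 0 + a * 0" by simp
      then show "0 \<in> Q'" unfolding Q'_def using iQ(2) C_closed(1) by blast
      show "x + y \<in> Q'" if xy: "x \<in> Q'" "y \<in> Q'" for x y
      proof -
        obtain q c q' c' where "q \<in> Q" "c \<in> C" "x = q + a * c" "q' \<in> Q" "c' \<in> C" "y = q' + a * c'"
          using xy unfolding Q'_def by blast
        moreover from this have "x + y = (q + q') + a * (c + c')" by (simp add: algebra_simps)
        ultimately show ?thesis unfolding Q'_def using iQ(3) C_closed(3) by blast
      qed
      show "x * y \<in> Q'" if xy: "x \<in> C" "y \<in> Q'" for x y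
      proof -
        obtain q c where "q \<in> Q" "c \<in> C" "y = q + a * c"
          using xy unfolding Q'_def by blast
        moreover from this have "x * y = x * q + a * (x * c)" by (simp add: algebra_simps)
        ultimately show ?thesis unfolding Q'_def using iQ(6) C_closed(6) xy(1) by blast
      qed
    qed
    moreover have "Q' \<inter> A \<subseteq> P" using none unfolding Q'_def by blast
    moreover have "Q \<subseteq> Q'"
    proof
      fix q assume "q \<in> Q"
      then have "q = q + a * 0 \<and> q \<in> Q \<and> 0 \<in> C" using C_closed(1) by simp
      then show "q \<in> Q'" unfolding Q'_def by blast
    qed
    moreover have "a \<in> Q'"
    proof -
      have "a = 0 + a * 1" by simp
      then show ?thesis unfolding Q'_def using iQ(2) C_closed(2) by blast
    qed
    ultimately show False using max a(2) by blast
  qed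
  have "primeideal Q (sub_ring C)"
    unfolding primeideal_sub_ring_iff[OF subring_C]
  proof (intro conjI ballI impI)
    show "1 \<notin> Q" using Q(2) pP(1) A_closed(2) by blast
    show "a \<in> Q \<or> b \<in> Q" if ab: "a \<in> C" "b \<in> C" "a * b \<in> Q" for a b
    proof (rule ccontr)
      assume "\<not> ?thesis"
      then obtain q c q' c' where *: "q \<in> Q" "c \<in> C" "q + a * c \<in> A - P" "q' \<in> Q" "c' \<in> C" "q' + b * c' \<in> A - P"
        using enlarge[of a] enlarge[of b] ab by blast
      have "(q + a * c) * (q' + b * c') = q * (q' + b * c') + ((a * c) * q' + (c * c') * (a * b))"
        by (simp add: algebra_simps)
      moreover have "q * (q' + b * c') \<in> Q" "(a * c) * q' \<in> Q" "(c * c') * (a * b) \<in> Q"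
        using iQ(7)[OF *(1)] iQ(6)[OF C_closed(6)[OF ab(1) *(2)] *(4)]
          iQ(6)[OF C_closed(6)[OF *(2,5)] ab(3)] *(6) A_subset by blast+
      ultimately have "(q + a * c) * (q' + b * c') \<in> Q"
        using iQ(3) by presburger
      then have "(q + a * c) * (q' + b * c') \<in> P"
        using Q(2) A_closed(6) * by blast
      then show False using * pP(2) by blast
    qed
  qed (use Q in simp)
  moreover have "P \<subseteq> Q"
  proof
    fix a assume a: "a \<in> P"
    then have aA: "a \<in> A" using iP(1) by blast
    show "a \<in> Q"
    proof (rule ccontr)
      assume "a \<notin> Q"
      then obtain q c where qc: "q \<in> Q" "c \<in> C" "q + a * c \<in> A - P"
        using enlarge[of a] A_subset aA by blast
      define s where "s = q + a * c"
      have s: "s \<in> A" "s \<notin> P" using qc by (simp_all add: s_def)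
      have inv: "g a = a" "g s = s" if "g \<in> G" for g using aA s(1) that by (auto simp: A_eq)
      have gq: "g q = s - a * g c" if "g \<in> G" for g
      proof -
        have "g s = g q + g a * g c" using that by (simp add: s_def hom_add hom_mult)
        then show ?thesis using inv[OF that] by (simp add: eq_diff_eq)
      qed
      have "\<exists>d\<in>C. (\<Prod>g\<in>S. g q) = s ^ card S + a * d" if "finite S" "S \<subseteq> G" for S
        using that
      proof (induction S rule: finite_induct)
        case empty
        then show ?case using C_closed(1) by (intro bexI[of _ 0]) auto
      next
        case (insert g S)
        then obtain d where d: "d \<in> C" "(\<Prod>g\<in>S. g q) = s ^ card S + a * d" by blast
        have "(\<Prod>g\<in>insert g S. g q) = s ^ card (insert g S) + a * (s * d - g c * (s ^ card S + a * d))"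
        proof -
          have "(\<Prod>g\<in>insert g S. g q) = g q * (\<Prod>g\<in>S. g q)"
            using insert(1,2) by simp
          also have "\<dots> = (s - a * g c) * (s ^ card S + a * d)"
            using d(2) gq insert(4) by simp
          also have "\<dots> = s ^ card (insert g S) + a * (s * d - g c * (s ^ card S + a * d))"
            using insert(1,2) by (simp add: algebra_simps)
          finally show ?thesis .
        qed
        moreover have "s * d - g c * (s ^ card S + a * d) \<in> C"
          using d insert stable_C qc s A_subset aA
          by (intro C_closed(4,6,3,7)) auto
        ultimately show ?case by blast
      qed
      from this[of G] obtain d where d: "d \<in> C" "norm_G q = s ^ card G + a * d"
        using finite_G by (auto simp: norm_G_def)
      have "a \<noteq> 0" using \<open>a \<notin> Q\<close> iQ(2) by auto
      have "norm_G q \<in> A" using norm_G_mem qc iQ(1) by blast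
      moreover have "norm_G q = q * (\<Prod>g\<in>G - {id}. g q)"
        unfolding norm_G_def using prod.remove[OF finite_G id_mem, of "\<lambda>g. g q"] by simp
      moreover have "(\<Prod>g\<in>G - {id}. g q) \<in> C"
        using qc iQ(1) stable_C by (intro C_closed(9)) auto
      ultimately have nP: "norm_G q \<in> P" using Q(2) iQ(7)[OF qc(1)] by auto
      \<comment> \<open>So far \<open>d\<close> is only known to lie in \<open>C\<close>. Applying
        \<open>g\<close> to an equation with invariant left side and cancelling the invariant
        \<open>a\<close> makes \<open>d\<close> invariant, so that \<open>a * d\<close> lies in
        \<open>P\<close>.\<close>
      have "g d = d" if g: "g \<in> G" for g
      proof -
        have "g (norm_G q) = g s ^ card G + g a * g d"
          unfolding d(2) using g by (simp add: hom_add hom_mult hom_power)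
        then have "norm_G q = s ^ card G + a * g d"
          unfolding norm_G_invariant[OF g] inv[OF g] .
        then have "a * g d = a * d" using d(2) by (metis add_left_cancel)
        then show ?thesis using \<open>a \<noteq> 0\<close> by simp
      qed
      then have "d \<in> A" using d(1) by (simp add: A_eq)
      then have "norm_G q - a * d \<in> P" using iP(5)[OF nP iP(7)[OF a]] by blast
      then have "s ^ card G \<in> P" using d(2) by simp
      then show False using pP(3) s by blast
    qed
  qed
  ultimately show ?thesis using Q(2) iP(1) by blast
qed

text \<open>If no conjugate of one prime were contained in the other, one could pick from each
  conjugate an element outside the other prime. Their product lies in the intersection of all
  conjugates, an invariant ideal whose trace on \<open>A\<close> is in the other prime; hence the
  whole ideal is in that prime, which contradicts primality.\<close>

lemma primes_conjugate:
  assumes Q: "primeideal Q (sub_ring C)" and Q': "primeideal Q' (sub_ring C)"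
    and eq: "Q \<inter> A = Q' \<inter> A"
  shows "\<exists>g\<in>G. g ` Q = Q'"
proof -
  have sub: "\<exists>g\<in>G. g ` Q1 \<subseteq> Q2"
    if Q1: "primeideal Q1 (sub_ring C)" and Q2: "primeideal Q2 (sub_ring C)" and eq: "Q1 \<inter> A = Q2 \<inter> A" for Q1 Q2
  proof (rule ccontr)
    assume "\<not> ?thesis"
    then have "\<forall>g\<in>G. \<exists>c. c \<in> g ` Q1 \<and> c \<notin> Q2" by blast
    then obtain c where c: "\<And>g. g \<in> G \<Longrightarrow> c g \<in> g ` Q1 \<and> c g \<notin> Q2" by metis
    note i1 = ideal_sub_ring_closed[OF subring_C primeideal_ideal[OF image_prime[OF Q1]]]
    define J where "J = (\<Inter>g\<in>G. g ` Q1)"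
    have J: "ideal J (sub_ring C)"
      unfolding ideal_sub_ring_iff[OF subring_C] J_def
    proof (intro conjI ballI INT_I)
      show "(\<Inter>g\<in>G. g ` Q1) \<subseteq> C" using i1(1)[OF id_mem] id_mem by blast
      show "0 \<in> g ` Q1" if "g \<in> G" for g using i1(2)[OF that] .
      show "a + b \<in> g ` Q1" if "a \<in> (\<Inter>g\<in>G. g ` Q1)" "b \<in> (\<Inter>g\<in>G. g ` Q1)" "g \<in> G" for a b g
        using i1(3)[OF that(3), of a b] that by simp
      show "a * b \<in> g ` Q1" if "a \<in> C" "b \<in> (\<Inter>g\<in>G. g ` Q1)" "g \<in> G" for a b g
        using i1(6)[OF that(3), of a b] that by simp
    qed
    have "h x \<in> J" if h: "h \<in> G" and x: "x \<in> J" for h x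
      unfolding J_def
    proof
      fix g assume g: "g \<in> G"
      obtain k where k: "k \<in> G" "h \<circ> k = id" using inv_mem[OF h] by blast
      have "x \<in> (k \<circ> g) ` Q1" using x comp_mem[OF k(1) g] unfolding J_def by blast
      then have "h x \<in> (h \<circ> k \<circ> g) ` Q1" by auto
      then show "h x \<in> g ` Q1" using k by simp
    qed
    moreover have "J \<inter> A \<subseteq> Q2"
    proof -
      have "J \<subseteq> id ` Q1" unfolding J_def using id_mem by (rule INF_lower)
      then show ?thesis using eq by auto
    qed
    ultimately have JQ: "J \<subseteq> Q2" using invariant_ideal_subset_prime[OF J _ Q2] by blast
    have cC: "c g \<in> C" if "g \<in> G" for g using c[OF that] i1(1)[OF that] by blast
    have "(\<Prod>g\<in>G. c g) \<in> J"
      unfolding J_def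
    proof
      fix g assume g: "g \<in> G"
      have "(\<Prod>g\<in>G. c g) = c g * (\<Prod>g\<in>G - {g}. c g)" by (rule prod.remove[OF finite_G g])
      also have "\<dots> \<in> g ` Q1"
        by (intro i1(7)[OF g] C_closed(9)) (simp_all add: c g cC)
      finally show "(\<Prod>g\<in>G. c g) \<in> g ` Q1" .
    qed
    then have "(\<Prod>g\<in>G. c g) \<in> Q2" using JQ by (rule subsetD[rotated])
    then have "\<exists>g\<in>G. c g \<in> Q2"
      using primeideal_sub_ring_closed(4)[OF subring_C Q2 finite_G, of c] cC by simp
    then show False using c by simp
  qed
  from sub[OF Q Q' eq] obtain g where g: "g \<in> G" "g ` Q \<subseteq> Q'" ..
  from sub[OF Q' Q eq[symmetric]] obtain h where h: "h \<in> G" "h ` Q' \<subseteq> Q" ..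
  note gh = g h
  define k where "k = h \<circ> g"
  have kG: "k \<in> G" using gh comp_mem by (simp add: k_def)
  have kQ: "k ` Q \<subseteq> Q" using gh unfolding k_def by (auto simp: image_subset_iff)
  obtain n where n: "n > 0" "k ^^ n = id" using finite_order[OF kG] by blast
  have pw: "(k ^^ j) ` Q \<subseteq> Q" for j
    by (induction j) (use kQ in \<open>auto simp: image_subset_iff\<close>)
  have "Q \<subseteq> k ` Q"
  proof
    fix q assume q: "q \<in> Q"
    have "q = (k \<circ> k ^^ (n - 1)) q" using n by (metis Suc_diff_1 funpow.simps(2) id_apply)
    then show "q \<in> k ` Q" using pw[of "n - 1"] q by auto
  qed
  have "Q' \<subseteq> g ` Q"
  proof
    fix x assume "x \<in> Q'"
    then have "h x \<in> Q" using gh by blast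
    then obtain q where "q \<in> Q" "h x = h (g q)" using \<open>Q \<subseteq> k ` Q\<close> unfolding k_def by auto
    then show "x \<in> g ` Q" using inj_G[OF gh(3)] by (metis image_eqI injD)
  qed
  with gh show ?thesis by blast
qed

lemma center_A_localization:
  assumes "primeideal Q (sub_ring C)"
  shows "center A (localization C Q) = Q \<inter> A"
  using center_localization[OF subring_C assms] A_subset unfolding center_def by blast

text \<open>The denominators of an invariant element form an invariant ideal.\<close>

lemma localization_invariants:
  assumes Q: "primeideal Q (sub_ring C)"
  shows "localization A (Q \<inter> A) = {f \<in> localization C Q. \<forall>g\<in>G. g f = f}"
proof (intro equalityI subsetI)
  fix f assume "f \<in> localization A (Q \<inter> A)"
  then obtain a b where ab: "a \<in> A" "b \<in> A" "b \<notin> Q" "f = a / b" unfolding mem_localization_iff by blast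
  then have "g f = f" if "g \<in> G" for g
    using that hom_divide[OF that, of a b] by (auto simp: A_eq)
  then show "f \<in> {f \<in> localization C Q. \<forall>g\<in>G. g f = f}"
    using ab A_subset unfolding localization_def by blast
next
  fix f assume f: "f \<in> {f \<in> localization C Q. \<forall>g\<in>G. g f = f}"
  define J where "J = {c \<in> C. c * f \<in> C}"
  have J: "ideal J (sub_ring C)"
    unfolding ideal_sub_ring_iff[OF subring_C]
  proof (intro conjI ballI)
    show "J \<subseteq> C" "0 \<in> J" using C_closed(1) by (auto simp: J_def)
    show "a + b \<in> J" if "a \<in> J" "b \<in> J" for a b
      using that C_closed(3) by (simp add: J_def distrib_right)
    show "a * b \<in> J" if "a \<in> C" "b \<in> J" for a b
      using that C_closed(6)[of a "b * f"] C_closed(6)[of a b] by (simp add: J_def mult.assoc)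
  qed
  have st: "g c \<in> J" if "g \<in> G" "c \<in> J" for g c
  proof -
    have "g (c * f) = g c * f" using f that by (simp add: hom_mult)
    then show ?thesis using that stable_C[OF that(1), of c] stable_C[OF that(1), of "c * f"] by (simp add: J_def)
  qed
  obtain a b where ab: "a \<in> C" "b \<in> C" "b \<notin> Q" "f = a / b"
    using f unfolding localization_def by blast
  then have "b \<in> J" using zero_mem_prime[OF subring_C Q] by (auto simp: J_def)
  then have "\<not> J \<subseteq> Q" using ab by blast
  then obtain d where d: "d \<in> J" "d \<in> A" "d \<notin> Q"
    using invariant_ideal_subset_prime[OF J _ Q] st by blast
  have df: "d * f \<in> A"
  proof -
    have "g (d * f) = d * f" if "g \<in> G" for g
    proof -
      have "g d = d" "g f = f" using d(2) f that unfolding A_eq by blast+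
      then show ?thesis using hom_mult[OF that, of d f] by simp
    qed
    then show ?thesis using d(1) unfolding J_def A_eq by simp
  qed
  have "d \<noteq> 0" using d(3) zero_mem_prime[OF subring_C Q] by metis
  then have "f = (d * f) / d" by simp
  moreover have "(d * f) / d \<in> localization A (Q \<inter> A)"
    unfolding localization_def using df d(2,3) by blast
  ultimately show "f \<in> localization A (Q \<inter> A)" by metis
qed

end

section \<open>Affine charts and quotients by finite groups\<close>

lemma Spec_simps:
  "space_of (Spec A) = topology_generated_by {{P. primeideal P (sub_ring A) \<and> f \<notin> P} | f. f \<in> A}"
  "sections (Spec A) W = (if W = {} then {0} else \<Inter>P\<in>W. localization A P)"
  by (simp_all add: Spec_def)

context
  fixes A :: "'f::field set"
  assumes A: "subring A amb"
begin

lemma points_Spec: "points (Spec A) = {P. primeideal P (sub_ring A)}"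
proof -
  have "1 \<notin> P" if "primeideal P (sub_ring A)" for P
    using primeideal_sub_ring_closed(1)[OF A that] .
  then show ?thesis
    unfolding Spec_simps topology_generated_by_topspace
    using subring_amb_closed(2)[OF A] by auto
qed

lemma openin_Spec_basic: "f \<in> A \<Longrightarrow> openin (space_of (Spec A)) {P. primeideal P (sub_ring A) \<and> f \<notin> P}"
  unfolding Spec_simps by (rule topology_generated_by_Basis) blast

text \<open>The generating sets already form a basis: nonvanishing of \<open>f\<close> and of
  \<open>g\<close> at a prime is nonvanishing of \<open>f * g\<close>.\<close>

lemma openin_SpecD:
  assumes "openin (space_of (Spec A)) W" "P \<in> W"
  shows "\<exists>f\<in>A - P. {P. primeideal P (sub_ring A) \<and> f \<notin> P} \<subseteq> W"
proof -
  have "generate_topology_on {{P. primeideal P (sub_ring A) \<and> f \<notin> P} | f. f \<in> A} W"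
    using assms(1) unfolding Spec_simps openin_topology_generated_by_iff .
  then show ?thesis using assms(2)
  proof (induction W arbitrary: P)
    case (Int U V)
    from Int have "P \<in> U" "P \<in> V" by auto
    from Int.IH(1)[OF this(1)] Int.IH(2)[OF this(2)] obtain f g where
      fg: "f \<in> A - P" "{P. primeideal P (sub_ring A) \<and> f \<notin> P} \<subseteq> U"
      "g \<in> A - P" "{P. primeideal P (sub_ring A) \<and> g \<notin> P} \<subseteq> V" by blast
    have "W \<subseteq> points (Spec A)" if "generate_topology_on {{P. primeideal P (sub_ring A) \<and> f \<notin> P} | f. f \<in> A} W" for W
    proof -
      have "openin (space_of (Spec A)) W"
        unfolding Spec_simps openin_topology_generated_by_iff by (rule that)
      then show ?thesis by (rule openin_subset)
    qed
    then have P: "primeideal P (sub_ring A)" using Int.hyps(1) \<open>P \<in> U\<close> unfolding points_Spec by blast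
    have "f * g \<notin> Q \<longleftrightarrow> f \<notin> Q \<and> g \<notin> Q" if "primeideal Q (sub_ring A)" for Q
      using primeideal_sub_ring_closed(2)[OF A that] fg by simp
    then have "f * g \<in> A - P" "{P. primeideal P (sub_ring A) \<and> f * g \<notin> P} \<subseteq> U \<inter> V"
      using fg P subring_amb_closed(6)[OF A] by blast+
    then show ?case by blast
  next
    case (UN K)
    then obtain U where "U \<in> K" "P \<in> U" by blast
    with UN.IH[OF this] show ?case by blast
  qed auto
qed

end

text \<open>Each local ring on a glued scheme that contains the elements \<open>S B\<close> must lie on the chart
  \<open>Spec B\<close>; the topology is then generated by the domains of definition of rational
  functions.\<close>

locale glued_charts =
  fixes \<B> :: "'f::field set set" and S :: "'f set \<Rightarrow> 'f set"
  assumes subring_chart: "B \<in> \<B> \<Longrightarrow> subring B amb"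
    and finite_S: "B \<in> \<B> \<Longrightarrow> finite (S B) \<and> S B \<subseteq> B"
    and chart: "B \<in> \<B> \<Longrightarrow> B' \<in> \<B> \<Longrightarrow> primeideal P (sub_ring B') \<Longrightarrow> S B \<subseteq> localization B' P \<Longrightarrow>
       \<exists>Q. primeideal Q (sub_ring B) \<and> localization B' P = localization B Q"
begin

lemma points_glue: "points (glue_Spec \<B>) = {localization B P | B P. B \<in> \<B> \<and> primeideal P (sub_ring B)}"
  (is "?L = ?R")
proof
  have "W \<subseteq> {P. primeideal P (sub_ring B)}" if "B \<in> \<B>" "openin (space_of (Spec B)) W" for B W
    using openin_subset[OF that(2)] points_Spec[OF subring_chart[OF that(1)]] by simp
  then show "?L \<subseteq> ?R"
    unfolding glue_Spec_def scheme_in.simps topology_generated_by_topspace by blast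
  show "?R \<subseteq> ?L"
  proof clarify
    fix B P assume B: "B \<in> \<B>" "primeideal P (sub_ring B)"
    have "openin (space_of (Spec B)) (points (Spec B))" by simp
    then have "localization B ` points (Spec B) \<in> {localization B ` W |B W. B \<in> \<B> \<and> openin (space_of (Spec B)) W}"
      using B by blast
    moreover have "localization B P \<in> localization B ` points (Spec B)"
      using B points_Spec[OF subring_chart] by blast
    ultimately show "localization B P \<in> ?L"
      unfolding glue_Spec_def scheme_in.simps topology_generated_by_topspace by (rule UnionI)
  qed
qed

text \<open>A representation \<open>a / b\<close> valid at one point remains valid wherever
  \<open>b\<close> does not vanish, which is a basic open set of the chart.\<close>

lemma openin_glue_domain: "openin (space_of (glue_Spec \<B>)) {\<O> \<in> points (glue_Spec \<B>). f \<in> \<O>}"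
proof (subst openin_subopen, intro ballI)
  fix \<O> assume "\<O> \<in> {\<O> \<in> points (glue_Spec \<B>). f \<in> \<O>}"
  then obtain B P where B: "B \<in> \<B>" "primeideal P (sub_ring B)" "\<O> = localization B P" "f \<in> localization B P"
    unfolding points_glue by blast
  then obtain a b where ab: "a \<in> B" "b \<in> B - P" "f = a / b" unfolding mem_localization_iff by blast
  let ?W = "localization B ` {P. primeideal P (sub_ring B) \<and> b \<notin> P}"
  have "openin (space_of (glue_Spec \<B>)) ?W"
    unfolding glue_Spec_def scheme_in.simps
    using openin_Spec_basic[OF subring_chart[OF B(1)], of b] ab B(1)
    by (intro topology_generated_by_Basis) blast
  moreover have "\<O> \<in> ?W" using B ab by blast
  moreover have "?W \<subseteq> {\<O> \<in> points (glue_Spec \<B>). f \<in> \<O>}"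
    unfolding points_glue using B(1) ab by (auto simp: localization_def)
  ultimately show "\<exists>T. openin (space_of (glue_Spec \<B>)) T \<and> \<O> \<in> T \<and> T \<subseteq> {\<O> \<in> points (glue_Spec \<B>). f \<in> \<O>}"
    by blast
qed

lemma openin_glueD:
  assumes "openin (space_of (glue_Spec \<B>)) W" "\<O> \<in> W"
  shows "\<exists>F. finite F \<and> F \<subseteq> \<O> \<and> {\<O>' \<in> points (glue_Spec \<B>). F \<subseteq> \<O>'} \<subseteq> W"
proof -
  have "generate_topology_on {localization B ` W |B W. B \<in> \<B> \<and> openin (space_of (Spec B)) W} W"
    using assms(1) unfolding glue_Spec_def scheme_in.simps openin_topology_generated_by_iff .
  then show ?thesis using assms(2)
  proof (induction W arbitrary: \<O>)
    case (Int U V)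
    from Int have "\<O> \<in> U" "\<O> \<in> V" by auto
    from Int.IH(1)[OF this(1)] Int.IH(2)[OF this(2)] obtain F F' where
      "finite F" "F \<subseteq> \<O>" "{\<O>' \<in> points (glue_Spec \<B>). F \<subseteq> \<O>'} \<subseteq> U"
      "finite F'" "F' \<subseteq> \<O>" "{\<O>' \<in> points (glue_Spec \<B>). F' \<subseteq> \<O>'} \<subseteq> V"
      by blast
    then show ?case by (intro exI[of _ "F \<union> F'"]) blast
  next
    case (UN K)
    then obtain U where "U \<in> K" "\<O> \<in> U" by blast
    with UN.IH[OF this] show ?case by blast
  next
    case (Basis s)
    then obtain B W where BW: "B \<in> \<B>" "openin (space_of (Spec B)) W" "s = localization B ` W" by blast
    note B = subring_chart[OF BW(1)]
    obtain P where P: "P \<in> W" "\<O> = localization B P" using Basis BW by blast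
    then have "primeideal P (sub_ring B)"
      using openin_subset[OF BW(2)] points_Spec[OF B] by blast
    obtain f where f: "f \<in> B - P" "{P. primeideal P (sub_ring B) \<and> f \<notin> P} \<subseteq> W"
      using openin_SpecD[OF B BW(2) P(1)] by blast
    have f0: "f \<noteq> 0" using f zero_mem_prime[OF B \<open>primeideal P (sub_ring B)\<close>] by auto
    \<comment> \<open>Regularity of \<open>inverse f\<close> expresses that \<open>f\<close> does
      not vanish, and the elements of \<open>S B\<close> force the local ring to come from the chart
      \<open>B\<close> at all.\<close>
    let ?F = "insert (inverse f) (S B)"
    have "?F \<subseteq> \<O>"
      using P f f0 inverse_mem_localization_iff[OF B \<open>primeideal P (sub_ring B)\<close>, of f]
        subset_localization[OF B \<open>primeideal P (sub_ring B)\<close>] finite_S[OF BW(1)] by blast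
    moreover have "{\<O>' \<in> points (glue_Spec \<B>). ?F \<subseteq> \<O>'} \<subseteq> s"
    proof clarify
      fix \<O>' assume "\<O>' \<in> points (glue_Spec \<B>)" and F: "?F \<subseteq> \<O>'"
      then obtain B' P' where "B' \<in> \<B>" "primeideal P' (sub_ring B')" "\<O>' = localization B' P'"
        unfolding points_glue by blast
      with chart[OF BW(1) this(1,2)] F obtain Q where Q: "primeideal Q (sub_ring B)" "\<O>' = localization B Q"
        by auto
      then have "f \<notin> Q" using inverse_mem_localization_iff[OF B Q(1), of f] F f f0 by auto
      then show "\<O>' \<in> s" using Q f BW(3) by blast
    qed
    ultimately show ?case using finite_S[OF BW(1)] by blast
  qed auto
qed

end

lemma sections_glue_Spec: "sections (glue_Spec \<B>) W = (if W = {} then {0} else \<Inter>W)"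
  by (simp add: glue_Spec_def)

section \<open>Group actions on schemes whose points are local rings, and their quotients\<close>

locale scheme_action = finite_field_auts G for G :: "('f::field \<Rightarrow> 'f) set" +
  fixes \<Y> :: "('f set, 'f) scheme_in"
  assumes sections_Y: "sections \<Y> W = (if W = {} then {0} else \<Inter>W)"
    and openin_domain: "openin (space_of \<Y>) {\<O> \<in> points \<Y>. f \<in> \<O>}"
    and openin_YD: "openin (space_of \<Y>) W \<Longrightarrow> \<O> \<in> W \<Longrightarrow>
       \<exists>F. finite F \<and> F \<subseteq> \<O> \<and> {\<O>' \<in> points \<Y>. F \<subseteq> \<O>'} \<subseteq> W"
    and stable_Y: "g \<in> G \<Longrightarrow> \<O> \<in> points \<Y> \<Longrightarrow> g ` \<O> \<in> points \<Y>"
begin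

abbreviation "\<X> \<equiv> quotient_scheme \<Y> G"

lemma openin_quotient_iff:
  "openin (space_of \<X>) W \<longleftrightarrow> W \<subseteq> point_orbit G ` points \<Y> \<and> openin (space_of \<Y>) {\<O> \<in> points \<Y>. point_orbit G \<O> \<in> W}"
  by (simp add: quotient_scheme_def openin_quotient_space)

lemma points_quotient: "points \<X> = point_orbit G ` points \<Y>"
proof
  show "points \<X> \<subseteq> point_orbit G ` points \<Y>"
    using openin_quotient_iff[of "points \<X>"] by simp
  have "{\<O> \<in> points \<Y>. point_orbit G \<O> \<in> point_orbit G ` points \<Y>} = points \<Y>" by blast
  then have "openin (space_of \<X>) (point_orbit G ` points \<Y>)"
    unfolding openin_quotient_iff by simp
  then show "point_orbit G ` points \<Y> \<subseteq> points \<X>" by (rule openin_subset)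
qed

lemma sections_quotient:
  "sections \<X> W = {f \<in> sections \<Y> {\<O> \<in> points \<Y>. point_orbit G \<O> \<in> W}. \<forall>g\<in>G. g f = f}"
  by (simp add: quotient_scheme_def)

lemma mem_orbit_invariant:
  assumes "\<forall>g\<in>G. g f = f" "point_orbit G \<O>' = point_orbit G \<O>"
  shows "f \<in> \<O>' \<longleftrightarrow> f \<in> \<O>"
proof -
  have "\<O>' \<in> point_orbit G \<O>" using mem_point_orbit[of \<O>'] assms(2) by simp
  then obtain g where "g \<in> G" "\<O>' = g ` \<O>" by (auto simp: point_orbit_def)
  then show ?thesis using mem_image_G_iff[OF _ assms(1)] by simp
qed

lemma orbit_mem_domain_iff:
  assumes "\<forall>g\<in>G. g f = f" "\<O> \<in> points \<Y>"
  shows "point_orbit G \<O> \<in> {x. \<exists>\<O>\<in>points \<Y>. f \<in> \<O> \<and> x = point_orbit G \<O>} \<longleftrightarrow> f \<in> \<O>"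
  using mem_orbit_invariant[OF assms(1), of \<O>] assms(2) by blast

lemma openin_quotient_domain:
  assumes "\<forall>g\<in>G. g f = f"
  shows "openin (space_of \<X>) {x. \<exists>\<O>\<in>points \<Y>. f \<in> \<O> \<and> x = point_orbit G \<O>}"
proof -
  have "{\<O> \<in> points \<Y>. point_orbit G \<O> \<in> {x. \<exists>\<O>\<in>points \<Y>. f \<in> \<O> \<and> x = point_orbit G \<O>}} = {\<O> \<in> points \<Y>. f \<in> \<O>}"
    by (rule Collect_cong) (use orbit_mem_domain_iff[OF assms] in blast)
  moreover have "{x. \<exists>\<O>\<in>points \<Y>. f \<in> \<O> \<and> x = point_orbit G \<O>} \<subseteq> point_orbit G ` points \<Y>"
    by blast
  ultimately show ?thesis unfolding openin_quotient_iff using openin_domain by simp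
qed

text \<open>An invariant function regular at one point is a section over the open set of all orbits
  on which it is regular, so passing to stalks commutes with taking invariants.\<close>

lemma stalk_quotient:
  assumes "\<O> \<in> points \<Y>"
  shows "stalk \<X> (point_orbit G \<O>) = {f \<in> \<O>. \<forall>g\<in>G. g f = f}"
proof (intro equalityI subsetI)
  fix f assume "f \<in> stalk \<X> (point_orbit G \<O>)"
  then obtain W where W: "openin (space_of \<X>) W" "point_orbit G \<O> \<in> W" "f \<in> sections \<X> W"
    unfolding stalk_def by blast
  then have "\<O> \<in> {\<O> \<in> points \<Y>. point_orbit G \<O> \<in> W}" using assms by simp
  then show "f \<in> {f \<in> \<O>. \<forall>g\<in>G. g f = f}"
    using W(3) unfolding sections_quotient sections_Y by (auto split: if_splits)
next
  fix f assume f: "f \<in> {f \<in> \<O>. \<forall>g\<in>G. g f = f}"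
  let ?W = "{x. \<exists>\<O>\<in>points \<Y>. f \<in> \<O> \<and> x = point_orbit G \<O>}"
  have inv: "\<forall>g\<in>G. g f = f" using f by simp
  have "{\<O> \<in> points \<Y>. point_orbit G \<O> \<in> ?W} = {\<O> \<in> points \<Y>. f \<in> \<O>}"
    by (rule Collect_cong) (use orbit_mem_domain_iff[OF inv] in blast)
  moreover have "\<O> \<in> {\<O> \<in> points \<Y>. f \<in> \<O>}" using f assms by simp
  then have "f \<in> sections \<Y> {\<O> \<in> points \<Y>. f \<in> \<O>}"
    unfolding sections_Y by (auto split: if_splits)
  ultimately have "f \<in> sections \<X> ?W"
    unfolding sections_quotient using inv by simp
  moreover have "point_orbit G \<O> \<in> ?W" using f assms by blast
  ultimately show "f \<in> stalk \<X> (point_orbit G \<O>)"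
    unfolding stalk_def using openin_quotient_domain[OF inv] by blast
qed

text \<open>Open sets are cut out locally by regularity of finitely many functions, and such
  conditions persist in a larger local ring. This is stability of open sets under generization, used
  to place points in the closure of a generic point.\<close>

lemma specialization_open_quotient:
  assumes W: "openin (space_of \<X>) W" and "\<O> \<in> points \<Y>" "\<O>' \<in> points \<Y>" "\<O> \<subseteq> \<O>'"
    and "point_orbit G \<O> \<in> W"
  shows "point_orbit G \<O>' \<in> W"
proof -
  have "openin (space_of \<Y>) {\<O> \<in> points \<Y>. point_orbit G \<O> \<in> W}"
    using W unfolding openin_quotient_iff by simp
  from openin_YD[OF this, of \<O>] assms show ?thesis by blast
qed

end

section \<open>The spectrum of a ring of invariants as an open subscheme of the quotient\<close>

locale quotient_chart = scheme_action G \<Y> + invariant_subring G C A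
  for G :: "('f::field \<Rightarrow> 'f) set" and \<Y> C A +
  assumes chart_points: "primeideal Q (sub_ring C) \<Longrightarrow> localization C Q \<in> points \<Y>"
begin

definition V :: "'f set set" where
  "V = {localization C Q | Q. primeideal Q (sub_ring C)}"

text \<open>The condition ranges over all members of the orbit, so that no representative has to be
  chosen. It is the trace on \<open>A\<close> of the maximal ideal of any of them.\<close>

definition chart_map :: "'f set set \<Rightarrow> 'f set" where
  "chart_map x = {a \<in> A. a = 0 \<or> (\<forall>\<O>\<in>x. inverse a \<notin> \<O>)}"

lemma V_subset: "V \<subseteq> points \<Y>"
  using chart_points by (auto simp: V_def)

lemma chart_map_orbit: "chart_map (point_orbit G \<O>) = center A \<O>"
proof -
  have "inverse a \<in> \<O>' \<longleftrightarrow> inverse a \<in> \<O>" if "a \<in> A" "\<O>' \<in> point_orbit G \<O>" for a \<O>'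
  proof -
    have "\<forall>g\<in>G. g (inverse a) = inverse a" using that(1) by (auto simp: A_eq hom_inverse)
    moreover obtain g where "g \<in> G" "\<O>' = g ` \<O>" using \<open>\<O>' \<in> point_orbit G \<O>\<close> unfolding point_orbit_def by blast
    ultimately show ?thesis using mem_image_G_iff by simp
  qed
  then show ?thesis unfolding chart_map_def center_def using mem_point_orbit by blast
qed

lemma chart_map_localization:
  "primeideal Q (sub_ring C) \<Longrightarrow> chart_map (point_orbit G (localization C Q)) = Q \<inter> A"
  unfolding chart_map_orbit by (rule center_A_localization)

lemma chart_map_image: "chart_map ` point_orbit G ` V = points (Spec A)"
  unfolding points_Spec[OF subring_A] V_def
proof (intro equalityI subsetI)
  fix P assume "P \<in> chart_map ` point_orbit G ` {localization C Q |Q. primeideal Q (sub_ring C)}"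
  then obtain Q where "primeideal Q (sub_ring C)" "P = chart_map (point_orbit G (localization C Q))" by blast
  then show "P \<in> {P. primeideal P (sub_ring A)}" using chart_map_localization prime_inter by simp
next
  fix P assume "P \<in> {P. primeideal P (sub_ring A)}"
  then obtain Q where "primeideal Q (sub_ring C)" "Q \<inter> A = P" using lying_over by blast
  then show "P \<in> chart_map ` point_orbit G ` {localization C Q |Q. primeideal Q (sub_ring C)}"
    using chart_map_localization by blast
qed

text \<open>Primes of \<open>C\<close> with the same trace on \<open>A\<close> are conjugate, and
  conjugate primes have local rings in a single orbit.\<close>

lemma chart_map_inj: "inj_on chart_map (point_orbit G ` V)"
proof (rule inj_onI)
  fix x x' assume "x \<in> point_orbit G ` V" "x' \<in> point_orbit G ` V" and eq: "chart_map x = chart_map x'"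
  then obtain Q Q' where Q: "primeideal Q (sub_ring C)" "x = point_orbit G (localization C Q)"
    "primeideal Q' (sub_ring C)" "x' = point_orbit G (localization C Q')"
    unfolding V_def by blast
  then obtain g where "g \<in> G" "g ` Q = Q'"
    using primes_conjugate[OF Q(1,3)] eq chart_map_localization by auto
  then show "x = x'" using Q point_orbit_image image_localization by metis
qed

text \<open>The elements of \<open>C\<close> whose nonvanishing forces a point into the given open
  set form a \<open>G\<close>-stable ideal. This ideal is not contained in \<open>Q\<close>, so it
  has an invariant element outside \<open>Q\<close>, and that element defines a basic neighbourhood
  in the spectrum of \<open>A\<close>.\<close>

lemma chart_map_open:
  assumes W: "openin (space_of \<X>) W"
  shows "openin (space_of (Spec A)) (chart_map ` (W \<inter> point_orbit G ` V))"
proof (subst openin_subopen, intro ballI)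
  fix P assume "P \<in> chart_map ` (W \<inter> point_orbit G ` V)"
  then obtain Q where Q: "primeideal Q (sub_ring C)" "point_orbit G (localization C Q) \<in> W"
    "P = chart_map (point_orbit G (localization C Q))"
    unfolding V_def by blast
  note P = Q(3)[unfolded chart_map_localization[OF Q(1)]]
  define D where "D c = {Q'. primeideal Q' (sub_ring C) \<and> c \<notin> Q'}" for c
  define J where "J = {c \<in> C. \<forall>Q'\<in>D c. point_orbit G (localization C Q') \<in> W}"
  note ip = ideal_sub_ring_closed[OF subring_C primeideal_ideal]
  have J: "ideal J (sub_ring C)"
    unfolding ideal_sub_ring_iff[OF subring_C]
  proof (intro conjI ballI)
    show "J \<subseteq> C" by (auto simp: J_def)
    show "0 \<in> J" using ip(2) C_closed(1) by (auto simp: J_def D_def)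
    show "a + b \<in> J" if "a \<in> J" "b \<in> J" for a b
    proof -
      have "D (a + b) \<subseteq> D a \<union> D b" using ip(3) by (auto simp: D_def)
      then show ?thesis using that C_closed(3) unfolding J_def by blast
    qed
    show "a * b \<in> J" if "a \<in> C" "b \<in> J" for a b
    proof -
      have "D (a * b) \<subseteq> D b" using ip(6) that(1) by (auto simp: D_def)
      then show ?thesis using that C_closed(6) unfolding J_def by blast
    qed
  qed
  have st: "g c \<in> J" if g: "g \<in> G" and c: "c \<in> J" for g c
    unfolding J_def
  proof (intro CollectI conjI ballI)
    show "g c \<in> C" using stable_C[OF g] c by (simp add: J_def)
    fix Q' assume Q': "Q' \<in> D (g c)"
    obtain k where k: "k \<in> G" "k \<circ> g = id" using inv_mem[OF g] by blast
    have kg: "k (g c) = c" using k by (metis comp_apply id_apply)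
    have pQ': "primeideal Q' (sub_ring C)" "g c \<notin> Q'" using Q' by (auto simp: D_def)
    have "c \<notin> k ` Q'" using pQ'(2) kg inj_G[OF k(1)] by (metis imageE injD)
    then have "k ` Q' \<in> D c" using image_prime[OF pQ'(1) k(1)] by (simp add: D_def)
    then have "point_orbit G (localization C (k ` Q')) \<in> W" using c by (simp add: J_def)
    then show "point_orbit G (localization C Q') \<in> W"
      using image_localization[OF k(1)] point_orbit_image[OF k(1)] by metis
  qed
  have "\<not> J \<subseteq> Q"
  proof -
    have "openin (space_of \<Y>) {\<O> \<in> points \<Y>. point_orbit G \<O> \<in> W}"
      using W unfolding openin_quotient_iff by simp
    from openin_YD[OF this, of "localization C Q"] obtain F where
      F: "finite F" "F \<subseteq> localization C Q" "{\<O>' \<in> points \<Y>. F \<subseteq> \<O>'} \<subseteq> {\<O> \<in> points \<Y>. point_orbit G \<O> \<in> W}"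
      using chart_points[OF Q(1)] Q(2) by blast
    have "\<forall>f\<in>F. \<exists>s\<in>C - Q. f * s \<in> C"
    proof
      fix f assume "f \<in> F"
      then obtain a b where ab: "a \<in> C" "b \<in> C - Q" "f = a / b" using F(2) unfolding localization_def by blast
      then have "b \<noteq> 0" using zero_mem_prime[OF subring_C Q(1)] by auto
      then have "f * b \<in> C" using ab by simp
      then show "\<exists>s\<in>C - Q. f * s \<in> C" using ab(2) by (rule bexI)
    qed
    then obtain s where s: "\<And>f. f \<in> F \<Longrightarrow> s f \<in> C - Q \<and> f * s f \<in> C" by metis
    \<comment> \<open>A common denominator of the finitely many functions in \<open>F\<close>:
      wherever \<open>t\<close> is a unit, all of \<open>F\<close> is regular.\<close>
    define t where "t = (\<Prod>f\<in>F. s f)"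
    have tC: "t \<in> C" unfolding t_def using s by (intro C_closed(9)) blast
    have tQ: "t \<notin> Q" unfolding t_def using s primeideal_sub_ring_closed(4)[OF subring_C Q(1) F(1), of s] by auto
    have "t \<in> J"
      unfolding J_def
    proof (intro CollectI conjI ballI tC)
      fix Q' assume "Q' \<in> D t"
      then have Q': "primeideal Q' (sub_ring C)" "t \<notin> Q'" by (auto simp: D_def)
      have "f \<in> localization C Q'" if f: "f \<in> F" for f
      proof -
        have "f * t = (f * s f) * (\<Prod>f\<in>F - {f}. s f)"
          unfolding t_def using prod.remove[OF F(1) f, of s] by simp
        also have "\<dots> \<in> C" by (rule C_closed(6)[OF conjunct2[OF s[OF f]] C_closed(9)]) (use s in blast)
        finally have "f * t \<in> C" .
        moreover have "t \<noteq> 0" using zero_mem_prime[OF subring_C Q'(1)] Q'(2) by metis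
        then have "f = (f * t) / t" by simp
        ultimately show ?thesis unfolding localization_def using tC Q'(2) by blast
      qed
      then show "point_orbit G (localization C Q') \<in> W"
        using F(3) chart_points[OF Q'(1)] by blast
    qed
    then show ?thesis using tQ by blast
  qed
  then obtain a where a: "a \<in> J" "a \<in> A" "a \<notin> Q"
    using invariant_ideal_subset_prime[OF J _ Q(1)] st by blast
  let ?T = "{P. primeideal P (sub_ring A) \<and> a \<notin> P}"
  have "P \<in> ?T" using P prime_inter[OF Q(1)] a by blast
  moreover have "?T \<subseteq> chart_map ` (W \<inter> point_orbit G ` V)"
  proof
    fix P' assume P': "P' \<in> ?T"
    then obtain Q' where Q': "primeideal Q' (sub_ring C)" "Q' \<inter> A = P'" using lying_over by blast
    then have "Q' \<in> D a" using P' a(2) by (auto simp: D_def)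
    then have "point_orbit G (localization C Q') \<in> W" using a(1) by (simp add: J_def)
    moreover have "localization C Q' \<in> V" using Q'(1) by (auto simp: V_def)
    moreover have "P' = chart_map (point_orbit G (localization C Q'))"
      using chart_map_localization[OF Q'(1)] Q'(2) by simp
    ultimately show "P' \<in> chart_map ` (W \<inter> point_orbit G ` V)" by blast
  qed
  ultimately show "\<exists>T. openin (space_of (Spec A)) T \<and> P \<in> T \<and> T \<subseteq> chart_map ` (W \<inter> point_orbit G ` V)"
    using openin_Spec_basic[OF subring_A a(2)] by blast
qed

text \<open>Lying over gives surjectivity and conjugacy of primes gives injectivity. Sections over
  an open set are intersections of local rings, so the comparison of the sheaves reduces to the
  statement that localization commutes with invariants.\<close>

theorem scheme_iso_chart:
  "scheme_iso (open_subscheme \<X> (point_orbit G ` V)) (Spec A) chart_map"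
proof -
  let ?U = "point_orbit G ` V"
  have U: "points (open_subscheme \<X> ?U) = ?U"
    using V_subset by (auto simp: open_subscheme_def points_quotient)
  have cont: "continuous_map (space_of (open_subscheme \<X> ?U)) (space_of (Spec A)) chart_map"
    unfolding Spec_simps
  proof (rule continuous_on_generated_topo)
    fix W assume "W \<in> {{P. primeideal P (sub_ring A) \<and> f \<notin> P} |f. f \<in> A}"
    then obtain f where f: "f \<in> A" "W = {P. primeideal P (sub_ring A) \<and> f \<notin> P}" by blast
    show "openin (space_of (open_subscheme \<X> ?U)) (chart_map -` W \<inter> points (open_subscheme \<X> ?U))"
    \<comment> \<open>The preimage is described by regularity of \<open>inverse f\<close>. Because
      \<open>inverse 0 = 0\<close> is regular everywhere, this description is wrong for
      \<open>f = 0\<close>, where the set is empty.\<close>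
    proof (cases "f = 0")
      case True
      have "W = {}" using True f zero_mem_prime[OF subring_A] by blast
      then show ?thesis by simp
    next
      case False
      define T where "T = {x. \<exists>\<O>\<in>points \<Y>. inverse f \<in> \<O> \<and> x = point_orbit G \<O>}"
      have inv: "\<forall>g\<in>G. g (inverse f) = inverse f" using f(1) by (auto simp: A_eq hom_inverse)
      have open_T: "openin (space_of \<X>) T"
        unfolding T_def by (rule openin_quotient_domain[OF inv])
      have mem_T: "point_orbit G \<O> \<in> T \<longleftrightarrow> chart_map (point_orbit G \<O>) \<in> W" if \<O>: "\<O> \<in> V" for \<O>
      proof -
        have 1: "point_orbit G \<O> \<in> T \<longleftrightarrow> inverse f \<in> \<O>"
          unfolding T_def by (rule orbit_mem_domain_iff[OF inv]) (use \<O> V_subset in blast)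
        have "primeideal (chart_map (point_orbit G \<O>)) (sub_ring A)"
          using \<O> prime_inter chart_map_localization by (auto simp: V_def)
        then show ?thesis unfolding 1 using f False unfolding chart_map_orbit by (auto simp: center_def)
      qed
      have "chart_map -` W \<inter> ?U = T \<inter> ?U"
      proof (rule Set.set_eqI)
        fix x
        show "x \<in> chart_map -` W \<inter> ?U \<longleftrightarrow> x \<in> T \<inter> ?U"
          using mem_T by (cases "x \<in> ?U") (simp_all, metis imageE)
      qed
      moreover have "openin (space_of (open_subscheme \<X> ?U)) (T \<inter> ?U)"
        unfolding open_subscheme_def scheme_in.simps openin_subtopology
        using open_T by blast
      ultimately show ?thesis unfolding U by metis
    qed
  next
    have "chart_map ` points (open_subscheme \<X> ?U) = points (Spec A)" unfolding U by (rule chart_map_image)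
    then show "chart_map ` points (open_subscheme \<X> ?U) \<subseteq> \<Union>{{P. primeideal P (sub_ring A) \<and> f \<notin> P} |f. f \<in> A}"
      unfolding Spec_simps topology_generated_by_topspace by simp
  qed
  have "open_map (space_of (open_subscheme \<X> ?U)) (space_of (Spec A)) chart_map"
    unfolding open_map_def using chart_map_open by (auto simp: open_subscheme_def openin_subtopology)
  then have "homeomorphic_map (space_of (open_subscheme \<X> ?U)) (space_of (Spec A)) chart_map"
    using cont chart_map_image chart_map_inj U
    by (intro bijective_open_imp_homeomorphic_map) simp_all
  moreover have "sections (open_subscheme \<X> ?U) {x \<in> points (open_subscheme \<X> ?U). chart_map x \<in> W} = sections (Spec A) W"
    if W: "openin (space_of (Spec A)) W" for W
  proof -
    let ?\<Omega> = "{\<O> \<in> points \<Y>. point_orbit G \<O> \<in> {x \<in> ?U. chart_map x \<in> W}}"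
    have \<Omega>: "?\<Omega> = {\<O> \<in> points \<Y>. point_orbit G \<O> \<in> ?U \<and> chart_map (point_orbit G \<O>) \<in> W}" by blast
    have lhs: "sections (open_subscheme \<X> ?U) {x \<in> points (open_subscheme \<X> ?U). chart_map x \<in> W} =
        {f \<in> sections \<Y> ?\<Omega>. \<forall>g\<in>G. g f = f}"
      unfolding U by (simp add: open_subscheme_def sections_quotient)
    show ?thesis
    proof (cases "W = {}")
      case True
      then show ?thesis unfolding lhs by (auto simp: sections_Y Spec_simps hom_zero)
    next
      case False
      have W_sub: "W \<subseteq> chart_map ` ?U" using openin_subset[OF W] chart_map_image by simp
      \<comment> \<open>Only the orbit of the point is known to come from a prime of
        \<open>C\<close>; invariant functions do not distinguish the members of an orbit.\<close>
      have key: "localization A P = {f \<in> \<O>. \<forall>g\<in>G. g f = f}"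
        if "\<O> \<in> points \<Y>" "point_orbit G \<O> \<in> ?U" "P = chart_map (point_orbit G \<O>)" for \<O> P
      proof -
        obtain Q where Q: "primeideal Q (sub_ring C)" "point_orbit G \<O> = point_orbit G (localization C Q)"
          using \<open>point_orbit G \<O> \<in> ?U\<close> unfolding V_def by blast
        have "localization A P = {f \<in> localization C Q. \<forall>g\<in>G. g f = f}"
          using localization_invariants[OF Q(1)] that(3) Q(2) chart_map_localization[OF Q(1)] by simp
        then show ?thesis using mem_orbit_invariant[OF _ Q(2)] by blast
      qed
      have "?\<Omega> \<noteq> {}"
      proof -
        obtain P where "P \<in> W" using False by blast
        then obtain \<O> where "\<O> \<in> V" "P = chart_map (point_orbit G \<O>)" using W_sub by blast
        then have "\<O> \<in> ?\<Omega>" using V_subset \<open>P \<in> W\<close> by blast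
        then show ?thesis by blast
      qed
      then have "{f \<in> sections \<Y> ?\<Omega>. \<forall>g\<in>G. g f = f} = (\<Inter>\<O>\<in>?\<Omega>. {f \<in> \<O>. \<forall>g\<in>G. g f = f})"
        unfolding sections_Y by auto
      also have "\<dots> = (\<Inter>\<O>\<in>?\<Omega>. localization A (chart_map (point_orbit G \<O>)))"
        using key by (intro INF_cong) auto
      also have "\<dots> = (\<Inter>P\<in>(\<lambda>\<O>. chart_map (point_orbit G \<O>)) ` ?\<Omega>. localization A P)" by simp
      also have "(\<lambda>\<O>. chart_map (point_orbit G \<O>)) ` ?\<Omega> = W"
        using W_sub V_subset by (auto simp: image_iff) blast+
      finally show ?thesis unfolding lhs using False by (simp add: Spec_simps)
    qed
  qed
  ultimately show ?thesis unfolding scheme_iso_def by blast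
qed

end

section \<open>Totally ramified Galois extensions\<close>

lemma subfield_amb_closed:
  assumes "subfield K (amb :: 'a::field ring)"
  shows "subring K amb" "a \<in> K \<Longrightarrow> inverse a \<in> K" "a \<in> K \<Longrightarrow> b \<in> K \<Longrightarrow> a / b \<in> K"
proof -
  interpret field "amb :: 'a ring" by rule
  show K: "subring K amb" using subfieldE(1)[OF assms] .
  show inv: "inverse a \<in> K" if "a \<in> K" for a
  proof (cases "a = 0")
    case False
    then have "a \<in> K - {\<zero>\<^bsub>amb\<^esub>}" using that by simp
    from subfield_m_inv[OF assms this] have "inv\<^bsub>amb\<^esub> a \<in> K" "a * inv\<^bsub>amb\<^esub> a = 1"
      by auto
    then show ?thesis by (metis inverse_unique)
  qed (use that in simp)
  show "a \<in> K \<Longrightarrow> b \<in> K \<Longrightarrow> a / b \<in> K"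
    using subring_amb_closed(6)[OF K, of a "inverse b"] inv[of b] by (simp add: divide_inverse)
qed

lemma mem_Gal_iff:
  "\<tau> \<in> Gal (K :: 'l::field set) \<longleftrightarrow> bij \<tau> \<and> (\<forall>a b. \<tau> (a + b) = \<tau> a + \<tau> b) \<and> (\<forall>a b. \<tau> (a * b) = \<tau> a * \<tau> b)
    \<and> \<tau> 1 = 1 \<and> (\<forall>a\<in>K. \<tau> a = a)"
  by (auto simp: Gal_def ring_iso_def ring_hom_def)

lemma finite_field_auts_Gal:
  assumes "finite (Gal (K :: 'l::field set))"
  shows "finite_field_auts (Gal K)"
proof
  show "finite (Gal K)" by (fact assms)
  show "id \<in> Gal K" by (simp add: mem_Gal_iff)
  show "g \<circ> h \<in> Gal K" if "g \<in> Gal K" "h \<in> Gal K" for g h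
    using that bij_comp[of h g] by (simp add: mem_Gal_iff)
  show "\<exists>h\<in>Gal K. h \<circ> g = id \<and> g \<circ> h = id" if g: "g \<in> Gal K" for g
  proof -
    have b: "bij g" and hom: "g (a + b) = g a + g b" "g (a * b) = g a * g b" "g 1 = 1" "c \<in> K \<Longrightarrow> g c = c" for a b c
      using g by (simp_all add: mem_Gal_iff)
    have gi: "g (inv_into UNIV g x) = x" "inv_into UNIV g (g x) = x" for x
      using b by (simp_all add: bij_is_surj surj_f_inv_f bij_is_inj)
    have "inv_into UNIV g \<in> Gal K"
      unfolding mem_Gal_iff
    proof (intro conjI allI ballI)
      show "bij (inv_into UNIV g)" by (rule bij_imp_bij_inv[OF b])
      show "inv_into UNIV g (x + y) = inv_into UNIV g x + inv_into UNIV g y" for x y by (metis gi hom(1))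
      show "inv_into UNIV g (x * y) = inv_into UNIV g x * inv_into UNIV g y" for x y by (metis gi hom(2))
      show "inv_into UNIV g 1 = 1" by (metis gi(2) hom(3))
      show "inv_into UNIV g c = c" if "c \<in> K" for c using hom(4)[OF that] gi(2) by metis
    qed
    then show ?thesis using gi by (intro bexI[of _ "inv_into UNIV g"]) auto
  qed
qed (simp_all add: mem_Gal_iff)

lemma (in ring) Span_Cons: "Span K (u # Us) = line_extension K u (Span K Us)"
  by simp

locale totally_ramified =
  fixes p :: nat and K :: "'l::field set" and vK vL :: "'l \<Rightarrow> int" and \<pi> :: 'l
  assumes p_pos: "0 < p" and K_subfield: "subfield K amb"
    and vK: "discrete_valuation K vK" and vL: "discrete_valuation UNIV vL"
    and ram: "\<forall>a\<in>K - {0}. vL a = int p * vK a"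
    and pi_nonzero: "\<pi> \<noteq> 0" and v_pi: "vL \<pi> = 1"
begin

lemmas K_closed = subring_amb_closed[OF subfield_amb_closed(1)[OF K_subfield]]

text \<open>Zero is included by hand as the element of infinite valuation, since \<open>vL 0\<close>
  is arbitrary. In this way the sets are additive groups.\<close>

definition Vge :: "int \<Rightarrow> 'l set" where
  "Vge n = {a. a = 0 \<or> n \<le> vL a}"

abbreviation "RL \<equiv> valuation_ring UNIV vL"
abbreviation "R \<equiv> valuation_ring K vK"

lemma RL_eq: "RL = Vge 0"
  by (auto simp: valuation_ring_def Vge_def)

lemma v_mult: "a \<noteq> 0 \<Longrightarrow> b \<noteq> 0 \<Longrightarrow> vL (a * b) = vL a + vL b"
  using vL by (auto simp: discrete_valuation_def)

lemma v_one: "vL 1 = 0"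
  using v_mult[of 1 1] by simp

lemma v_uminus: "a \<noteq> 0 \<Longrightarrow> vL (- a) = vL a"
  using v_mult[of "-1" "-1"] v_mult[of "-1" a] v_one by simp

lemma v_inverse: "a \<noteq> 0 \<Longrightarrow> vL (inverse a) = - vL a"
  using v_mult[of a "inverse a"] v_one by simp

lemma v_divide: "a \<noteq> 0 \<Longrightarrow> b \<noteq> 0 \<Longrightarrow> vL (a / b) = vL a - vL b"
  using v_mult[of a "inverse b"] v_inverse[of b] by (simp add: divide_inverse)

lemma v_power: "a \<noteq> 0 \<Longrightarrow> vL (a ^ n) = int n * vL a"
  by (induction n) (simp_all add: v_one v_mult algebra_simps)

lemma v_prod: "(\<And>i. i \<in> I \<Longrightarrow> f i \<noteq> 0) \<Longrightarrow> vL (prod f I) = (\<Sum>i\<in>I. vL (f i))"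
  by (induction I rule: infinite_finite_induct) (simp_all add: v_one v_mult)

lemma Vge_zero: "0 \<in> Vge n"
  by (simp add: Vge_def)

lemma Vge_add: "a \<in> Vge n \<Longrightarrow> b \<in> Vge n \<Longrightarrow> a + b \<in> Vge n"
proof -
  assume "a \<in> Vge n" "b \<in> Vge n"
  moreover have "min (vL a) (vL b) \<le> vL (a + b)" if "a \<noteq> 0" "b \<noteq> 0" "a + b \<noteq> 0"
    using vL that by (auto simp: discrete_valuation_def)
  ultimately show ?thesis by (cases "a + b = 0"; cases "a = 0"; cases "b = 0") (auto simp: Vge_def)
qed

lemma Vge_uminus: "a \<in> Vge n \<Longrightarrow> - a \<in> Vge n"
  by (cases "a = 0") (auto simp: Vge_def v_uminus)

lemma Vge_diff: "a \<in> Vge n \<Longrightarrow> b \<in> Vge n \<Longrightarrow> a - b \<in> Vge n"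
  using Vge_add[of a n "- b"] Vge_uminus[of b n] by simp

lemma Vge_sum: "(\<And>i. i \<in> I \<Longrightarrow> f i \<in> Vge n) \<Longrightarrow> sum f I \<in> Vge n"
  by (induction I rule: infinite_finite_induct) (simp_all add: Vge_zero Vge_add)

lemma Vge_mult: "a \<in> Vge n \<Longrightarrow> b \<in> Vge k \<Longrightarrow> a * b \<in> Vge (n + k)"
  by (cases "a = 0"; cases "b = 0") (auto simp: Vge_def v_mult)

lemma Vge_mono: "n \<le> k \<Longrightarrow> a \<in> Vge k \<Longrightarrow> a \<in> Vge n"
  by (auto simp: Vge_def)

lemma subring_RL: "subring RL amb"
  unfolding RL_eq subring_amb_iff
proof (intro conjI ballI)
  show "1 \<in> Vge 0" by (simp add: Vge_def v_one)
  show "a - b \<in> Vge 0" "a * b \<in> Vge 0" if "a \<in> Vge 0" "b \<in> Vge 0" for a b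
    using Vge_diff[OF that] Vge_mult[OF that] by simp_all
qed

lemma R_eq: "R = K \<inter> RL"
proof -
  have "0 \<le> vK a \<longleftrightarrow> 0 \<le> vL a" if "a \<in> K" "a \<noteq> 0" for a
    using ram that p_pos by (simp add: zero_le_mult_iff)
  then show ?thesis by (auto simp: valuation_ring_def)
qed

lemma subring_R: "subring R amb"
  using K_closed subring_amb_closed[OF subring_RL] unfolding R_eq subring_amb_iff by auto

lemma v_term:
  assumes "b \<in> K" "b \<noteq> 0"
  shows "vL (b * \<pi> ^ i) = int p * vK b + int i"
  using assms ram pi_nonzero by (simp add: v_mult v_power v_pi)

text \<open>The nonzero terms \<open>b i * \<pi> ^ i\<close> have distinct valuations, as these are distinct modulo
  \<open>p\<close>.\<close>

lemma mem_Vge_term: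
  assumes b: "\<And>i. i < p \<Longrightarrow> b i \<in> K" and sum: "(\<Sum>i<p. b i * \<pi> ^ i) \<in> Vge n" and i: "i < p"
  shows "b i * \<pi> ^ i \<in> Vge n"
proof (rule ccontr)
  assume neg: "b i * \<pi> ^ i \<notin> Vge n"
  let ?t = "\<lambda>i. b i * \<pi> ^ i"
  define S where "S = {i. i < p \<and> ?t i \<notin> Vge n}"
  have "finite S" "S \<noteq> {}" using neg i by (auto simp: S_def)
  then have "Min ((\<lambda>i. vL (?t i)) ` S) \<in> (\<lambda>i. vL (?t i)) ` S" by (intro Min_in) auto
  then obtain k where "k \<in> S" "Min ((\<lambda>i. vL (?t i)) ` S) = vL (?t k)" by blast
  then have k: "k \<in> S" "\<And>j. j \<in> S \<Longrightarrow> vL (?t k) \<le> vL (?t j)"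
    using Min_le[of "(\<lambda>i. vL (?t i)) ` S"] \<open>finite S\<close> by auto
  have kn: "k < p" "?t k \<noteq> 0" "vL (?t k) < n" "b k \<noteq> 0" using k(1) by (auto simp: S_def Vge_def)
  \<comment> \<open>Terms outside \<open>S\<close> have valuation at least \<open>n\<close>, and
    those in \<open>S\<close> at least that of term \<open>k\<close> but different from it modulo
    \<open>p\<close>. So all other terms, and the sum itself, have larger valuation than term
    \<open>k\<close>, which then could not cancel.\<close>
  have other: "?t j \<in> Vge (vL (?t k) + 1)" if j: "j < p" "j \<noteq> k" for j
  proof (cases "j \<in> S")
    case True
    then have "b j \<noteq> 0" by (auto simp: S_def Vge_def)
    then have "vL (?t j) = int p * vK (b j) + int j" "vL (?t k) = int p * vK (b k) + int k"
      using v_term b j kn by auto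
    moreover have "(int p * vK (b j) + int j) mod int p = int j" "(int p * vK (b k) + int k) mod int p = int k"
      using j kn by simp_all
    ultimately have "vL (?t j) \<noteq> vL (?t k)" using j by (metis of_nat_eq_iff)
    then show ?thesis using k(2)[OF True] by (simp add: Vge_def)
  next
    case False
    then have "?t j \<in> Vge n" using j by (simp add: S_def)
    then show ?thesis by (rule Vge_mono[rotated]) (use kn in simp)
  qed
  have "(\<Sum>i<p. ?t i) = ?t k + (\<Sum>i\<in>{..<p} - {k}. ?t i)"
    using kn by (intro sum.remove) auto
  then have "?t k = (\<Sum>i<p. ?t i) - (\<Sum>i\<in>{..<p} - {k}. ?t i)" by simp
  also have "\<dots> \<in> Vge (vL (?t k) + 1)"
    by (rule Vge_diff[OF Vge_mono[OF _ sum] Vge_sum]) (use kn other in auto)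
  finally show False using kn by (simp add: Vge_def)
qed

text \<open>The term number \<open>i\<close> has valuation \<open>p * vK (b i) + i\<close>; for
  \<open>i < p\<close> this can be nonnegative only if \<open>vK (b i)\<close> is.\<close>

lemma coeff_mem_R:
  assumes b: "\<And>i. i < p \<Longrightarrow> b i \<in> K" and sum: "(\<Sum>i<p. b i * \<pi> ^ i) \<in> RL" and i: "i < p"
  shows "b i \<in> R"
proof (cases "b i = 0")
  case False
  have "b i * \<pi> ^ i \<in> Vge 0" using mem_Vge_term[OF b sum[unfolded RL_eq] i] .
  then have "0 \<le> int p * vK (b i) + int i"
    using v_term[OF b[OF i] False] False pi_nonzero by (simp add: Vge_def)
  have "\<not> vK (b i) \<le> -1"
  proof
    assume "vK (b i) \<le> -1"
    then have "int p * vK (b i) \<le> int p * (-1)" by (rule mult_left_mono) simp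
    then show False using \<open>0 \<le> int p * vK (b i) + int i\<close> i by simp
  qed
  then show ?thesis using b[OF i] by (auto simp: valuation_ring_def)
qed (simp add: valuation_ring_def K_closed)

text \<open>Zero belongs to every \<open>Vge n\<close>, in particular to the one just above the
  valuation of a supposedly nonzero term.\<close>

lemma basis_independent:
  assumes b: "\<And>i. i < p \<Longrightarrow> b i \<in> K" and sum: "(\<Sum>i<p. b i * \<pi> ^ i) = 0" and i: "i < p"
  shows "b i = 0"
proof (rule ccontr)
  assume "b i \<noteq> 0"
  then have "b i * \<pi> ^ i \<noteq> 0" using pi_nonzero by simp
  moreover have "b i * \<pi> ^ i \<in> Vge (vL (b i * \<pi> ^ i) + 1)"
    by (rule mem_Vge_term[OF b _ i]) (simp_all add: sum Vge_zero)
  ultimately show False by (simp add: Vge_def)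
qed

end

section \<open>The minimal polynomial of the uniformizer and its conjugates\<close>

locale galois_totally_ramified = totally_ramified +
  fixes \<phi> :: "'a poly"
  assumes dim: "ring.dimension amb p K UNIV" and galois: "galois_over K"
    and min_poly: "is_min_poly K \<pi> \<phi>"
begin

text \<open>The first \<open>p\<close> powers of \<pi> are independent for valuation reasons, and
  \<open>p\<close> independent vectors span a space of dimension \<open>p\<close>.\<close>

lemma power_basis: "\<exists>b. (\<forall>i. b i \<in> K) \<and> a = (\<Sum>i<p. b i * \<pi> ^ i)"
proof -
  interpret F: field "amb :: 'a ring" by rule
  define pw where "pw n = map (\<lambda>i. \<pi> ^ i) (rev [0..<n])" for n
  have pw_Suc: "pw (Suc n) = \<pi> ^ n # pw n" for n by (simp add: pw_def)
  have Span: "F.Span K (pw n) = {(\<Sum>i<n. b i * \<pi> ^ i) | b. \<forall>i. b i \<in> K}" for n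
  proof (induction n)
    case 0
    have "\<exists>b::nat \<Rightarrow> 'a. \<forall>i. b i \<in> K" using K_closed(1) by (intro exI[of _ "\<lambda>_. 0"]) simp
    then show ?case by (auto simp: pw_def)
  next
    case (Suc n)
    have "F.Span K (pw (Suc n)) = {k * \<pi> ^ n + v | k v. k \<in> K \<and> v \<in> F.Span K (pw n)}"
      unfolding pw_Suc F.Span_Cons F.line_extension_def set_add_def' r_coset_def by auto
    also have "\<dots> = {(\<Sum>i<Suc n. b i * \<pi> ^ i) | b. \<forall>i. b i \<in> K}"
    proof (intro equalityI subsetI)
      fix x assume "x \<in> {k * \<pi> ^ n + v | k v. k \<in> K \<and> v \<in> F.Span K (pw n)}"
      then obtain k b where kb: "k \<in> K" "\<forall>i. b i \<in> K" "x = k * \<pi> ^ n + (\<Sum>i<n. b i * \<pi> ^ i)"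
        unfolding Suc by blast
      then have "x = (\<Sum>i<Suc n. (b(n := k)) i * \<pi> ^ i)" by (simp add: add.commute)
      moreover have "\<forall>i. (b(n := k)) i \<in> K" using kb by simp
      ultimately show "x \<in> {(\<Sum>i<Suc n. b i * \<pi> ^ i) | b. \<forall>i. b i \<in> K}" by blast
    next
      fix x assume "x \<in> {(\<Sum>i<Suc n. b i * \<pi> ^ i) | b. \<forall>i. b i \<in> K}"
      then obtain b where b: "\<forall>i. b i \<in> K" "x = (\<Sum>i<Suc n. b i * \<pi> ^ i)" by blast
      then have "x = b n * \<pi> ^ n + (\<Sum>i<n. b i * \<pi> ^ i)" by (simp add: add.commute)
      then show "x \<in> {k * \<pi> ^ n + v | k v. k \<in> K \<and> v \<in> F.Span K (pw n)}"
        unfolding Suc using b(1) by blast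
    qed
    finally show ?case .
  qed
  have "F.independent K (pw n)" if "n \<le> p" for n
    using that
  proof (induction n)
    case (Suc n)
    have "\<pi> ^ n \<notin> F.Span K (pw n)"
    proof
      assume "\<pi> ^ n \<in> F.Span K (pw n)"
      then obtain b where b: "\<forall>i. b i \<in> K" "\<pi> ^ n = (\<Sum>i<n. b i * \<pi> ^ i)" unfolding Span by blast
      define c where "c i = (if i < n then b i else if i = n then -1 else 0)" for i
      have "(\<Sum>i<p. c i * \<pi> ^ i) = (\<Sum>i<Suc n. c i * \<pi> ^ i)"
        using Suc.prems by (intro sum.mono_neutral_right) (auto simp: c_def)
      also have "\<dots> = 0" using b(2) by (simp add: c_def)
      finally have "c n = 0"
      proof (intro basis_independent[of c n])
        show "c i \<in> K" for i using b(1) K_closed(1) K_closed(5)[OF K_closed(2)] by (simp add: c_def)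
      qed (use Suc.prems in auto)
      then show False by (simp add: c_def)
    qed
    then show ?case unfolding pw_Suc using Suc by (intro F.li_Cons) auto
  qed (simp add: pw_def)
  then have "F.Span K (pw p) = UNIV"
    using F.independent_length_eq_dimension[OF K_subfield dim, of "pw p"] by (simp add: pw_def)
  then show ?thesis unfolding Span by blast
qed

lemma phi: "lead_coeff \<phi> = 1" "poly.coeff \<phi> i \<in> K" "poly \<phi> \<pi> = 0"
  "g \<noteq> 0 \<Longrightarrow> (\<And>i. poly.coeff g i \<in> K) \<Longrightarrow> poly g \<pi> = 0 \<Longrightarrow> Polynomial.degree \<phi> \<le> Polynomial.degree g"
  using min_poly by (auto simp: is_min_poly_def)

lemma phi_nonzero: "\<phi> \<noteq> 0"
  using phi(1) by auto

text \<open>Expressing \<open>\<pi> ^ p\<close> through lower powers gives a monic annihilating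
  polynomial of degree \<open>p\<close>; one of smaller degree would be a relation between
  independent powers.\<close>

lemma degree_phi: "Polynomial.degree \<phi> = p"
proof (rule antisym)
  obtain b where b: "\<forall>i. b i \<in> K" "\<pi> ^ p = (\<Sum>i<p. b i * \<pi> ^ i)" using power_basis by blast
  define g where "g = Polynomial.monom 1 p - (\<Sum>i<p. Polynomial.monom (b i) i)"
  have cf: "poly.coeff g i = (if i = p then 1 else if i < p then - b i else 0)" for i
    by (auto simp: g_def coeff_sum sum.delta)
  have "poly g \<pi> = 0" using b by (simp add: g_def poly_sum poly_monom)
  moreover have "poly.coeff g i \<in> K" for i using b K_closed(1,2,5) by (simp add: cf)
  moreover have "g \<noteq> 0" using cf[of p] by auto
  ultimately have "Polynomial.degree \<phi> \<le> Polynomial.degree g" by (intro phi(4)) auto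
  also have "\<dots> \<le> p" by (rule degree_le) (simp add: cf)
  finally show "Polynomial.degree \<phi> \<le> p" .
next
  show "p \<le> Polynomial.degree \<phi>"
  proof (rule ccontr)
    assume *: "\<not> p \<le> Polynomial.degree \<phi>"
    have "(\<Sum>i<p. poly.coeff \<phi> i * \<pi> ^ i) = (\<Sum>i\<le>Polynomial.degree \<phi>. poly.coeff \<phi> i * \<pi> ^ i)"
      using * by (intro sum.mono_neutral_right) (auto simp: coeff_eq_0)
    also have "\<dots> = 0" using phi(3) by (simp add: poly_altdef)
    finally have "poly.coeff \<phi> (Polynomial.degree \<phi>) = 0"
      using * phi(2) by (intro basis_independent[of "poly.coeff \<phi>"]) auto
    then show False using phi(1) by simp
  qed
qed

lemma Gal_hom:
  assumes "g \<in> Gal K"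
  shows "g (a + b) = g a + g b" "g (a * b) = g a * g b" "g 1 = 1" "g 0 = 0" "c \<in> K \<Longrightarrow> g c = c"
    "g (a ^ n) = g a ^ n" "g (sum f I) = (\<Sum>i\<in>I. g (f i))"
proof -
  show add: "g (a + b) = g a + g b" and mult: "g (a * b) = g a * g b" and one: "g 1 = 1"
    and "c \<in> K \<Longrightarrow> g c = c" for a b using assms by (auto simp: mem_Gal_iff)
  show zero: "g 0 = 0" using add[of 0 0] by (metis add.right_neutral add_left_cancel)
  show "g (a ^ n) = g a ^ n" by (induction n) (simp_all add: one mult)
  show "g (sum f I) = (\<Sum>i\<in>I. g (f i))"
    by (induction I rule: infinite_finite_induct) (simp_all add: zero add)
qed

lemma poly_phi_conj:
  assumes "g \<in> Gal K"
  shows "poly \<phi> (g \<pi>) = 0"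
proof -
  note h = Gal_hom[OF assms]
  have "poly \<phi> (g \<pi>) = g (poly \<phi> \<pi>)"
    unfolding poly_altdef h(7) h(2) h(6) by (simp add: h(5)[OF phi(2)])
  then show ?thesis using phi(3) h(4) by simp
qed

text \<open>Every element is a polynomial in \<pi> over \<open>K\<close>, so the image of \<pi>
  determines the automorphism.\<close>

lemma inj_on_conj_pi: "inj_on (\<lambda>g. g \<pi>) (Gal K)"
proof (rule inj_onI, rule ext)
  fix g h a assume g: "g \<in> Gal K" and h: "h \<in> Gal K" and eq: "g \<pi> = h \<pi>"
  obtain b where b: "\<forall>i. b i \<in> K" "a = (\<Sum>i<p. b i * \<pi> ^ i)" using power_basis by blast
  show "g a = h a"
    unfolding b(2) Gal_hom(7)[OF g] Gal_hom(7)[OF h] Gal_hom(2)[OF g] Gal_hom(2)[OF h]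
      Gal_hom(6)[OF g] Gal_hom(6)[OF h] eq
    using b(1) Gal_hom(5)[OF g] Gal_hom(5)[OF h] by simp
qed

lemma conj_pi_subset_roots: "(\<lambda>g. g \<pi>) ` Gal K \<subseteq> {x. poly \<phi> x = 0}"
  using poly_phi_conj by auto

lemma finite_Gal: "finite (Gal K)"
  using finite_subset[OF conj_pi_subset_roots poly_roots_finite[OF phi_nonzero]] inj_on_conj_pi
  by (rule finite_imageD)

sublocale gal: finite_field_auts "Gal K"
  by (rule finite_field_auts_Gal[OF finite_Gal])

lemma fixed_iff: "(\<forall>g\<in>Gal K. g a = a) \<longleftrightarrow> a \<in> K"
  using galois unfolding galois_over_def by blast

text \<open>The product is monic, has root \<pi>, and has coefficients in \<open>K\<close> because
  these are Galois invariant. Minimality bounds the degree of \<phi> from above, and its distinct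
  roots \<open>g \<pi>\<close> bound it from below. The difference of the two monic polynomials then
  has smaller degree and still kills \<pi>.\<close>

lemma phi_eq_prod: "\<phi> = (\<Prod>g\<in>Gal K. [:- g \<pi>, 1:])"
proof -
  let ?\<psi> = "\<Prod>g\<in>Gal K. [:- g \<pi>, 1:]"
  have deg: "Polynomial.degree ?\<psi> = card (Gal K)"
    by (subst degree_prod_eq_sum_degree) simp_all
  have monic: "lead_coeff ?\<psi> = 1" by (simp add: lead_coeff_prod)
  have K: "poly.coeff ?\<psi> i \<in> K" for i
    unfolding fixed_iff[symmetric] using gal.poly_prod_orbit_invariant by blast
  have root: "poly ?\<psi> \<pi> = 0"
    unfolding poly_prod using gal.id_mem finite_Gal by (intro prod_zero bexI[of _ id]) auto
  have "card ((\<lambda>g. g \<pi>) ` Gal K) \<le> Polynomial.degree \<phi>"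
    using card_mono[OF poly_roots_finite[OF phi_nonzero] conj_pi_subset_roots]
      card_poly_roots_bound[OF phi_nonzero] by simp
  moreover have "card ((\<lambda>g. g \<pi>) ` Gal K) = card (Gal K)"
    by (rule card_image[OF inj_on_conj_pi])
  moreover have "Polynomial.degree \<phi> \<le> card (Gal K)"
  proof -
    have "?\<psi> \<noteq> 0" using monic by (metis leading_coeff_0_iff one_neq_zero)
    then show ?thesis using phi(4)[OF _ K root] deg by simp
  qed
  ultimately have degs: "Polynomial.degree \<phi> = Polynomial.degree ?\<psi>" using deg by simp
  show ?thesis
  proof (rule ccontr)
    assume "\<phi> \<noteq> ?\<psi>"
    then have nz: "\<phi> - ?\<psi> \<noteq> 0" by simp
    have "Polynomial.degree (\<phi> - ?\<psi>) < Polynomial.degree \<phi>"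
    proof (rule ccontr)
      assume "\<not> ?thesis"
      moreover have "Polynomial.degree (\<phi> - ?\<psi>) \<le> Polynomial.degree \<phi>"
        using degs by (intro degree_diff_le) auto
      ultimately have "lead_coeff (\<phi> - ?\<psi>) = 0" using degs phi(1) monic by simp
      then show False using nz leading_coeff_0_iff by blast
    qed
    moreover have "Polynomial.degree \<phi> \<le> Polynomial.degree (\<phi> - ?\<psi>)"
      using phi(2,3) K root K_closed(4) by (intro phi(4)[OF nz]) auto
    ultimately show False by simp
  qed
qed

lemma card_Gal: "card (Gal K) = p"
proof -
  have "Polynomial.degree (\<Prod>g\<in>Gal K. [:- g \<pi>, 1:]) = card (Gal K)"
    by (subst degree_prod_eq_sum_degree) simp_all
  then show ?thesis using degree_phi phi_eq_prod by simp
qed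

text \<open>The lower terms at \<pi> add up to \<open>- (\<pi> ^ p)\<close>, so each of them has
  valuation at least \<open>p\<close>. As \<open>i < p\<close>, the coefficient has positive
  valuation, and valuations of elements of \<open>K\<close> are multiples of
  \<open>p\<close>.\<close>

lemma eisenstein:
  assumes "i < p"
  shows "poly.coeff \<phi> i \<in> Vge (int p)"
proof (cases "poly.coeff \<phi> i = 0")
  case False
  have "(\<Sum>i\<le>p. poly.coeff \<phi> i * \<pi> ^ i) = 0"
    using phi(3) by (simp add: poly_altdef degree_phi)
  then have "(\<Sum>i<p. poly.coeff \<phi> i * \<pi> ^ i) = - (\<pi> ^ p)"
    using phi(1) by (simp add: degree_phi lessThan_Suc_atMost[symmetric] eq_neg_iff_add_eq_0)
  moreover have "- (\<pi> ^ p) \<in> Vge (int p)"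
    using pi_nonzero by (intro Vge_uminus) (simp add: Vge_def v_power v_pi)
  ultimately have "poly.coeff \<phi> i * \<pi> ^ i \<in> Vge (int p)"
    using phi(2) assms by (intro mem_Vge_term[of "poly.coeff \<phi>"]) auto
  then have "int p \<le> int p * vK (poly.coeff \<phi> i) + int i"
    using v_term[OF phi(2) False] False pi_nonzero by (simp add: Vge_def)
  then have "0 < int p * vK (poly.coeff \<phi> i)" using assms by linarith
  then have "1 \<le> vK (poly.coeff \<phi> i)" using p_pos by (simp add: zero_less_mult_iff)
  then have "int p * 1 \<le> int p * vK (poly.coeff \<phi> i)" by (rule mult_left_mono) simp
  then show ?thesis using ram phi(2) False by (simp add: Vge_def)
qed (simp add: Vge_zero)

text \<open>If \<open>g \<pi>\<close> had valuation at most 0, the leading term of the Eisenstein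
  equation at \<open>g \<pi>\<close> would have strictly smaller valuation than all others. This
  starts the proof that automorphisms respect \<open>vL\<close>, which is derived here from the
  equation of \<pi>.\<close>

lemma conj_pi_Vge:
  assumes "g \<in> Gal K"
  shows "g \<pi> \<in> Vge 1"
proof (rule ccontr)
  assume "g \<pi> \<notin> Vge 1"
  then have nz: "g \<pi> \<noteq> 0" and v: "vL (g \<pi>) \<le> 0" by (auto simp: Vge_def)
  let ?v = "vL (g \<pi>)"
  have "(\<Sum>i\<le>p. poly.coeff \<phi> i * g \<pi> ^ i) = 0"
    using poly_phi_conj[OF assms] by (simp add: poly_altdef degree_phi)
  then have "g \<pi> ^ p = - (\<Sum>i<p. poly.coeff \<phi> i * g \<pi> ^ i)"
    using phi(1) by (simp add: degree_phi lessThan_Suc_atMost[symmetric] eq_neg_iff_add_eq_0 add.commute)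
  also have "\<dots> \<in> Vge (int p * ?v + 1)"
  proof (intro Vge_uminus Vge_sum)
    fix i assume i: "i \<in> {..<p}"
    have "g \<pi> ^ i \<in> Vge (int i * ?v)" using nz by (simp add: Vge_def v_power)
    then have "poly.coeff \<phi> i * g \<pi> ^ i \<in> Vge (int p + int i * ?v)"
      using i by (intro Vge_mult eisenstein) auto
    moreover have "int p * ?v \<le> int i * ?v"
      using i v by (intro mult_right_mono_neg) auto
    ultimately show "poly.coeff \<phi> i * g \<pi> ^ i \<in> Vge (int p * ?v + 1)"
      using p_pos by (intro Vge_mono[of "int p * ?v + 1" "int p + int i * ?v"]) auto
  qed
  finally show False using nz by (simp add: Vge_def v_power)
qed

lemma conj_RL:
  assumes g: "g \<in> Gal K" and a: "a \<in> RL"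
  shows "g a \<in> RL"
proof -
  obtain b where b: "\<forall>i. b i \<in> K" "a = (\<Sum>i<p. b i * \<pi> ^ i)" using power_basis by blast
  have bR: "b i \<in> R" if "i < p" for i
    using coeff_mem_R[of b i] b a that by simp
  have "g a = (\<Sum>i<p. b i * g \<pi> ^ i)"
    unfolding b(2) Gal_hom(7)[OF g] Gal_hom(2)[OF g] Gal_hom(6)[OF g] using Gal_hom(5)[OF g] b(1) by simp
  also have "\<dots> \<in> RL"
    using bR conj_pi_Vge[OF g] Vge_mono[of 0 1] subring_amb_closed[OF subring_RL]
    unfolding R_eq by (intro subring_amb_closed(8)[OF subring_RL]) (auto simp: RL_eq[symmetric])
  finally show ?thesis .
qed

text \<open>With \<open>h\<close> inverse to \<open>g\<close>, the quotient
  \<open>h \<pi> / \<pi>\<close> is integral, and so is its image under \<open>g\<close>. Hence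
  \<open>\<pi>\<close> is \<open>g \<pi>\<close> times an integral element, which bounds the
  valuation of \<open>g \<pi>\<close> by 1 from above.\<close>

lemma v_conj_pi:
  assumes g: "g \<in> Gal K"
  shows "vL (g \<pi>) = 1"
proof -
  obtain h where h: "h \<in> Gal K" "g \<circ> h = id" using gal.inv_mem[OF g] by blast
  have nz: "g \<pi> \<noteq> 0" "h \<pi> \<noteq> 0" using gal.hom_eq_zero_iff pi_nonzero g h by auto
  define u where "u = h \<pi> / \<pi>"
  have "u \<in> RL"
    using conj_pi_Vge[OF h(1)] nz pi_nonzero v_pi by (auto simp: RL_eq Vge_def u_def v_divide)
  then have "g u \<in> Vge 0" using conj_RL[OF g] by (simp add: RL_eq)
  moreover have "g u \<noteq> 0" using nz pi_nonzero gal.hom_eq_zero_iff[OF g] by (simp add: u_def)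
  moreover have "\<pi> = g \<pi> * g u"
  proof -
    have "\<pi> = g (h \<pi>)" using h(2) by (metis comp_apply id_apply)
    also have "h \<pi> = \<pi> * u" using pi_nonzero by (simp add: u_def)
    finally show ?thesis by (simp add: Gal_hom(2)[OF g])
  qed
  ultimately have "1 = vL (g \<pi>) + vL (g u)" "0 \<le> vL (g u)"
    using v_mult[OF nz(1), of "g u"] v_pi by (auto simp: Vge_def)
  then show ?thesis using conj_pi_Vge[OF g] nz by (simp add: Vge_def)
qed

lemma conj_Vge:
  assumes g: "g \<in> Gal K" and a: "a \<in> Vge (int n)"
  shows "g a \<in> Vge (int n)"
proof (cases "a = 0")
  case False
  define u where "u = a / \<pi> ^ n"
  have "u \<in> RL" using a False pi_nonzero by (auto simp: RL_eq Vge_def u_def v_divide v_power v_pi)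
  then have "g u \<in> Vge 0" using conj_RL[OF g] by (simp add: RL_eq)
  moreover have "g \<pi> ^ n \<in> Vge (int n)"
    using v_conj_pi[OF g] gal.hom_eq_zero_iff[OF g] pi_nonzero by (simp add: Vge_def v_power)
  moreover have "g a = g \<pi> ^ n * g u"
  proof -
    have "a = \<pi> ^ n * u" using pi_nonzero by (simp add: u_def)
    then have "g a = g (\<pi> ^ n * u)" by simp
    then show ?thesis unfolding Gal_hom(2)[OF g] Gal_hom(6)[OF g] .
  qed
  ultimately show ?thesis using Vge_mult[of "g \<pi> ^ n" "int n" "g u" 0] by simp
qed (simp add: Gal_hom(4)[OF g] Vge_zero)

text \<open>Only the generator enters the definition of \<open>m\<close>. The bound passes to its
  powers by telescoping, because automorphisms preserve lower bounds for the valuation.\<close>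

lemma conj_pi_diff:
  assumes \<sigma>: "\<sigma> \<in> Gal K" and gen: "Gal K = {\<sigma> ^^ j | j. True}" and m: "int m = vL (\<sigma> \<pi> - \<pi>)"
    and g: "g \<in> Gal K"
  shows "g \<pi> - \<pi> \<in> Vge (int m)"
proof -
  have pw: "\<sigma> ^^ j \<in> Gal K" for j using gen by blast
  have "(\<sigma> ^^ j) \<pi> - \<pi> \<in> Vge (int m)" for j
  proof (induction j)
    case (Suc j)
    have "(\<sigma> ^^ Suc j) \<pi> - \<pi> = \<sigma> ((\<sigma> ^^ j) \<pi> - \<pi>) + (\<sigma> \<pi> - \<pi>)"
      by (simp add: gal.hom_diff[OF \<sigma>])
    moreover have "\<sigma> \<pi> - \<pi> \<in> Vge (int m)" using m by (simp add: Vge_def)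
    ultimately show ?case using Vge_add conj_Vge[OF \<sigma> Suc] by metis
  qed (simp add: Vge_zero)
  moreover obtain j where "g = \<sigma> ^^ j" using g gen by blast
  ultimately show ?thesis by simp
qed

lemma prod_conj_pi: "poly.coeff \<phi> 0 = (-1) ^ p * (\<Prod>g\<in>Gal K. g \<pi>)"
proof -
  have "poly.coeff \<phi> 0 = poly \<phi> 0" by (simp add: poly_0_coeff_0)
  also have "\<dots> = (\<Prod>g\<in>Gal K. - g \<pi>)" unfolding phi_eq_prod poly_prod by simp
  also have "\<dots> = (-1) ^ p * (\<Prod>g\<in>Gal K. g \<pi>)"
    using prod_constant[of "-1" "Gal K"] card_Gal by (simp add: prod_uminus)
  finally show ?thesis .
qed

text \<open>Up to sign this coefficient is the norm of \<pi>, a product of \<open>p\<close>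
  conjugates of valuation 1.\<close>

lemma v_coeff_0: "poly.coeff \<phi> 0 \<noteq> 0" "vL (poly.coeff \<phi> 0) = int p"
proof -
  have nz: "g \<pi> \<noteq> 0" if "g \<in> Gal K" for g
    using gal.hom_eq_zero_iff[OF that] pi_nonzero by simp
  then have nz': "(\<Prod>g\<in>Gal K. g \<pi>) \<noteq> 0" using finite_Gal by simp
  then show "poly.coeff \<phi> 0 \<noteq> 0" unfolding prod_conj_pi by simp
  have "vL ((-1) ^ p) = 0" using v_power[of "-1" p] v_uminus[of 1] v_one by simp
  then show "vL (poly.coeff \<phi> 0) = int p"
    unfolding prod_conj_pi using nz' nz v_conj_pi card_Gal by (simp add: v_mult v_prod)
qed

lemma vK_coeff_0: "vK (poly.coeff \<phi> 0) = 1"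
  using v_coeff_0 ram phi(2)[of 0] p_pos by simp

end

section \<open>Polynomials and rational functions over a subring\<close>

definition polys_over :: "'a::comm_ring_1 set \<Rightarrow> 'a poly set" where
  "polys_over S = {f. \<forall>i. poly.coeff f i \<in> S}"

context
  fixes S :: "'a::comm_ring_1 set"
  assumes S: "subring S amb"
begin

lemmas S_closed = subring_amb_closed[OF S]

lemma subring_polys_over: "subring (polys_over S) amb"
  unfolding subring_amb_iff
proof (intro conjI ballI)
  show "1 \<in> polys_over S" using S_closed(1,2) by (simp add: polys_over_def)
  show "f - g \<in> polys_over S" "f * g \<in> polys_over S" if "f \<in> polys_over S" "g \<in> polys_over S" for f g
    using that S_closed(4) by (auto simp: polys_over_def coeff_mult intro!: S_closed(6,8))
qed

lemma pCons_mem_polys_over: "pCons a f \<in> polys_over S \<longleftrightarrow> a \<in> S \<and> f \<in> polys_over S"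
proof
  assume *: "pCons a f \<in> polys_over S"
  have "poly.coeff (pCons a f) 0 \<in> S" "poly.coeff (pCons a f) (Suc i) \<in> S" for i
    using * by (simp_all only: polys_over_def mem_Collect_eq)
  then show "a \<in> S \<and> f \<in> polys_over S" by (simp add: polys_over_def)
qed (auto simp: polys_over_def coeff_pCons split: nat.split)

lemma monom_mem_polys_over: "a \<in> S \<Longrightarrow> Polynomial.monom a n \<in> polys_over S"
  using S_closed(1) by (simp add: polys_over_def)

lemma smult_mem_polys_over: "a \<in> S \<Longrightarrow> f \<in> polys_over S \<Longrightarrow> smult a f \<in> polys_over S"
  using S_closed(6) by (simp add: polys_over_def)

lemma pcompose_mem_polys_over: "f \<in> polys_over S \<Longrightarrow> g \<in> polys_over S \<Longrightarrow> f \<circ>\<^sub>p g \<in> polys_over S"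
proof (induction f)
  case (pCons a f)
  then have "a \<in> S" "f \<in> polys_over S" by (simp_all add: pCons_mem_polys_over)
  then have "[:a:] \<in> polys_over S" "g * (f \<circ>\<^sub>p g) \<in> polys_over S"
    using pCons subring_amb_closed(1,6)[OF subring_polys_over] by (auto simp: pCons_mem_polys_over)
  then show ?case
    unfolding pcompose_pCons by (rule subring_amb_closed(3)[OF subring_polys_over])
qed simp

end

text \<open>Long division inverts nothing but the leading coefficient of the divisor. Applied over
  \<open>K\<close> and over \<open>RL\<close>, this makes division by \<open>N\<close> compatible
  with both rings of coefficients.\<close>

lemma div_mod_mem_polys_over:
  fixes S :: "'a::field set"
  assumes S: "subring S amb" and d: "d \<in> polys_over S" "inverse (lead_coeff d) \<in> S" "d \<noteq> 0"
    and f: "f \<in> polys_over S"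
  shows "f div d \<in> polys_over S \<and> f mod d \<in> polys_over S"
  using f
proof (induction "Polynomial.degree f" arbitrary: f rule: less_induct)
  case less
  note cl = subring_amb_closed[OF subring_polys_over[OF S]]
  show ?case
  proof (cases "f = 0 \<or> Polynomial.degree f < Polynomial.degree d")
    case True
    then have "f div d = 0" "f mod d = f" by (auto simp: div_poly_less mod_poly_less)
    then show ?thesis using less.prems cl(1) by simp
  next
    case False
    define q where "q = Polynomial.monom (lead_coeff f * inverse (lead_coeff d)) (Polynomial.degree f - Polynomial.degree d)"
    have q: "q \<in> polys_over S"
      unfolding q_def using less.prems d(2) subring_amb_closed(6)[OF S]
      by (intro monom_mem_polys_over[OF S]) (simp add: polys_over_def)
    define f' where "f' = f - q * d"
    have f': "f' \<in> polys_over S" unfolding f'_def using less.prems q d(1) cl(4,6) by blast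
    have eq: "f = f' + q * d" by (simp add: f'_def)
    have dd: "f div d = q + f' div d" "f mod d = f' mod d"
      unfolding eq using d(3) by simp_all
    have "f' div d \<in> polys_over S \<and> f' mod d \<in> polys_over S"
    proof (cases "f' = 0")
      case False
      have nz: "lead_coeff f \<noteq> 0" "lead_coeff d \<noteq> 0" using \<open>\<not> (f = 0 \<or> _)\<close> d(3) by auto
      then have degq: "Polynomial.degree (q * d) = Polynomial.degree f"
        using \<open>\<not> (f = 0 \<or> _)\<close> d(3) by (subst degree_mult_eq) (auto simp: q_def degree_monom_eq monom_eq_0_iff)
      have "lead_coeff (q * d) = lead_coeff q * lead_coeff d" by (rule lead_coeff_mult)
      also have "\<dots> = lead_coeff f" using nz by (simp add: q_def degree_monom_eq)
      finally have "poly.coeff f' (Polynomial.degree f) = 0" using degq by (simp add: f'_def)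
      moreover have "Polynomial.degree f' \<le> Polynomial.degree f"
        unfolding f'_def using degq by (intro degree_diff_le) auto
      ultimately have "Polynomial.degree f' < Polynomial.degree f"
        using False by (metis leading_coeff_0_iff nat_less_le)
      then show ?thesis using less.hyps f' by blast
    qed (use cl(1) in simp)
    then show ?thesis unfolding dd using q cl(3) by blast
  qed
qed

lemma adjoin_subring: "subring (adjoin R S) (amb :: 'a::comm_ring_1 ring)"
proof -
  interpret ring "amb :: 'a ring" by rule
  show ?thesis unfolding adjoin_def by (rule generate_ring_is_subring) simp
qed

lemma adjoin_superset: "R \<subseteq> adjoin R S" "S \<subseteq> adjoin R S"
  unfolding adjoin_def by (auto intro: generate_ring.incl)

lemma adjoin_least:
  assumes "subring T (amb :: 'a::comm_ring_1 ring)" "R \<subseteq> T" "S \<subseteq> T"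
  shows "adjoin R S \<subseteq> T"
proof -
  interpret ring "amb :: 'a ring" by rule
  show ?thesis
    unfolding adjoin_def by (rule generate_ring_min_subring1[OF _ assms(1)]) (use assms in auto)
qed

lemma of_poly_simps [simp]:
  "of_poly 0 = 0" "of_poly 1 = 1"
  "of_poly (f + g) = of_poly f + of_poly g" "of_poly (f - g) = of_poly f - of_poly g"
  "of_poly (- f) = - of_poly f" "of_poly (f * g) = of_poly f * of_poly (g :: 'l::field poly)"
  by (simp_all add: Zero_fract_def One_fract_def)

lemma of_poly_power [simp]: "of_poly (f ^ n) = of_poly (f :: 'l::field poly) ^ n"
  by (induction n) simp_all

lemma of_poly_sum [simp]: "of_poly (sum f I) = (\<Sum>i\<in>I. of_poly (f i :: 'l::field poly))"
  by (induction I rule: infinite_finite_induct) simp_all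

lemma of_poly_eq_iff [simp]: "of_poly f = of_poly g \<longleftrightarrow> f = (g :: 'l::field poly)"
  by (simp add: eq_fract)

lemma of_poly_eq_0_iff [simp]: "of_poly f = 0 \<longleftrightarrow> f = (0 :: 'l::field poly)"
  using of_poly_eq_iff[of f 0] by simp

declare add_fract [simp del] diff_fract [simp del] minus_fract [simp del] mult_fract [simp del]
  divide_fract [simp del] inverse_fract [simp del]

lemma of_const_simps [simp]:
  "of_const (a + b) = of_const a + of_const (b :: 'l::field)" "of_const (a - b) = of_const a - of_const b"
  "of_const (- a) = - of_const a" "of_const (a * b) = of_const a * of_const b"
  "of_const (a ^ n) = of_const a ^ n"
proof -
  have "[:a + b:] = [:a:] + [:b:]" "[:a - b:] = [:a:] - [:b:]" "[:- a:] = - [:a:]" "[:a * b:] = [:a:] * [:b:]"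
    "[:a ^ n:] = [:a:] ^ n"
    by (simp_all add: poly_const_pow)
  then show "of_const (a + b) = of_const a + of_const b" "of_const (a - b) = of_const a - of_const b"
    "of_const (- a) = - of_const a" "of_const (a * b) = of_const a * of_const b"
    "of_const (a ^ n) = of_const a ^ n"
    by (simp_all only: of_poly_simps of_poly_power)
qed

lemma of_const_0_1 [simp]: "of_const (0 :: 'l::field) = 0" "of_const (1 :: 'l::field) = 1"
  using of_poly_simps(1,2) by (simp_all only: one_pCons pCons_0_0)

lemma of_const_inverse [simp]: "of_const (inverse c) = inverse (of_const (c :: 'l::field))"
proof (cases "c = 0")
  case False
  then have "of_const c * of_const (inverse c) = 1"
    by (metis of_const_simps(4) right_inverse of_const_0_1(2))
  then show ?thesis by (metis inverse_unique)
qed simp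

lemma of_const_divide [simp]: "of_const (a / b) = of_const a / of_const (b :: 'l::field)"
  unfolding divide_inverse of_const_simps of_const_inverse ..

section \<open>Substituting rational functions into polynomials with constant coefficients\<close>

definition evc :: "'l::field poly \<Rightarrow> 'l poly fract \<Rightarrow> 'l poly fract" where
  "evc f t = poly (map_poly of_const f) t"

lemma evc_pCons [simp]: "evc (pCons a f) t = of_const a + t * evc f t"
  by (simp add: evc_def map_poly_pCons)

lemma evc_0 [simp]: "evc 0 t = 0"
  by (simp add: evc_def)

lemma evc_1 [simp]: "evc 1 t = 1"
  by (metis evc_pCons evc_0 mult_zero_right add_0_right of_const_0_1(2) one_pCons)

lemma evc_add [simp]: "evc (f + g) t = evc f t + evc g t"
proof -
  have "map_poly of_const (f + g) = map_poly of_const f + map_poly of_const g"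
    by (rule poly_eqI) (simp add: coeff_map_poly)
  then show ?thesis by (simp add: evc_def)
qed

lemma evc_smult [simp]: "evc (smult c f) t = of_const c * evc f t"
  by (induction f) (simp_all add: algebra_simps)

lemma evc_diff [simp]: "evc (f - g) t = evc f t - evc g t"
  using evc_add[of "f - g" g t] by (simp add: eq_diff_eq)

lemma evc_mult [simp]: "evc (f * g) t = evc f t * evc g t"
  by (induction f) (simp_all add: algebra_simps)

lemma evc_power [simp]: "evc (f ^ n) t = evc f t ^ n"
  by (induction n) simp_all

lemma evc_sum [simp]: "evc (sum f I) t = (\<Sum>i\<in>I. evc (f i) t)"
  by (induction I rule: infinite_finite_induct) simp_all

lemma evc_prod [simp]: "evc (prod f I) t = (\<Prod>i\<in>I. evc (f i) t)"
  by (induction I rule: infinite_finite_induct) simp_all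

lemma evc_monom: "evc (Polynomial.monom c n) t = of_const c * t ^ n"
  by (simp add: evc_def map_poly_monom poly_monom)

lemma evc_altdef: "Polynomial.degree f \<le> n \<Longrightarrow> evc f t = (\<Sum>i\<le>n. of_const (poly.coeff f i) * t ^ i)"
proof -
  assume n: "Polynomial.degree f \<le> n"
  have "evc f t = evc (\<Sum>i\<le>n. Polynomial.monom (poly.coeff f i) i) t"
    using poly_as_sum_of_monoms'[OF n] by simp
  then show ?thesis by (simp add: evc_monom)
qed

lemma evc_of_poly: "evc f (of_poly q) = of_poly (f \<circ>\<^sub>p q)"
  by (induction f) (simp_all add: pcompose_pCons)

lemma evc_pcompose: "evc (f \<circ>\<^sub>p g) t = evc f (evc g t)"
  by (induction f) (simp_all add: pcompose_pCons)

text \<open>This is \<open>t ^ n * f (1 / t)\<close>, the reversal of \<open>f\<close> regarded as a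
  form of degree \<open>n\<close>; it translates between the coordinates \<open>y\<close> and
  \<open>1/y\<close>.\<close>

definition flip_poly :: "nat \<Rightarrow> 'l::field poly \<Rightarrow> 'l poly" where
  "flip_poly n f = (\<Sum>i\<le>n. Polynomial.monom (poly.coeff f i) (n - i))"

lemma evc_flip_poly:
  assumes "Polynomial.degree f \<le> n" "t \<noteq> 0"
  shows "evc f (inverse t) * t ^ n = evc (flip_poly n f) t"
proof -
  have "t ^ (n - i) = inverse t ^ i * t ^ n" if "i \<le> n" for i
    using that assms(2) by (simp add: power_diff field_simps)
  then show ?thesis
    unfolding evc_altdef[OF assms(1)] by (simp add: flip_poly_def evc_monom sum_distrib_right mult.assoc)
qed

lemma flip_poly_mem_polys_over:
  assumes "subring S amb" "f \<in> polys_over S"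
  shows "flip_poly n f \<in> polys_over S"
  unfolding flip_poly_def using assms(2)
  by (intro subring_amb_closed(8)[OF subring_polys_over[OF assms(1)]] monom_mem_polys_over[OF assms(1)])
    (simp add: polys_over_def)

lemma flip_poly_eq_0: "Polynomial.degree f \<le> n \<Longrightarrow> flip_poly n f = 0 \<Longrightarrow> f = 0"
proof -
  assume n: "Polynomial.degree f \<le> n" and 0: "flip_poly n f = 0"
  have "poly.coeff f j = 0" if "j \<le> n" for j
  proof -
    have "poly.coeff (flip_poly n f) (n - j) = (\<Sum>i\<le>n. if i = j then poly.coeff f i else 0)"
      unfolding flip_poly_def coeff_sum by (intro sum.cong) (use that in auto)
    then show ?thesis using 0 that by simp
  qed
  then show "f = 0" using n by (metis leading_coeff_0_iff)
qed

lemma adjoin_singleton_eq: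
  assumes S: "subring S (amb :: 'l::field ring)"
  shows "adjoin (of_const ` S) {t} = (\<lambda>f. evc f t) ` polys_over S"
proof
  note clp = subring_amb_closed[OF subring_polys_over[OF S]]
  show "adjoin (of_const ` S) {t} \<subseteq> (\<lambda>f. evc f t) ` polys_over S"
  proof (rule adjoin_least)
    show "subring ((\<lambda>f. evc f t) ` polys_over S) amb"
      unfolding subring_amb_iff
    proof (intro conjI ballI)
      show "1 \<in> (\<lambda>f. evc f t) ` polys_over S"
        using clp(2) by (intro image_eqI[of _ _ 1]) simp_all
      fix x y assume "x \<in> (\<lambda>f. evc f t) ` polys_over S" "y \<in> (\<lambda>f. evc f t) ` polys_over S"
      then obtain f g where fg: "f \<in> polys_over S" "g \<in> polys_over S" "x = evc f t" "y = evc g t" by blast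
      show "x - y \<in> (\<lambda>f. evc f t) ` polys_over S"
        using fg clp(4)[OF fg(1,2)] by (intro image_eqI[of _ _ "f - g"]) simp_all
      show "x * y \<in> (\<lambda>f. evc f t) ` polys_over S"
        using fg clp(6)[OF fg(1,2)] by (intro image_eqI[of _ _ "f * g"]) simp_all
    qed
    show "of_const ` S \<subseteq> (\<lambda>f. evc f t) ` polys_over S"
    proof clarify
      fix s assume "s \<in> S"
      then have "[:s:] \<in> polys_over S" using clp(1) by (simp add: pCons_mem_polys_over[OF S])
      moreover have "of_const s = evc [:s:] t" by simp
      ultimately show "of_const s \<in> (\<lambda>f. evc f t) ` polys_over S" by blast
    qed
    have "[:0, 1:] \<in> polys_over S" using clp(1) subring_amb_closed(1,2)[OF S] by (simp add: pCons_mem_polys_over[OF S])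
    moreover have "t = evc [:0, 1:] t" by simp
    ultimately show "{t} \<subseteq> (\<lambda>f. evc f t) ` polys_over S" by blast
  qed
  show "(\<lambda>f. evc f t) ` polys_over S \<subseteq> adjoin (of_const ` S) {t}"
  proof clarify
    fix f assume "f \<in> polys_over S"
    then have "of_const (poly.coeff f i) \<in> adjoin (of_const ` S) {t}" for i
      using adjoin_superset(1)[of "of_const ` S"] by (auto simp: polys_over_def)
    moreover have "t \<in> adjoin (of_const ` S) {t}" using adjoin_superset(2) by blast
    ultimately show "evc f t \<in> adjoin (of_const ` S) {t}"
      unfolding evc_altdef[OF order_refl]
      by (intro subring_amb_closed(8,6,7)[OF adjoin_subring])
  qed
qed

text \<open>\<open>R[t, 1/t]\<close> is the coordinate ring of the intersection of the two charts.\<close>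

lemma proj_line_chart_switch:
  assumes S: "subring S (amb :: 'l::field ring)" and t: "t \<noteq> 0"
    and P: "primeideal P (sub_ring (adjoin (of_const ` S) {inverse t}))"
    and mem: "t \<in> localization (adjoin (of_const ` S) {inverse t}) P"
  shows "\<exists>Q. primeideal Q (sub_ring (adjoin (of_const ` S) {t})) \<and>
    localization (adjoin (of_const ` S) {inverse t}) P = localization (adjoin (of_const ` S) {t}) Q"
proof -
  let ?B = "adjoin (of_const ` S) {t}" and ?B' = "adjoin (of_const ` S) {inverse t}"
  let ?C = "adjoin ?B' {t}" and ?\<O> = "localization ?B' P"
  have C: "subring ?C amb" by (rule adjoin_subring)
  note B' = adjoin_subring[of "of_const ` S" "{inverse t}"]
  note clC = subring_amb_closed[OF C]
  note clB = subring_amb_closed[OF adjoin_subring[of "of_const ` S" "{t}"]]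
  have C\<O>: "?C \<subseteq> ?\<O>"
    by (rule adjoin_least[OF subring_localization[OF B' P] subset_localization[OF B' P]]) (use mem in simp)
  have B'C: "?B' \<subseteq> ?C" by (rule adjoin_superset)
  have inv: "inverse t \<in> ?C" using adjoin_superset(2)[of "{inverse t}" "of_const ` S"] B'C by blast
  have tB: "t \<in> ?B" using adjoin_superset(2)[of "{t}" "of_const ` S"] by simp
  have SB: "of_const ` S \<subseteq> ?B" by (rule adjoin_superset)
  have BC: "?B \<subseteq> ?C"
    by (rule adjoin_least[OF C subset_trans[OF adjoin_superset(1) B'C] adjoin_superset(2)])
  \<comment> \<open>The elements that some power of \<open>t\<close> carries into \<open>?B\<close>.
    They form a ring containing \<open>1/t\<close>, hence all of \<open>?C\<close>, so that powers
    of \<open>t\<close> suffice as denominators.\<close>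
  define T where "T = {c. \<exists>n. c * t ^ n \<in> ?B}"
  have T: "subring T amb"
    unfolding subring_amb_iff
  proof (intro conjI ballI)
    show "1 \<in> T" unfolding T_def using clB(2) by (intro CollectI exI[of _ 0]) simp
    fix x y assume "x \<in> T" "y \<in> T"
    then obtain n k where nk: "x * t ^ n \<in> ?B" "y * t ^ k \<in> ?B" unfolding T_def by blast
    have "(x - y) * t ^ (n + k) = (x * t ^ n) * t ^ k - (y * t ^ k) * t ^ n"
      by (simp add: power_add algebra_simps)
    also have "\<dots> \<in> ?B" by (intro clB(4) clB(6)[OF nk(1)] clB(6)[OF nk(2)] clB(7) tB)
    finally show "x - y \<in> T" unfolding T_def by blast
    have "(x * y) * t ^ (n + k) = (x * t ^ n) * (y * t ^ k)"
      by (simp add: power_add algebra_simps)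
    also have "\<dots> \<in> ?B" by (rule clB(6)[OF nk])
    finally show "x * y \<in> T" unfolding T_def by blast
  qed
  have inT: "b \<in> T" if "b \<in> ?B" for b
    unfolding T_def using that by (intro CollectI exI[of _ 0]) simp
  have "inverse t \<in> T"
    unfolding T_def using t clB(2) by (intro CollectI exI[of _ 1]) simp
  then have "?B' \<subseteq> T"
    by (intro adjoin_least[OF T]) (use inT SB in auto)
  then have C_T: "?C \<subseteq> T"
    by (rule adjoin_least[OF T]) (use inT tB in simp)
  have frac: "\<exists>b\<in>?B. \<exists>s\<in>?B - {0}. inverse s \<in> ?C \<and> c = b / s" if c: "c \<in> ?C" for c
  proof -
    obtain n where n: "c * t ^ n \<in> ?B" using subsetD[OF C_T c] unfolding T_def by blast
    have "inverse (t ^ n) \<in> ?C" using clC(7)[OF inv] by (simp add: power_inverse)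
    moreover have "t ^ n \<in> ?B - {0}" using clB(7)[OF tB] t by simp
    moreover have "c = c * t ^ n / t ^ n" using t by simp
    ultimately show ?thesis using n by blast
  qed
  \<comment> \<open>The point is first moved up from \<open>?B'\<close> to the ring
    \<open>?C\<close> of the overlap, and then down to \<open>?B\<close>, of which \<open>?C\<close>
    is a ring of fractions.\<close>
  note Q = localization_center_intermediate[OF B' P C B'C C\<O>]
  from localization_of_fractions[OF adjoin_subring C Q(1) BC frac] show ?thesis
    unfolding Q(2) by blast
qed

text \<open>The coordinate of a chart is the function whose regularity detects the chart. Both cases
  are the same change of chart, once with \<open>t\<close> and once with
  \<open>inverse t\<close>.\<close>

lemma glued_charts_proj_line:
  assumes S: "subring S (amb :: 'l::field ring)" and t: "t \<noteq> 0"
  shows "glued_charts {adjoin (of_const ` S) {t}, adjoin (of_const ` S) {inverse t}}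
    (\<lambda>B. if B = adjoin (of_const ` S) {t} then {t} else {inverse t})"
proof (rule glued_charts.intro)
  fix B assume B: "B \<in> {adjoin (of_const ` S) {t}, adjoin (of_const ` S) {inverse t}}"
  then show "subring B amb" using adjoin_subring by auto
next
  fix B assume B: "B \<in> {adjoin (of_const ` S) {t}, adjoin (of_const ` S) {inverse t}}"
  show "finite (if B = adjoin (of_const ` S) {t} then {t} else {inverse t}) \<and>
      (if B = adjoin (of_const ` S) {t} then {t} else {inverse t}) \<subseteq> B"
    using B adjoin_superset(2)[of "{t}" "of_const ` S"] adjoin_superset(2)[of "{inverse t}" "of_const ` S"] by auto
next
  fix B assume B: "B \<in> {adjoin (of_const ` S) {t}, adjoin (of_const ` S) {inverse t}}"
  fix B' P assume B': "B' \<in> {adjoin (of_const ` S) {t}, adjoin (of_const ` S) {inverse t}}"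
    and P: "primeideal P (sub_ring B')"
    and mem: "(if B = adjoin (of_const ` S) {t} then {t} else {inverse t}) \<subseteq> localization B' P"
  show "\<exists>Q. primeideal Q (sub_ring B) \<and> localization B' P = localization B Q"
  proof (cases "B = B'")
    case True
    then show ?thesis using P by blast
  next
    case False
    then consider "B = adjoin (of_const ` S) {t}" "B' = adjoin (of_const ` S) {inverse t}"
      | "B = adjoin (of_const ` S) {inverse t}" "B' = adjoin (of_const ` S) {t}" "B \<noteq> adjoin (of_const ` S) {t}"
      using B B' by auto
    then show ?thesis
    proof cases
      case 1
      then show ?thesis using proj_line_chart_switch[OF S t, of P] P mem by simp
    next
      case 2
      then show ?thesis using proj_line_chart_switch[OF S, of "inverse t" P] t P mem by simp
    qed
  qed
qed

section \<open>Automorphisms of the rational function field induced from its constants\<close>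

lemma map_poly_hom:
  assumes "\<And>a b. h (a + b) = h a + h b" "\<And>a b. h (a * b) = h a * h b" "h 0 = 0" "h 1 = (1 :: 'l::field)"
  shows "map_poly h (f + g) = map_poly h f + map_poly h (g :: 'l poly)"
    "map_poly h (f * g) = map_poly h f * map_poly h g"
proof -
  show "map_poly h (f + g) = map_poly h f + map_poly h g"
    by (rule poly_eqI) (simp add: coeff_map_poly assms)
  have sum: "h (sum k I) = (\<Sum>i\<in>I. h (k i))" for k :: "nat \<Rightarrow> 'l" and I
    by (induction I rule: infinite_finite_induct) (simp_all add: assms)
  show "map_poly h (f * g) = map_poly h f * map_poly h g"
    by (rule poly_eqI) (simp add: coeff_map_poly assms coeff_mult sum)
qed

context
  fixes \<tau> :: "'l::field \<Rightarrow> 'l" and K :: "'l set"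
  assumes \<tau>: "\<tau> \<in> Gal K"
begin

lemma tau_hom: "\<tau> (a + b) = \<tau> a + \<tau> b" "\<tau> (a * b) = \<tau> a * \<tau> b" "\<tau> 1 = 1" "\<tau> 0 = 0" "\<tau> a = 0 \<longleftrightarrow> a = 0"
proof -
  show *: "\<tau> (a + b) = \<tau> a + \<tau> b" "\<tau> (a * b) = \<tau> a * \<tau> b" "\<tau> 1 = 1" for a b
    using \<tau> by (auto simp: mem_Gal_iff)
  show 0: "\<tau> 0 = 0" using *(1)[of 0 0] by (metis add.right_neutral add_left_cancel)
  have "inj \<tau>" using \<tau> by (simp add: mem_Gal_iff bij_is_inj)
  then show "\<tau> a = 0 \<longleftrightarrow> a = 0" using 0 by (metis injD)
qed

lemmas map_poly_tau = map_poly_hom[OF tau_hom(1,2,4,3)]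

lemma map_poly_tau_eq_0_iff: "map_poly \<tau> f = 0 \<longleftrightarrow> f = 0"
  by (simp add: poly_eq_iff coeff_map_poly tau_hom)

text \<open>The definite description is justified here: a cross-multiplied equality of fractions is
  preserved by the automorphism, and nonzero denominators stay nonzero by injectivity.\<close>

lemma extend_aut_Fract:
  assumes "b \<noteq> 0"
  shows "extend_aut \<tau> (Fraction_Field.Fract a b) = Fraction_Field.Fract (map_poly \<tau> a) (map_poly \<tau> b)"
  unfolding extend_aut_def
proof (rule the_equality)
  show "\<exists>a' b'. b' \<noteq> 0 \<and> Fraction_Field.Fract a b = Fraction_Field.Fract a' b' \<and>
      Fraction_Field.Fract (map_poly \<tau> a) (map_poly \<tau> b) = Fraction_Field.Fract (map_poly \<tau> a') (map_poly \<tau> b')"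
    using assms by blast
  fix g assume "\<exists>a' b'. b' \<noteq> 0 \<and> Fraction_Field.Fract a b = Fraction_Field.Fract a' b' \<and>
      g = Fraction_Field.Fract (map_poly \<tau> a') (map_poly \<tau> b')"
  then obtain a' b' where *: "b' \<noteq> 0" "Fraction_Field.Fract a b = Fraction_Field.Fract a' b'"
    "g = Fraction_Field.Fract (map_poly \<tau> a') (map_poly \<tau> b')" by blast
  then have "a * b' = a' * b" using assms by (simp add: eq_fract)
  then have "map_poly \<tau> a * map_poly \<tau> b' = map_poly \<tau> a' * map_poly \<tau> b"
    by (metis map_poly_tau(2))
  then show "g = Fraction_Field.Fract (map_poly \<tau> a) (map_poly \<tau> b)"
    using * assms by (simp add: eq_fract map_poly_tau_eq_0_iff)
qed

lemma extend_aut_of_poly: "extend_aut \<tau> (of_poly f) = of_poly (map_poly \<tau> f)"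
  using extend_aut_Fract[of 1 f] tau_hom(3) by simp

lemma extend_aut_hom:
  "extend_aut \<tau> (u + v) = extend_aut \<tau> u + extend_aut \<tau> v"
  "extend_aut \<tau> (u * v) = extend_aut \<tau> u * extend_aut \<tau> v"
  "extend_aut \<tau> 1 = 1"
proof -
  obtain a b where u: "u = Fraction_Field.Fract a b" "b \<noteq> 0" by (cases u) auto
  obtain c d where v: "v = Fraction_Field.Fract c d" "d \<noteq> 0" by (cases v) auto
  show "extend_aut \<tau> (u + v) = extend_aut \<tau> u + extend_aut \<tau> v"
    using u v by (simp add: extend_aut_Fract map_poly_tau map_poly_tau_eq_0_iff add_fract)
  show "extend_aut \<tau> (u * v) = extend_aut \<tau> u * extend_aut \<tau> v"
    using u v by (simp add: extend_aut_Fract map_poly_tau mult_fract)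
  show "extend_aut \<tau> 1 = 1" using extend_aut_of_poly[of 1] tau_hom(3) by simp
qed

end

lemma finite_field_auts_extend_aut:
  assumes "finite_field_auts (Gal (K :: 'l::field set))"
  shows "finite_field_auts (extend_aut ` Gal K)"
proof -
  interpret G: finite_field_auts "Gal K" by (rule assms)
  have comp: "extend_aut g (extend_aut h u) = extend_aut (g \<circ> h) u" if g: "g \<in> Gal K" and h: "h \<in> Gal K" for g h u
  proof -
    obtain a b where u: "u = Fraction_Field.Fract a b" "b \<noteq> 0" by (cases u) auto
    show ?thesis
      unfolding u(1) extend_aut_Fract[OF h u(2)] extend_aut_Fract[OF G.comp_mem[OF g h] u(2)]
      using extend_aut_Fract[OF g, of "map_poly h b" "map_poly h a"] u(2)
      by (simp add: map_poly_tau_eq_0_iff[OF h] map_poly_map_poly[of g h, OF tau_hom(4)[OF g] tau_hom(4)[OF h]])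
  qed
  have id: "extend_aut (id :: 'l \<Rightarrow> 'l) = id"
  proof (rule ext)
    fix u :: "'l poly fract"
    obtain a b where u: "u = Fraction_Field.Fract a b" "b \<noteq> 0" by (cases u) auto
    then show "extend_aut id u = id u" using extend_aut_Fract[OF G.id_mem] by simp
  qed
  show ?thesis
  proof
    show "finite (extend_aut ` Gal K)" using G.finite_G by simp
    show "id \<in> extend_aut ` Gal K" using id G.id_mem by (metis imageI)
  next
    fix g h assume "g \<in> extend_aut ` Gal K" "h \<in> extend_aut ` Gal K"
    then obtain g' h' where gh: "g' \<in> Gal K" "h' \<in> Gal K" "g = extend_aut g'" "h = extend_aut h'" by blast
    then have "g \<circ> h = extend_aut (g' \<circ> h')" using comp by (simp add: fun_eq_iff)
    then show "g \<circ> h \<in> extend_aut ` Gal K" using G.comp_mem gh by blast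
  next
    fix g assume "g \<in> extend_aut ` Gal K"
    then obtain g' where g: "g' \<in> Gal K" "g = extend_aut g'" by blast
    obtain h' where h: "h' \<in> Gal K" "h' \<circ> g' = id" "g' \<circ> h' = id" using G.inv_mem[OF g(1)] by blast
    have "extend_aut h' \<circ> g = id" "g \<circ> extend_aut h' = id"
      unfolding g(2) using comp[OF h(1) g(1)] comp[OF g(1) h(1)] h id by (simp_all add: fun_eq_iff)
    then show "\<exists>h\<in>extend_aut ` Gal K. h \<circ> g = id \<and> g \<circ> h = id" using h(1) by blast
  qed (use extend_aut_hom in blast)+
qed

section \<open>The ring of invariants of the affine chart\<close>

locale quotient_model = galois_totally_ramified p K vK vL \<pi> \<phi>
  for p K vK vL and \<pi> :: "'l::field" and \<phi> +
  fixes \<sigma> :: "'l \<Rightarrow> 'l" and m :: nat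
  assumes sigma: "\<sigma> \<in> Gal K" and generator: "Gal K = {\<sigma> ^^ j | j. True}"
    and m_eq: "int m = vL (\<sigma> \<pi> - \<pi>)"
begin

abbreviation "\<pi>K \<equiv> poly.coeff \<phi> 0"
abbreviation "kR \<equiv> of_const ` R"
abbreviation "kRL \<equiv> of_const ` RL"

definition y :: "'l poly fract" where "y = (var_x - of_const \<pi>) / of_const \<pi> ^ m"
definition N :: "'l poly fract" where "N = of_poly \<phi> / of_const \<pi>K ^ m"
text \<open>The value of \<open>y\<close> at \<open>x = g \<pi>\<close>, so these are the roots of
  \<open>N\<close> in the coordinate \<open>y\<close>.\<close>

definition \<delta> :: "('l \<Rightarrow> 'l) \<Rightarrow> 'l" where "\<delta> g = (g \<pi> - \<pi>) / \<pi> ^ m"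
text \<open>\<open>x\<^sub>y\<close> expresses \<open>x\<close> in terms of \<open>y\<close>, and \<open>Y\<^sub>0\<close> expresses \<open>y\<close> in terms of \<open>x\<close>.\<close>

definition x\<^sub>y :: "'l poly" where "x\<^sub>y = [:\<pi>, \<pi> ^ m:]"
definition Y\<^sub>0 :: "'l poly" where "Y\<^sub>0 = [:- \<pi> / \<pi> ^ m, 1 / \<pi> ^ m:]"
text \<open>\<open>\<Phi>\<close> and \<open>\<nu>\<close> are the same function \<open>N\<close>,
  written as a polynomial in \<open>x\<close> and in \<open>y\<close> respectively.\<close>

definition \<Phi> :: "'l poly" where "\<Phi> = smult (inverse (\<pi>K ^ m)) \<phi>"
definition \<nu> :: "'l poly" where "\<nu> = \<Phi> \<circ>\<^sub>p x\<^sub>y"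
text \<open>The leading coefficient of \<open>N\<close> in the coordinate \<open>y\<close>: each of
  the \<open>p\<close> linear factors of \<phi> contributes \<open>\<pi> ^ m\<close>. Numerator and
  denominator both have valuation \<open>m * p\<close>.\<close>

definition c :: 'l where "c = \<pi> ^ (m * p) / \<pi>K ^ m"
definition G :: "('l poly fract \<Rightarrow> 'l poly fract) set" where "G = extend_aut ` Gal K"
text \<open>The rational functions that are regular on \<open>Y\<close> away from the zeroes of \<open>N\<close>; the bound on
  the degree expresses regularity at \<open>y = \<infinity>\<close>.\<close>

definition C :: "'l poly fract set" where
  "C = {evc f y / N ^ n | f n. f \<in> polys_over RL \<and> Polynomial.degree f \<le> p * n}"
definition xs :: "nat \<Rightarrow> 'l poly fract" where "xs i = of_const \<pi>K ^ m * var_x ^ i / of_poly \<phi>"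
definition A :: "'l poly fract set" where "A = adjoin kR (xs ` {..<p})"

lemmas RL_closed = subring_amb_closed[OF subring_RL]
lemmas pRL_closed = subring_amb_closed[OF subring_polys_over[OF subring_RL]]

lemma piK_nonzero: "\<pi>K \<noteq> 0"
  using v_coeff_0 by simp

lemma unit_RL: "a \<noteq> 0 \<Longrightarrow> vL a = 0 \<Longrightarrow> a \<in> RL \<and> inverse a \<in> RL"
  by (simp add: RL_eq Vge_def v_inverse)

lemma pi_RL: "\<pi> \<in> RL"
  by (simp add: RL_eq Vge_def v_pi)

lemma delta_RL: "g \<in> Gal K \<Longrightarrow> \<delta> g \<in> RL"
  using conj_pi_diff[OF sigma generator m_eq, of g] pi_nonzero
  by (cases "g \<pi> - \<pi> = 0") (auto simp: \<delta>_def RL_eq Vge_def v_divide v_power v_pi)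

lemma delta_id: "\<delta> id = 0"
  by (simp add: \<delta>_def)

lemma c_unit: "c \<noteq> 0" "c \<in> RL" "inverse c \<in> RL"
proof -
  show nz: "c \<noteq> 0" using pi_nonzero piK_nonzero by (simp add: c_def)
  have "vL c = 0"
    using pi_nonzero piK_nonzero v_coeff_0 by (simp add: c_def v_divide v_power v_pi)
  then show "c \<in> RL" "inverse c \<in> RL" using unit_RL nz by auto
qed

lemma Y0_ell: "Y\<^sub>0 \<circ>\<^sub>p x\<^sub>y = [:0, 1:]" "x\<^sub>y \<circ>\<^sub>p Y\<^sub>0 = [:0, 1:]"
  using pi_nonzero by (simp_all add: Y\<^sub>0_def x\<^sub>y_def pcompose_pCons field_simps)

lemma y_eq: "y = of_poly Y\<^sub>0"
proof -
  have "Y\<^sub>0 = smult (inverse (\<pi> ^ m)) ([:0, 1:] - [:\<pi>:])"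
    by (simp add: Y\<^sub>0_def divide_inverse)
  then have "Y\<^sub>0 = [:inverse (\<pi> ^ m):] * ([:0, 1:] - [:\<pi>:])" by simp
  then show ?thesis
    by (simp only: of_poly_simps of_const_inverse of_const_simps) (simp add: y_def field_simps)
qed

lemma degree_Y0: "Polynomial.degree Y\<^sub>0 = 1" and degree_ell: "Polynomial.degree x\<^sub>y = 1"
  using pi_nonzero by (simp_all add: Y\<^sub>0_def x\<^sub>y_def)

lemma evc_y_eq_0_iff: "evc f y = 0 \<longleftrightarrow> f = 0"
  unfolding y_eq evc_of_poly of_poly_eq_0_iff using degree_Y0 by (simp add: pcompose_eq_0_iff)

lemma evc_y_inject: "evc f y = evc g y \<longleftrightarrow> f = g"
  using evc_y_eq_0_iff[of "f - g"] by simp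

lemma y_nonzero: "y \<noteq> 0"
  using evc_y_eq_0_iff[of "[:0, 1:]"] by simp

lemma evc_w_eq_0_iff: "evc f (inverse y) = 0 \<longleftrightarrow> f = 0"
proof
  assume "evc f (inverse y) = 0"
  then have "evc (flip_poly (Polynomial.degree f) f) y = 0"
    using evc_flip_poly[of f "Polynomial.degree f" y] y_nonzero by simp
  then show "f = 0" using flip_poly_eq_0[of f "Polynomial.degree f"] by (simp add: evc_y_eq_0_iff)
qed simp

lemma evc_w_inject: "evc f (inverse y) = evc g (inverse y) \<longleftrightarrow> f = g"
  using evc_w_eq_0_iff[of "f - g"] by simp

lemma of_poly_eq_evc: "of_poly h = evc (h \<circ>\<^sub>p x\<^sub>y) y"
  unfolding y_eq evc_of_poly by (simp add: pcompose_assoc[symmetric] Y0_ell)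

lemma ell_RL: "x\<^sub>y \<in> polys_over RL"
  unfolding x\<^sub>y_def using pi_RL RL_closed(7)[OF pi_RL] pRL_closed(1) by (simp add: pCons_mem_polys_over[OF subring_RL])

lemma N_eq: "N = of_poly \<Phi>"
proof -
  have "\<Phi> = [:inverse (\<pi>K ^ m):] * \<phi>" by (simp add: \<Phi>_def)
  then show ?thesis
    by (simp only: of_poly_simps of_const_inverse of_const_simps) (simp add: N_def field_simps)
qed

lemma N_eq_evc: "N = evc \<nu> y"
  unfolding N_eq of_poly_eq_evc \<nu>_def ..

text \<open>The substitution \<open>x = \<pi> + \<pi> ^ m * y\<close> turns the factor
  \<open>x - g \<pi>\<close> into \<open>\<pi> ^ m * (y - \<delta> g)\<close>.\<close>

lemma nu_eq: "\<nu> = smult c (\<Prod>g\<in>Gal K. [:- \<delta> g, 1:])"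
proof -
  have "[:- g \<pi>, 1:] \<circ>\<^sub>p x\<^sub>y = smult (\<pi> ^ m) [:- \<delta> g, 1:]" for g
    using pi_nonzero by (simp add: x\<^sub>y_def \<delta>_def pcompose_pCons field_simps)
  then have "\<phi> \<circ>\<^sub>p x\<^sub>y = (\<Prod>g\<in>Gal K. smult (\<pi> ^ m) [:- \<delta> g, 1:])"
    unfolding phi_eq_prod pcompose_prod by (simp only:)
  also have "\<dots> = smult (\<pi> ^ (m * p)) (\<Prod>g\<in>Gal K. [:- \<delta> g, 1:])"
    by (simp only: prod_smult prod_constant card_Gal power_mult)
  finally have "\<phi> \<circ>\<^sub>p x\<^sub>y = smult (\<pi> ^ (m * p)) (\<Prod>g\<in>Gal K. [:- \<delta> g, 1:])" .
  then show ?thesis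
    by (simp add: \<nu>_def \<Phi>_def pcompose_smult c_def field_simps)
qed

lemma degree_Phi: "Polynomial.degree \<Phi> = p"
  using degree_phi piK_nonzero by (simp add: \<Phi>_def)

lemma nu: "\<nu> \<in> polys_over RL" "Polynomial.degree \<nu> = p" "lead_coeff \<nu> = c" "\<nu> \<noteq> 0"
proof -
  have "[:- \<delta> g, 1:] \<in> polys_over RL" if "g \<in> Gal K" for g
    using delta_RL[OF that] RL_closed(2,5) pRL_closed(1) by (simp add: pCons_mem_polys_over[OF subring_RL])
  then show "\<nu> \<in> polys_over RL"
    unfolding nu_eq using c_unit(2) by (intro smult_mem_polys_over[OF subring_RL] pRL_closed(9))
  show "Polynomial.degree \<nu> = p" unfolding \<nu>_def by (simp add: degree_pcompose degree_Phi degree_ell)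
  show lc: "lead_coeff \<nu> = c" unfolding nu_eq by (simp add: lead_coeff_prod)
  then show "\<nu> \<noteq> 0" using c_unit(1) by auto
qed

lemma N_nonzero: "N \<noteq> 0"
  using nu(4) by (simp add: N_eq_evc evc_y_eq_0_iff)

lemma N_eq_prod: "N = of_const c * (\<Prod>g\<in>Gal K. y - of_const (\<delta> g))"
  unfolding N_eq_evc nu_eq by simp

lemma finite_field_auts_G: "finite_field_auts G"
  unfolding G_def by (rule finite_field_auts_extend_aut) (rule gal.finite_field_auts_axioms)

sublocale act: finite_field_auts G
  by (rule finite_field_auts_G)

lemma act_const: "g \<in> Gal K \<Longrightarrow> extend_aut g (of_const a) = of_const (g a)"
  by (simp add: extend_aut_of_poly map_poly_pCons Gal_hom)

lemma act_x: "g \<in> Gal K \<Longrightarrow> extend_aut g var_x = var_x"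
  by (simp add: extend_aut_of_poly map_poly_pCons Gal_hom)

lemma act_G: "g \<in> Gal K \<Longrightarrow> extend_aut g \<in> G"
  by (simp add: G_def)

text \<open>Acting on the numerator moves its zero from \<pi> to \<open>g \<pi>\<close>, and acting
  on the denominator contributes the unit \<open>(\<pi> / g \<pi>) ^ m\<close>. The action on
  \<open>y\<close> is therefore affine with integral coefficients.\<close>

lemma act_y:
  assumes "g \<in> Gal K"
  shows "extend_aut g y = of_const ((\<pi> / g \<pi>) ^ m) * (y - of_const (\<delta> g))"
proof -
  have nz: "of_const \<pi> \<noteq> 0" "of_const (g \<pi>) \<noteq> 0"
    using pi_nonzero gal.hom_eq_zero_iff[OF assms] by simp_all
  have "extend_aut g y = (var_x - of_const (g \<pi>)) / of_const (g \<pi>) ^ m"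
    unfolding y_def by (simp add: act.hom_divide act.hom_diff act.hom_power act_G[OF assms] act_const[OF assms] act_x[OF assms])
  also have "\<dots> = of_const ((\<pi> / g \<pi>) ^ m) * (y - of_const (\<delta> g))"
    unfolding y_def \<delta>_def of_const_simps of_const_divide using nz
    by (simp add: power_divide diff_divide_distrib[symmetric])
  finally show ?thesis .
qed

lemma conj_ratio_RL: "g \<in> Gal K \<Longrightarrow> (\<pi> / g \<pi>) ^ m \<in> RL" "g \<in> Gal K \<Longrightarrow> g \<pi> \<noteq> 0"
proof -
  assume g: "g \<in> Gal K"
  show nz: "g \<pi> \<noteq> 0" using gal.hom_eq_zero_iff[OF g] pi_nonzero by simp
  then have "\<pi> / g \<pi> \<in> RL" using v_conj_pi[OF g] pi_nonzero v_pi by (simp add: RL_eq Vge_def v_divide)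
  then show "(\<pi> / g \<pi>) ^ m \<in> RL" by (rule RL_closed(7))
qed

lemma act_evc: "g \<in> Gal K \<Longrightarrow> extend_aut g (evc f t) = evc (map_poly g f) (extend_aut g t)"
proof (induction f)
  case 0
  then show ?case using act.hom_zero[OF act_G] by simp
next
  case (pCons a f)
  note g = pCons.prems
  show ?case
    using pCons by (simp add: act.hom_add[OF act_G[OF g]] act.hom_mult[OF act_G[OF g]] act_const[OF g]
      map_poly_pCons Gal_hom(4)[OF g])
qed

text \<open>The action replaces \<open>y\<close> by an affine expression and conjugates
  coefficients. The bound on the degree is recorded because membership in \<open>C\<close> depends
  on it.\<close>

lemma act_evc_y:
  assumes g: "g \<in> Gal K" and f: "f \<in> polys_over RL"
  shows "\<exists>f'\<in>polys_over RL. Polynomial.degree f' \<le> Polynomial.degree f \<and> extend_aut g (evc f y) = evc f' y"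
proof -
  define a where "a = (\<pi> / g \<pi>) ^ m"
  define q where "q = [:- a * \<delta> g, a:]"
  have a: "a \<in> RL" unfolding a_def by (rule conj_ratio_RL(1)[OF g])
  have q: "q \<in> polys_over RL"
    unfolding q_def using a delta_RL[OF g] RL_closed(5,6) pRL_closed(1)
    by (simp add: pCons_mem_polys_over[OF subring_RL])
  have "evc q y = extend_aut g y"
    unfolding act_y[OF g] q_def a_def[symmetric] by (simp add: algebra_simps)
  then have "extend_aut g (evc f y) = evc (map_poly g f \<circ>\<^sub>p q) y"
    unfolding act_evc[OF g] evc_pcompose by simp
  moreover have "map_poly g f \<in> polys_over RL"
    using f conj_RL[OF g] by (simp add: polys_over_def coeff_map_poly Gal_hom(4)[OF g])
  then have "map_poly g f \<circ>\<^sub>p q \<in> polys_over RL" using pcompose_mem_polys_over[OF subring_RL _ q] by blast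
  moreover have "Polynomial.degree (map_poly g f \<circ>\<^sub>p q) \<le> Polynomial.degree f"
  proof -
    have "Polynomial.degree (map_poly g f \<circ>\<^sub>p q) \<le> Polynomial.degree (map_poly g f) * Polynomial.degree q"
      by (rule degree_pcompose_le)
    also have "\<dots> \<le> Polynomial.degree f * 1"
      by (intro mult_mono map_poly_degree_leq) (auto simp: q_def)
    finally show ?thesis by simp
  qed
  ultimately show ?thesis by blast
qed

lemma act_invariant_of_poly_iff: "(\<forall>g\<in>G. g (of_poly h) = of_poly h) \<longleftrightarrow> h \<in> polys_over K"
proof -
  have "(\<forall>g\<in>G. g (of_poly h) = of_poly h) \<longleftrightarrow> (\<forall>g\<in>Gal K. map_poly g h = h)"
    unfolding G_def by (simp add: extend_aut_of_poly)
  also have "\<dots> \<longleftrightarrow> (\<forall>g\<in>Gal K. \<forall>i. g (poly.coeff h i) = poly.coeff h i)"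
    by (intro ball_cong refl) (simp add: poly_eq_iff coeff_map_poly Gal_hom(4))
  also have "\<dots> \<longleftrightarrow> h \<in> polys_over K"
    unfolding polys_over_def mem_Collect_eq fixed_iff[symmetric] by blast
  finally show ?thesis .
qed

lemma phi_over_K: "\<phi> \<in> polys_over K"
  using phi(2) by (simp add: polys_over_def)

lemma Phi_over_K: "\<Phi> \<in> polys_over K"
  unfolding \<Phi>_def using K_closed(7) phi(2)
  by (intro smult_mem_polys_over[OF subfield_amb_closed(1)[OF K_subfield]] phi_over_K subfield_amb_closed(2)[OF K_subfield]) auto

lemma N_invariant: "g \<in> G \<Longrightarrow> g N = N"
  unfolding N_eq using act_invariant_of_poly_iff Phi_over_K by blast

lemma C_mem: "f \<in> polys_over RL \<Longrightarrow> Polynomial.degree f \<le> p * n \<Longrightarrow> evc f y / N ^ n \<in> C"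
  unfolding C_def by blast

lemma subring_C: "subring C amb"
  unfolding subring_amb_iff
proof (intro conjI ballI)
  have "evc 1 y / N ^ 0 \<in> C" by (rule C_mem) (use pRL_closed(2) in simp_all)
  then show "1 \<in> C" by simp
  fix a b assume "a \<in> C" "b \<in> C"
  then obtain f n g k where f: "f \<in> polys_over RL" "Polynomial.degree f \<le> p * n" "a = evc f y / N ^ n"
    and g: "g \<in> polys_over RL" "Polynomial.degree g \<le> p * k" "b = evc g y / N ^ k"
    unfolding C_def by blast
  have dnu: "Polynomial.degree (\<nu> ^ j) \<le> p * j" for j
    using degree_power_le[of \<nu> j] nu(2) by simp
  have "a - b = evc (f * \<nu> ^ k - g * \<nu> ^ n) y / N ^ (n + k)"
    using N_nonzero unfolding f(3) g(3) by (simp add: N_eq_evc[symmetric] power_add field_simps)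
  also have "\<dots> \<in> C"
  proof (rule C_mem)
    show "f * \<nu> ^ k - g * \<nu> ^ n \<in> polys_over RL"
      by (intro pRL_closed(4) pRL_closed(6) pRL_closed(7) f g nu)
    have "Polynomial.degree (f * \<nu> ^ k) \<le> p * (n + k)" "Polynomial.degree (g * \<nu> ^ n) \<le> p * (n + k)"
      using degree_mult_le[of f "\<nu> ^ k"] degree_mult_le[of g "\<nu> ^ n"] dnu[of k] dnu[of n] f(2) g(2)
      by (auto simp: algebra_simps)
    then show "Polynomial.degree (f * \<nu> ^ k - g * \<nu> ^ n) \<le> p * (n + k)" by (rule degree_diff_le)
  qed
  finally show "a - b \<in> C" .
  have "a * b = evc (f * g) y / N ^ (n + k)"
    unfolding f(3) g(3) by (simp add: power_add)
  also have "\<dots> \<in> C"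
  proof (rule C_mem)
    show "f * g \<in> polys_over RL" by (rule pRL_closed(6)[OF f(1) g(1)])
    show "Polynomial.degree (f * g) \<le> p * (n + k)"
      using degree_mult_le[of f g] f(2) g(2) by (simp add: algebra_simps)
  qed
  finally show "a * b \<in> C" .
qed

lemma stable_C:
  assumes "g \<in> G" "a \<in> C"
  shows "g a \<in> C"
proof -
  obtain h where h: "h \<in> Gal K" "g = extend_aut h" using assms(1) unfolding G_def by blast
  obtain f n where f: "f \<in> polys_over RL" "Polynomial.degree f \<le> p * n" "a = evc f y / N ^ n"
    using assms(2) unfolding C_def by blast
  obtain f' where f': "f' \<in> polys_over RL" "Polynomial.degree f' \<le> Polynomial.degree f" "g (evc f y) = evc f' y"
    using act_evc_y[OF h(1) f(1)] h(2) by blast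
  have "g a = evc f' y / N ^ n"
    unfolding f(3) using f'(3) N_invariant[OF assms(1)] by (simp add: act.hom_divide[OF assms(1)] act.hom_power[OF assms(1)])
  also have "\<dots> \<in> C" using f f' by (intro C_mem) auto
  finally show ?thesis .
qed

lemma xs_eq: "xs i = var_x ^ i / N"
  using piK_nonzero by (simp add: xs_def N_def)

lemma xs_0: "xs 0 = inverse N"
  by (simp add: xs_eq inverse_eq_divide)

lemma subring_A: "subring A amb"
  unfolding A_def by (rule adjoin_subring)

lemmas A_closed = subring_amb_closed[OF subring_A]

lemma kR_subset_A: "r \<in> R \<Longrightarrow> of_const r \<in> A"
  unfolding A_def by (rule subsetD[OF adjoin_superset(1)]) (rule imageI)

lemma xs_mem_A: "i < p \<Longrightarrow> xs i \<in> A"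
  unfolding A_def by (rule subsetD[OF adjoin_superset(2)]) (simp add: imageI)

lemma low_degree_mem_A:
  assumes r: "r \<in> polys_over K" "r \<circ>\<^sub>p x\<^sub>y \<in> polys_over RL" "Polynomial.degree r < p"
  shows "of_poly r / N \<in> A"
proof -
  have rs: "r = (\<Sum>i<p. Polynomial.monom (poly.coeff r i) i)"
    using poly_as_sum_of_monoms'[of r "p - 1"] r(3) by (cases p) (simp_all add: lessThan_Suc_atMost)
  have "poly.coeff (r \<circ>\<^sub>p x\<^sub>y) 0 = (\<Sum>i<p. poly.coeff r i * \<pi> ^ i)"
    by (subst rs) (simp add: pcompose_coeff_0 x\<^sub>y_def poly_sum poly_monom)
  then have "(\<Sum>i<p. poly.coeff r i * \<pi> ^ i) \<in> RL"
    using r(2) by (metis (mono_tags, lifting) mem_Collect_eq polys_over_def)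
  then have R: "poly.coeff r i \<in> R" if "i < p" for i
    using coeff_mem_R[of "poly.coeff r"] r(1) that by (simp add: polys_over_def)
  have "of_poly (Polynomial.monom a i) = of_const a * var_x ^ i" for a :: 'l and i
    using evc_monom[of a i var_x] evc_of_poly[of "Polynomial.monom a i" "[:0, 1:]"] by simp
  then have "of_poly r / N = (\<Sum>i<p. of_const (poly.coeff r i) * xs i)"
    by (subst rs) (simp add: sum_divide_distrib xs_eq)
  also have "\<dots> \<in> A"
    using R kR_subset_A xs_mem_A by (intro A_closed(8) A_closed(6)) auto
  finally show ?thesis .
qed

text \<open>Expansion in powers of \<open>\<Phi>\<close>: the division by \<open>\<Phi>\<close> in \<open>K[x]\<close> is, in the
  coordinate \<open>y\<close>, a division by a polynomial over \<open>RL\<close> with unit leading coefficient.\<close>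

lemma phi_adic_mem_A:
  assumes "h \<in> polys_over K" "h \<circ>\<^sub>p x\<^sub>y \<in> polys_over RL" "Polynomial.degree h \<le> p * n"
  shows "of_poly h / N ^ n \<in> A"
  using assms
proof (induction n arbitrary: h)
  case 0
  then obtain a where a: "h = [:a:]" by (metis degree_eq_zeroE le_zero_eq mult_0_right)
  have "a \<in> K" "a \<in> RL"
    using 0 pCons_mem_polys_over[OF subring_RL] pCons_mem_polys_over[OF subfield_amb_closed(1)[OF K_subfield]]
    by (simp_all add: a)
  then show ?case using kR_subset_A[of a] by (simp add: a R_eq)
next
  case (Suc n)
  define q r where "q = h div \<Phi>" and "r = h mod \<Phi>"
  have Phi0: "\<Phi> \<noteq> 0" using degree_Phi p_pos by auto
  have h_eq: "h = q * \<Phi> + r" by (simp only: q_def r_def div_mult_mod_eq)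
  have dr: "Polynomial.degree r < p"
    using degree_mod_less[OF Phi0, of h] degree_Phi p_pos by (auto simp: r_def)
  have qK: "q \<in> polys_over K" "r \<in> polys_over K"
    using div_mod_mem_polys_over[OF subfield_amb_closed(1)[OF K_subfield] Phi_over_K _ Phi0 Suc.prems(1)]
      Phi_over_K subfield_amb_closed(2)[OF K_subfield] by (auto simp: q_def r_def polys_over_def)
  have hl: "h \<circ>\<^sub>p x\<^sub>y = (q \<circ>\<^sub>p x\<^sub>y) * \<nu> + r \<circ>\<^sub>p x\<^sub>y"
    unfolding h_eq by (simp add: pcompose_add pcompose_mult \<nu>_def)
  have drl: "Polynomial.degree (r \<circ>\<^sub>p x\<^sub>y) < Polynomial.degree \<nu>"
    using dr by (simp add: degree_pcompose degree_ell nu(2))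
  \<comment> \<open>Uniqueness of division with remainder: the substitution \<open>x\<^sub>y\<close>
    has degree 1, so it keeps the degree of the remainder below that of the divisor. The quotient
    and remainder over \<open>K\<close> are thereby identified with those over
    \<open>RL\<close>.\<close>
  have "(h \<circ>\<^sub>p x\<^sub>y) div \<nu> = q \<circ>\<^sub>p x\<^sub>y" "(h \<circ>\<^sub>p x\<^sub>y) mod \<nu> = r \<circ>\<^sub>p x\<^sub>y"
    unfolding hl using nu(4) drl by (simp_all add: div_poly_less mod_poly_less)
  then have qRL: "q \<circ>\<^sub>p x\<^sub>y \<in> polys_over RL" "r \<circ>\<^sub>p x\<^sub>y \<in> polys_over RL"
    using div_mod_mem_polys_over[OF subring_RL nu(1) _ nu(4) Suc.prems(2)] c_unit(3) nu(3) by auto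
  have "Polynomial.degree q \<le> p * n"
  proof (cases "q = 0")
    case False
    then have dq: "Polynomial.degree (q * \<Phi>) = Polynomial.degree q + p"
      using Phi0 degree_Phi by (simp add: degree_mult_eq)
    then have "Polynomial.degree h = Polynomial.degree q + p"
      unfolding h_eq using dr by (subst degree_add_eq_left) auto
    then show ?thesis using Suc.prems(3) by simp
  qed simp
  then have "of_poly q / N ^ n \<in> A" by (rule Suc.IH[OF qK(1) qRL(1)])
  moreover have "of_poly r / N * inverse N ^ n \<in> A"
    using low_degree_mem_A[OF qK(2) qRL(2) dr] xs_mem_A[OF p_pos] by (intro A_closed(6) A_closed(7)) (simp_all add: xs_0)
  moreover have "of_poly h / N ^ Suc n = of_poly q / N ^ n + of_poly r / N * inverse N ^ n"
    using N_nonzero unfolding h_eq by (simp add: N_eq[symmetric] field_simps)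
  ultimately show ?case using A_closed(3) by simp
qed

lemma xs_mem_C: "i < p \<Longrightarrow> xs i \<in> C"
proof -
  assume i: "i < p"
  have "Polynomial.degree (x\<^sub>y ^ i) \<le> p * 1"
    using degree_power_le[of x\<^sub>y i] degree_ell i by simp
  then have "evc (x\<^sub>y ^ i) y / N ^ 1 \<in> C"
    by (intro C_mem pRL_closed(7) ell_RL)
  moreover have "evc x\<^sub>y y = var_x" using of_poly_eq_evc[of "[:0, 1:]"] by (simp add: pcompose_pCons)
  ultimately show "xs i \<in> C" by (simp add: xs_eq)
qed

lemma const_mem_C: "a \<in> RL \<Longrightarrow> of_const a \<in> C"
proof -
  assume a: "a \<in> RL"
  have "evc [:a:] y / N ^ 0 \<in> C"
    using a pRL_closed(1) by (intro C_mem) (simp_all add: pCons_mem_polys_over[OF subring_RL])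
  then show ?thesis by simp
qed

lemma A_eq: "A = {a \<in> C. \<forall>g\<in>G. g a = a}"
proof
  interpret inv: invariant_subring G C "{a \<in> C. \<forall>g\<in>G. g a = a}"
    by (rule invariant_subring.intro[OF finite_field_auts_G], rule invariant_subring_axioms.intro) (fact subring_C stable_C refl)+
  have "g (xs i) = xs i" if g: "g \<in> G" for g i
  proof -
    obtain h where h: "h \<in> Gal K" "g = extend_aut h" using g unfolding G_def by blast
    show ?thesis
      unfolding xs_eq by (simp add: act.hom_divide[OF g] act.hom_power[OF g] N_invariant[OF g])
        (simp add: h(2) act_x[OF h(1)])
  qed
  moreover have "g (of_const r) = of_const r" if "g \<in> G" "r \<in> R" for g r
    using that act_const Gal_hom(5) unfolding G_def R_eq by auto
  ultimately show "A \<subseteq> {a \<in> C. \<forall>g\<in>G. g a = a}"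
    unfolding A_def using xs_mem_C const_mem_C R_eq by (intro adjoin_least[OF inv.subring_A]) auto
  show "{a \<in> C. \<forall>g\<in>G. g a = a} \<subseteq> A"
  proof
    fix a assume a: "a \<in> {a \<in> C. \<forall>g\<in>G. g a = a}"
    then obtain f n where f: "f \<in> polys_over RL" "Polynomial.degree f \<le> p * n" "a = evc f y / N ^ n"
      unfolding C_def by blast
    define h where "h = f \<circ>\<^sub>p Y\<^sub>0"
    have h: "of_poly h = evc f y" by (simp add: h_def y_eq evc_of_poly)
    have "of_poly h = a * N ^ n" using f(3) N_nonzero by (simp add: h)
    then have "g (of_poly h) = of_poly h" if "g \<in> G" for g
      using a that N_invariant[OF that] by (simp add: act.hom_mult[OF that] act.hom_power[OF that])
    then have "h \<in> polys_over K" using act_invariant_of_poly_iff by blast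
    moreover have "h \<circ>\<^sub>p x\<^sub>y = f" unfolding h_def by (simp add: pcompose_assoc[symmetric] Y0_ell)
    moreover have "Polynomial.degree h \<le> p * n" using f(2) by (simp add: h_def degree_pcompose degree_Y0)
    ultimately show "a \<in> A" using phi_adic_mem_A[of h n] f(1,3) h by simp
  qed
qed

sublocale inv: invariant_subring G C A
  by (rule invariant_subring.intro[OF finite_field_auts_G], rule invariant_subring_axioms.intro) (fact subring_C stable_C A_eq)+

section \<open>Points of the model and of its quotient\<close>

abbreviation "w \<equiv> inverse y"
abbreviation "B1 \<equiv> adjoin kRL {y}"
abbreviation "B2 \<equiv> adjoin kRL {w}"

definition \<Y> :: "('l poly fract set, 'l poly fract) scheme_in" where "\<Y> = proj_line kRL y"
text \<open>The function \<open>N / y ^ p\<close>, which is \<open>N\<close> read in the coordinate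
  \<open>w\<close>. It is a polynomial in \<open>w\<close> with the unit \<open>c\<close> as
  constant term, and \<open>C\<close> is the localization of \<open>B2\<close> at its
  powers.\<close>

definition s\<^sub>0 :: "'l poly fract" where "s\<^sub>0 = w ^ p * N"

lemmas charts = glued_charts_proj_line[OF subring_RL y_nonzero]
lemmas subring_B1 = adjoin_subring[of kRL "{y}"]
lemmas subring_B2 = adjoin_subring[of kRL "{w}"]
lemmas B1_closed = subring_amb_closed[OF subring_B1]
lemmas B2_closed = subring_amb_closed[OF subring_B2]
lemmas B1_eq = adjoin_singleton_eq[OF subring_RL, of y]
lemmas B2_eq = adjoin_singleton_eq[OF subring_RL, of w]

lemma mem_B1: "f \<in> polys_over RL \<Longrightarrow> evc f y \<in> B1"
  unfolding B1_eq by (rule imageI)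

lemma mem_B2: "f \<in> polys_over RL \<Longrightarrow> evc f w \<in> B2"
  unfolding B2_eq by (rule imageI)

lemma const_mem_B: "a \<in> RL \<Longrightarrow> of_const a \<in> adjoin kRL S"
  using subsetD[OF adjoin_superset(1)[of kRL S] imageI] .

lemma y_mem_B1: "y \<in> B1" and w_mem_B2: "w \<in> B2"
  using adjoin_superset(2)[of "{y}" kRL] adjoin_superset(2)[of "{w}" kRL] by simp_all

lemma points_Y:
  "points \<Y> = {localization B1 P | P. primeideal P (sub_ring B1)} \<union> {localization B2 P | P. primeideal P (sub_ring B2)}"
  unfolding \<Y>_def proj_line_def glued_charts.points_glue[OF charts] by blast

lemma flip_mem_B2: "f \<in> polys_over RL \<Longrightarrow> Polynomial.degree f \<le> n \<Longrightarrow> evc f y * w ^ n \<in> B2"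
  using evc_flip_poly[of f n w] y_nonzero mem_B2[OF flip_poly_mem_polys_over[OF subring_RL]] by simp

lemma s0_mem: "s\<^sub>0 \<in> B2"
  using flip_mem_B2[OF nu(1), of p] nu(2) by (simp add: s\<^sub>0_def N_eq_evc mult.commute)

lemma s0_nonzero: "s\<^sub>0 \<noteq> 0"
  using y_nonzero N_nonzero by (simp add: s\<^sub>0_def)

lemma s0_eq: "s\<^sub>0 = of_const c * (\<Prod>g\<in>Gal K. 1 - of_const (\<delta> g) * w)"
proof -
  have "w ^ p * (\<Prod>g\<in>Gal K. y - of_const (\<delta> g)) = (\<Prod>g\<in>Gal K. w * (y - of_const (\<delta> g)))"
    by (simp add: prod.distrib card_Gal)
  also have "\<dots> = (\<Prod>g\<in>Gal K. 1 - of_const (\<delta> g) * w)"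
    using y_nonzero by (intro prod.cong) (simp_all add: field_simps)
  finally show ?thesis unfolding s\<^sub>0_def N_eq_prod by (simp add: mult.left_commute)
qed

text \<open>The bound \<open>p * n\<close> on the degree in the definition of \<open>C\<close> is
  exactly what makes the numerator, multiplied by \<open>w ^ (p * n)\<close>, a polynomial in
  \<open>w\<close>.\<close>

lemma C_frac:
  assumes a: "a \<in> C"
  shows "\<exists>b\<in>B2. \<exists>n. a = b / s\<^sub>0 ^ n"
proof -
  obtain f n where f: "f \<in> polys_over RL" "Polynomial.degree f \<le> p * n" "a = evc f y / N ^ n"
    using a unfolding C_def by blast
  have "a = (evc f y * w ^ (p * n)) / s\<^sub>0 ^ n"
    using y_nonzero by (simp add: f(3) s\<^sub>0_def power_mult_distrib power_mult)
  then show ?thesis using flip_mem_B2[OF f(1,2)] by blast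
qed

lemma inverse_s0_mem_C: "inverse (s\<^sub>0 ^ n) \<in> C"
proof -
  have "evc (Polynomial.monom 1 (p * n)) y / N ^ n \<in> C"
    using RL_closed(2) by (intro C_mem monom_mem_polys_over[OF subring_RL] degree_monom_le)
  moreover have "inverse (s\<^sub>0 ^ n) = evc (Polynomial.monom 1 (p * n)) y / N ^ n"
    by (simp add: evc_monom s\<^sub>0_def power_mult_distrib power_mult power_inverse divide_inverse)
  ultimately show ?thesis by simp
qed

text \<open>The factor of \<open>N\<close> belonging to the identity is \<open>y\<close> itself, as
  \<open>\<delta> id = 0\<close>. Consequently \<open>1/y\<close> is regular on \<open>RL[y]\<close>
  wherever \<open>1/N\<close> is.\<close>

lemma w_eq: "w = evc (smult c (\<Prod>g\<in>Gal K - {id}. [:- \<delta> g, 1:])) y / N"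
proof -
  have "(\<Prod>g\<in>Gal K. y - of_const (\<delta> g)) = y * (\<Prod>g\<in>Gal K - {id}. y - of_const (\<delta> g))"
    using prod.remove[OF finite_Gal gal.id_mem, of "\<lambda>g. y - of_const (\<delta> g)"] by (simp add: delta_id)
  then have "N = y * evc (smult c (\<Prod>g\<in>Gal K - {id}. [:- \<delta> g, 1:])) y"
    unfolding N_eq_prod by simp
  then show ?thesis using y_nonzero N_nonzero by (simp add: field_simps)
qed

lemma wN_poly: "smult c (\<Prod>g\<in>Gal K - {id}. [:- \<delta> g, 1:]) \<in> polys_over RL"
proof -
  have "[:- \<delta> g, 1:] \<in> polys_over RL" if "g \<in> Gal K - {id}" for g
    using delta_RL[of g] that RL_closed(2,5) pRL_closed(1) by (simp add: pCons_mem_polys_over[OF subring_RL])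
  then show ?thesis using c_unit(2) by (intro smult_mem_polys_over[OF subring_RL] pRL_closed(9))
qed

lemma w_mem_C: "w \<in> C"
proof -
  have "Polynomial.degree (\<Prod>g\<in>Gal K - {id}. [:- \<delta> g, 1:]) = card (Gal K - {id})"
    by (subst degree_prod_eq_sum_degree) simp_all
  also have "\<dots> \<le> p * 1" using card_Gal finite_Gal card_Diff1_le[of "Gal K" id] by simp
  finally have "Polynomial.degree (smult c (\<Prod>g\<in>Gal K - {id}. [:- \<delta> g, 1:])) \<le> p * 1" by simp
  from C_mem[OF wN_poly this] show ?thesis using w_eq by simp
qed

lemma B2_subset_C: "B2 \<subseteq> C"
  by (rule adjoin_least[OF subring_C]) (use const_mem_C w_mem_C in auto)

lemma C_frac_B2: "a \<in> C \<Longrightarrow> \<exists>b\<in>B2. \<exists>s\<in>B2 - {0}. inverse s \<in> C \<and> a = b / s"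
  using C_frac inverse_s0_mem_C s0_nonzero B2_closed(7)[OF s0_mem]
  by (metis Diff_iff power_not_zero singletonD)

lemma chart_C_points: "primeideal Q (sub_ring C) \<Longrightarrow> localization C Q \<in> points \<Y>"
  using localization_of_fractions[OF subring_B2 subring_C _ B2_subset_C C_frac_B2, of Q]
  unfolding points_Y by blast

lemma inverse_N_eq: "inverse N = w ^ p * inverse s\<^sub>0"
  using y_nonzero by (simp add: s\<^sub>0_def)

lemma inverse_N_mem_C: "inverse N \<in> C"
proof -
  have "evc 1 y / N ^ 1 \<in> C" by (rule C_mem) (use pRL_closed(2) in simp_all)
  then show ?thesis by (simp add: inverse_eq_divide)
qed

lemma unit_not_mem_prime:
  assumes "subring B amb" "primeideal P (sub_ring B)" "a \<in> B" "inverse a \<in> B" "a \<noteq> (0 :: 'l poly fract)"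
  shows "a \<notin> P"
proof
  assume "a \<in> P"
  then have "inverse a * a \<in> P" using ideal_sub_ring_closed(6)[OF assms(1) primeideal_ideal[OF assms(2)] assms(4)] by blast
  then show False using assms(5) primeideal_sub_ring_closed(1)[OF assms(1,2)] by simp
qed

lemma const_unit_not_mem_prime:
  assumes "primeideal P (sub_ring (adjoin kRL S))"
  shows "of_const c \<notin> P"
  using const_mem_B[OF c_unit(2), of S] const_mem_B[OF c_unit(3), of S] c_unit(1)
  by (intro unit_not_mem_prime[OF adjoin_subring assms]) simp_all

text \<open>Where \<open>w\<close> vanishes, every factor
  \<open>1 - of_const (\<delta> g) * w\<close> is congruent to 1, and what remains is the unit
  \<open>c\<close>.\<close>

lemma s0_not_mem_prime:
  assumes P: "primeideal P (sub_ring B2)" and w: "w \<in> P"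
  shows "s\<^sub>0 \<notin> P"
proof
  note pr = primeideal_sub_ring_closed[OF subring_B2 P]
  note pid = ideal_sub_ring_closed[OF subring_B2 primeideal_ideal[OF P]]
  have mem: "1 - of_const (\<delta> g) * w \<in> B2" if "g \<in> Gal K" for g
    by (intro B2_closed(4) B2_closed(6) B2_closed(2) w_mem_B2 const_mem_B delta_RL that)
  assume "s\<^sub>0 \<in> P"
  then have "of_const c * (\<Prod>g\<in>Gal K. 1 - of_const (\<delta> g) * w) \<in> P" by (simp only: s0_eq)
  moreover have "(\<Prod>g\<in>Gal K. 1 - of_const (\<delta> g) * w) \<in> B2" by (rule B2_closed(9)[OF mem])
  ultimately have "(\<Prod>g\<in>Gal K. 1 - of_const (\<delta> g) * w) \<in> P"
    using pr(2)[OF const_mem_B[OF c_unit(2)]] const_unit_not_mem_prime[OF P] by metis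
  then have "\<exists>g\<in>Gal K. 1 - of_const (\<delta> g) * w \<in> P"
    using pr(4)[OF finite_Gal, of "\<lambda>g. 1 - of_const (\<delta> g) * w"] mem by metis
  then obtain g where g: "g \<in> Gal K" "1 - of_const (\<delta> g) * w \<in> P" ..
  have "of_const (\<delta> g) * w \<in> P" by (rule pid(6)[OF const_mem_B[OF delta_RL[OF g(1)]] w])
  from pid(3)[OF g(2) this] show False using pr(1) by simp
qed

text \<open>Where \<open>w\<close> vanishes this holds without any condition on \<open>N\<close>;
  elsewhere \<open>y\<close> is regular, and \<open>1/s\<^sub>0\<close> is \<open>y ^ p\<close>
  times \<open>1/N\<close>.\<close>

lemma inverse_s0_mem:
  assumes P: "primeideal P (sub_ring B2)" and N: "inverse N \<in> localization B2 P"
  shows "inverse s\<^sub>0 \<in> localization B2 P"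
proof (cases "w \<in> P")
  case True
  then show ?thesis
    using s0_not_mem_prime[OF P] inverse_mem_localization_iff[OF subring_B2 P s0_mem s0_nonzero] by blast
next
  case False
  note \<O> = subring_amb_closed[OF subring_localization[OF subring_B2 P]]
  have "y \<in> localization B2 P"
    using False inverse_mem_localization_iff[OF subring_B2 P w_mem_B2] y_nonzero by simp
  then have "y ^ p * inverse N \<in> localization B2 P" using \<O>(6,7) N by blast
  moreover have "inverse s\<^sub>0 = y ^ p * inverse N"
    by (simp add: s\<^sub>0_def power_inverse)
  ultimately show ?thesis by simp
qed

lemma chart2_mem_V:
  assumes P: "primeideal P (sub_ring B2)" and N: "inverse N \<in> localization B2 P"
  shows "\<exists>Q. primeideal Q (sub_ring C) \<and> localization B2 P = localization C Q"
proof -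
  note \<O> = subring_amb_closed[OF subring_localization[OF subring_B2 P]]
  have "C \<subseteq> localization B2 P"
  proof
    fix a assume "a \<in> C"
    then obtain b n where b: "b \<in> B2" "a = b / s\<^sub>0 ^ n" using C_frac by blast
    then have "a = b * inverse s\<^sub>0 ^ n" by (simp add: divide_inverse power_inverse)
    also have "\<dots> \<in> localization B2 P"
      using b(1) subset_localization[OF subring_B2 P] inverse_s0_mem[OF assms]
      by (intro \<O>(6) \<O>(7)) auto
    finally show "a \<in> localization B2 P" .
  qed
  from localization_center_intermediate[OF subring_B2 P subring_C B2_subset_C this] show ?thesis by metis
qed

lemma switch_to_B2:
  assumes "primeideal P (sub_ring B1)" "w \<in> localization B1 P"
  shows "\<exists>Q. primeideal Q (sub_ring B2) \<and> localization B1 P = localization B2 Q"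
  using proj_line_chart_switch[OF subring_RL, of w P] y_nonzero assms by simp

lemma switch_to_B1:
  assumes "primeideal P (sub_ring B2)" "y \<in> localization B2 P"
  shows "\<exists>Q. primeideal Q (sub_ring B1) \<and> localization B2 P = localization B1 Q"
  using proj_line_chart_switch[OF subring_RL y_nonzero assms] .

lemma V_eq: "{localization C Q | Q. primeideal Q (sub_ring C)} = {\<O> \<in> points \<Y>. inverse N \<in> \<O>}"
proof (intro equalityI subsetI)
  fix \<O> assume "\<O> \<in> {localization C Q | Q. primeideal Q (sub_ring C)}"
  then obtain Q where "primeideal Q (sub_ring C)" "\<O> = localization C Q" by blast
  then show "\<O> \<in> {\<O> \<in> points \<Y>. inverse N \<in> \<O>}"
    using chart_C_points subset_localization[OF subring_C] inverse_N_mem_C by blast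
next
  fix \<O> assume "\<O> \<in> {\<O> \<in> points \<Y>. inverse N \<in> \<O>}"
  then have "\<O> \<in> points \<Y>" and N: "inverse N \<in> \<O>" by auto
  then consider P where "primeideal P (sub_ring B1)" "\<O> = localization B1 P"
    | P where "primeideal P (sub_ring B2)" "\<O> = localization B2 P"
    unfolding points_Y by blast
  then show "\<O> \<in> {localization C Q | Q. primeideal Q (sub_ring C)}"
  proof cases
    case 1
    note cl = subring_amb_closed[OF subring_localization[OF subring_B1 1(1)]]
    \<comment> \<open>Regularity of \<open>1/N\<close> makes \<open>w\<close> regular, so a point of
      the chart \<open>B1\<close> at which it holds also lies on the chart
      \<open>B2\<close>.\<close>
    have "w = evc (smult c (\<Prod>g\<in>Gal K - {id}. [:- \<delta> g, 1:])) y * inverse N"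
      using w_eq by (simp only: divide_inverse)
    also have "\<dots> \<in> \<O>"
      unfolding 1(2) by (rule cl(6)[OF subsetD[OF subset_localization[OF subring_B1 1(1)] mem_B1[OF wN_poly]] N[unfolded 1(2)]])
    finally obtain P' where P': "primeideal P' (sub_ring B2)" "\<O> = localization B2 P'"
      using switch_to_B2[OF 1(1)] 1(2) by blast
    from chart2_mem_V[OF P'(1)] N P'(2) show ?thesis by blast
  next
    case 2
    from chart2_mem_V[OF 2(1)] N 2(2) show ?thesis by blast
  qed
qed

text \<open>A point of the chart \<open>B2\<close> either has \<open>w\<close> invertible, and then
  lies on \<open>B1\<close>, or has \<open>w\<close> vanishing, and then
  \<open>1/N = w ^ p / s\<^sub>0\<close> is regular there. This replaces the standard charts by a
  cover with two \<open>G\<close>-stable sets, from which stability of all of \<open>\<Y>\<close>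
  can be read off.\<close>

lemma points_Y': "points \<Y> = {localization B1 P | P. primeideal P (sub_ring B1)} \<union> {\<O> \<in> points \<Y>. inverse N \<in> \<O>}"
proof -
  have "localization B2 P \<in> {localization B1 P | P. primeideal P (sub_ring B1)} \<union> {\<O> \<in> points \<Y>. inverse N \<in> \<O>}"
    if P: "primeideal P (sub_ring B2)" for P
  proof (cases "w \<in> P")
    case True
    note cl = subring_amb_closed[OF subring_localization[OF subring_B2 P]]
    have "w ^ p * inverse s\<^sub>0 \<in> localization B2 P"
      using s0_not_mem_prime[OF P True] inverse_mem_localization_iff[OF subring_B2 P s0_mem s0_nonzero]
        subset_localization[OF subring_B2 P] w_mem_B2
      by (intro cl(6) cl(7)) auto
    then have "inverse N \<in> localization B2 P" using inverse_N_eq by simp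
    then show ?thesis using P unfolding points_Y by blast
  next
    case False
    have "y \<in> localization B2 P"
      using False inverse_mem_localization_iff[OF subring_B2 P w_mem_B2] y_nonzero by simp
    then show ?thesis using switch_to_B1[OF P] by blast
  qed
  then show ?thesis unfolding points_Y by blast
qed

lemma stable_B1: "g \<in> G \<Longrightarrow> b \<in> B1 \<Longrightarrow> g b \<in> B1"
proof -
  assume "g \<in> G" "b \<in> B1"
  then obtain h f where "h \<in> Gal K" "g = extend_aut h" "f \<in> polys_over RL" "b = evc f y"
    unfolding G_def B1_eq by blast
  then show "g b \<in> B1" using act_evc_y[of h f] mem_B1 by auto
qed

sublocale B1: invariant_subring G B1 "{b \<in> B1. \<forall>g\<in>G. g b = b}"
  by (rule invariant_subring.intro[OF finite_field_auts_G], rule invariant_subring_axioms.intro)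
    (fact subring_B1 stable_B1 refl)+

lemma inverse_N_invariant: "\<forall>g\<in>G. g (inverse N) = inverse N"
  by (intro ballI) (simp only: act.hom_inverse N_invariant)

lemma stable_Y: "g \<in> G \<Longrightarrow> \<O> \<in> points \<Y> \<Longrightarrow> g ` \<O> \<in> points \<Y>"
proof -
  assume g: "g \<in> G" and "\<O> \<in> points \<Y>"
  then consider P where "primeideal P (sub_ring B1)" "\<O> = localization B1 P"
    | Q where "primeideal Q (sub_ring C)" "\<O> = localization C Q"
    using points_Y' V_eq by blast
  then show ?thesis
  proof cases
    case 1
    then have "g ` \<O> = localization B1 (g ` P)" "primeideal (g ` P) (sub_ring B1)"
      using B1.image_localization[OF g] B1.image_prime[OF _ g] by auto
    then show ?thesis unfolding points_Y by blast
  next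
    case 2
    then have "g ` \<O> = localization C (g ` Q)" "primeideal (g ` Q) (sub_ring C)"
      using inv.image_localization[OF g] inv.image_prime[OF _ g] by auto
    then show ?thesis using chart_C_points by simp
  qed
qed

sublocale sch: quotient_chart G \<Y> C A
proof (rule quotient_chart.intro[OF scheme_action.intro[OF finite_field_auts_G scheme_action_axioms.intro]
      inv.invariant_subring_axioms quotient_chart_axioms.intro])
  show "sections \<Y> W = (if W = {} then {0} else \<Inter>W)" for W
    unfolding \<Y>_def proj_line_def by (rule sections_glue_Spec)
  show "openin (space_of \<Y>) {\<O> \<in> points \<Y>. f \<in> \<O>}" for f
    unfolding \<Y>_def proj_line_def by (rule glued_charts.openin_glue_domain[OF charts])
  show "\<exists>F. finite F \<and> F \<subseteq> \<O> \<and> {\<O>' \<in> points \<Y>. F \<subseteq> \<O>'} \<subseteq> W"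
    if "openin (space_of \<Y>) W" "\<O> \<in> W" for W \<O>
    using glued_charts.openin_glueD[OF charts] that unfolding \<Y>_def proj_line_def by blast
qed (fact stable_Y chart_C_points)+

section \<open>The closure of the divisor of zeroes\<close>

abbreviation "\<X> \<equiv> quotient_scheme \<Y> G"

lemma V_def': "sch.V = {\<O> \<in> points \<Y>. inverse N \<in> \<O>}"
  unfolding sch.V_def by (rule V_eq)

text \<open>The prime ideal generated by \<open>y\<close> in \<open>RL[y]\<close>, that is the
  generic point of the section \<open>y = 0\<close>. Its orbit is the generic point of the divisor
  whose closure is sought.\<close>

definition P\<^sub>y :: "'l poly fract set" where
  "P\<^sub>y = {evc f y | f. f \<in> polys_over RL \<and> poly.coeff f 0 = 0}"

lemma mem_Py:
  assumes "f \<in> polys_over RL"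
  shows "evc f y \<in> P\<^sub>y \<longleftrightarrow> poly.coeff f 0 = 0"
proof
  assume "evc f y \<in> P\<^sub>y"
  then obtain f' where "evc f y = evc f' y" "poly.coeff f' 0 = 0" unfolding P\<^sub>y_def by blast
  then show "poly.coeff f 0 = 0" by (simp add: evc_y_inject)
qed (use assms in \<open>auto simp: P\<^sub>y_def\<close>)

lemma prime_Py: "primeideal P\<^sub>y (sub_ring B1)"
  unfolding primeideal_sub_ring_iff[OF subring_B1] ideal_sub_ring_iff[OF subring_B1]
proof (intro conjI ballI impI)
  show "P\<^sub>y \<subseteq> B1" unfolding P\<^sub>y_def using mem_B1 by auto
  show "0 \<in> P\<^sub>y" using mem_Py[OF pRL_closed(1)] by simp
  show "1 \<notin> P\<^sub>y" using mem_Py[OF pRL_closed(2)] by simp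
next
  fix a b assume "a \<in> P\<^sub>y" "b \<in> P\<^sub>y"
  then obtain f g where fg: "f \<in> polys_over RL" "g \<in> polys_over RL" "a = evc f y" "b = evc g y"
    "poly.coeff f 0 = 0" "poly.coeff g 0 = 0" unfolding P\<^sub>y_def by blast
  then show "a + b \<in> P\<^sub>y" using mem_Py[OF pRL_closed(3)[OF fg(1,2)]] by simp
next
  fix a b assume "a \<in> B1" "b \<in> P\<^sub>y"
  then obtain f g where fg: "f \<in> polys_over RL" "g \<in> polys_over RL" "a = evc f y" "b = evc g y"
    "poly.coeff g 0 = 0" unfolding B1_eq P\<^sub>y_def by blast
  then show "a * b \<in> P\<^sub>y" using mem_Py[OF pRL_closed(6)[OF fg(1,2)]] by (simp add: coeff_mult_0)
next
  fix a b assume "a \<in> B1" "b \<in> B1" and ab: "a * b \<in> P\<^sub>y"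
  then obtain f g where fg: "f \<in> polys_over RL" "g \<in> polys_over RL" "a = evc f y" "b = evc g y"
    unfolding B1_eq by blast
  then show "a \<in> P\<^sub>y \<or> b \<in> P\<^sub>y"
    using mem_Py[OF pRL_closed(6)[OF fg(1,2)]] mem_Py[OF fg(1)] mem_Py[OF fg(2)] ab by (simp add: coeff_mult_0)
qed

lemma phi_y: "of_poly \<phi> = of_const (\<pi>K ^ m) * N"
  using piK_nonzero by (simp add: N_def)

lemma piKm_RL: "\<pi>K ^ m \<in> RL"
  using RL_closed(7)[of \<pi>K m] eisenstein[OF p_pos] Vge_mono[of 0 "int p"] by (simp add: RL_eq)

text \<open>Each factor of \<open>N\<close> is conjugate to a unit times \<open>y\<close>. Hence the points at which \<open>1 / N\<close> is
  not regular are, up to the action of \<open>G\<close>, specializations of the generic point of \<open>y = 0\<close>.\<close>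

lemma outside_V_specializes:
  assumes \<O>: "\<O> \<in> points \<Y>" and N: "inverse N \<notin> \<O>"
  shows "\<exists>\<O>'\<in>points \<Y>. point_orbit G \<O>' = point_orbit G \<O> \<and> \<O>' \<subseteq> localization B1 P\<^sub>y"
proof -
  obtain P where P: "primeideal P (sub_ring B1)" "\<O> = localization B1 P"
    using \<O> N points_Y' by blast
  note pr = primeideal_sub_ring_closed[OF subring_B1 P(1)]
  have mem: "y - of_const (\<delta> g) \<in> B1" if "g \<in> Gal K" for g
    by (intro B1_closed(4) y_mem_B1 const_mem_B delta_RL that)
  have "N \<in> B1" unfolding N_eq_evc by (rule mem_B1[OF nu(1)])
  then have "N \<in> P" using N inverse_mem_localization_iff[OF subring_B1 P(1) _ N_nonzero] P(2) by blast
  then have "of_const c * (\<Prod>g\<in>Gal K. y - of_const (\<delta> g)) \<in> P" by (simp only: N_eq_prod)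
  moreover have "(\<Prod>g\<in>Gal K. y - of_const (\<delta> g)) \<in> B1" by (rule B1_closed(9)[OF mem])
  ultimately have "(\<Prod>g\<in>Gal K. y - of_const (\<delta> g)) \<in> P"
    using pr(2)[OF const_mem_B[OF c_unit(2)]] const_unit_not_mem_prime[OF P(1)] by metis
  then have "\<exists>g\<in>Gal K. y - of_const (\<delta> g) \<in> P"
    using pr(4)[OF finite_Gal, of "\<lambda>g. y - of_const (\<delta> g)"] mem by metis
  then obtain g where g: "g \<in> Gal K" "y - of_const (\<delta> g) \<in> P" ..
  then have gy: "extend_aut g y \<in> P"
    unfolding act_y[OF g(1)]
    by (intro ideal_sub_ring_closed(6)[OF subring_B1 primeideal_ideal[OF P(1)]] const_mem_B conj_ratio_RL(1))
  obtain k where k: "k \<in> G" "k \<circ> extend_aut g = id" using act.inv_mem[OF act_G[OF g(1)]] by blast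
  have "y \<in> k ` P" using gy k(2) by (metis comp_apply id_apply imageI)
  have kP: "primeideal (k ` P) (sub_ring B1)" by (rule B1.image_prime[OF P(1) k(1)])
  have k\<O>: "k ` \<O> = localization B1 (k ` P)" using B1.image_localization[OF k(1)] P(2) by simp
  have "P\<^sub>y \<subseteq> k ` P"
  proof
    fix a assume "a \<in> P\<^sub>y"
    then obtain f where f: "f \<in> polys_over RL" "poly.coeff f 0 = 0" "a = evc f y" unfolding P\<^sub>y_def by blast
    obtain b f' where "f = pCons b f'" by (cases f)
    then have "a = y * evc f' y" "f' \<in> polys_over RL" using f pCons_mem_polys_over[OF subring_RL] by auto
    then show "a \<in> k ` P"
      using ideal_sub_ring_closed(7)[OF subring_B1 primeideal_ideal[OF kP] \<open>y \<in> k ` P\<close> mem_B1] by simp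
  qed
  then have "k ` \<O> \<subseteq> localization B1 P\<^sub>y" unfolding k\<O> localization_def by blast
  moreover have "k ` \<O> \<in> points \<Y>" by (rule stable_Y[OF k(1) \<O>])
  ultimately show ?thesis using act.point_orbit_image[OF k(1)] by blast
qed

text \<open>No nonzero constant lies in \<open>P\<^sub>y\<close>, so the point is on the generic
  fibre; and \<open>y = 0\<close> means \<open>x = \<pi>\<close>, a root of \<phi>.\<close>

lemma generic_zero_mem:
  "point_orbit G (localization B1 P\<^sub>y) \<in> zeroes kR \<X> (of_poly \<phi>)"
proof -
  let ?\<O> = "localization B1 P\<^sub>y"
  have pt: "?\<O> \<in> points \<Y>" using prime_Py unfolding points_Y by blast
  note st = sch.stalk_quotient[OF pt]
  have inv: "\<forall>g\<in>G. g (of_poly \<phi>) = of_poly \<phi>" using act_invariant_of_poly_iff phi_over_K by blast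
  have "inverse a \<in> stalk \<X> (point_orbit G ?\<O>)" if a: "a \<in> kR - {0}" for a
  proof -
    obtain r where r: "r \<in> R" "a = of_const r" "r \<noteq> 0" using a by auto
    have rRL: "[:r:] \<in> polys_over RL" using r(1) pRL_closed(1) by (simp add: R_eq pCons_mem_polys_over[OF subring_RL])
    have "a = evc [:r:] y" using r by simp
    then have "a \<notin> P\<^sub>y" "a \<in> B1" using mem_Py[OF rRL] mem_B1[OF rRL] r(3) by auto
    then have "inverse a \<in> ?\<O>" using inverse_mem_localization_iff[OF subring_B1 prime_Py, of a] a by blast
    moreover have "g a = a" if "g \<in> G" for g
      using that r act_const Gal_hom(5) unfolding G_def R_eq by auto
    then have "\<forall>g\<in>G. g (inverse a) = inverse a" by (simp add: act.hom_inverse)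
    ultimately show ?thesis unfolding st by simp
  qed
  moreover have "point_orbit G ?\<O> \<in> points \<X>" unfolding sch.points_quotient using pt by blast
  moreover have poly: "\<phi> \<circ>\<^sub>p x\<^sub>y \<in> polys_over RL"
  proof -
    have "\<phi> = smult (\<pi>K ^ m) \<Phi>" using piK_nonzero by (simp add: \<Phi>_def)
    then have "\<phi> \<circ>\<^sub>p x\<^sub>y = smult (\<pi>K ^ m) \<nu>" by (metis \<nu>_def pcompose_smult)
    then show ?thesis using smult_mem_polys_over[OF subring_RL piKm_RL nu(1)] by simp
  qed
  then have "of_poly \<phi> \<in> B1" unfolding of_poly_eq_evc[of \<phi>] by (rule mem_B1)
  then have "of_poly \<phi> \<in> stalk \<X> (point_orbit G ?\<O>)"
    unfolding st using subset_localization[OF subring_B1 prime_Py] inv by blast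
  moreover have "of_poly \<phi> \<in> P\<^sub>y"
    unfolding of_poly_eq_evc[of \<phi>] mem_Py[OF poly] using phi(3) by (simp add: pcompose_coeff_0 x\<^sub>y_def)
  then have "inverse (of_poly \<phi>) \<notin> ?\<O>"
    using inverse_mem_localization_iff[OF subring_B1 prime_Py \<open>of_poly \<phi> \<in> B1\<close>] phi_nonzero by simp
  then have "inverse (of_poly \<phi>) \<notin> stalk \<X> (point_orbit G ?\<O>)" unfolding st by blast
  ultimately show ?thesis unfolding zeroes_def generic_fibre_def by blast
qed

text \<open>On the generic fibre \<phi> and \<open>N\<close> differ by an invertible constant, so
  the zeroes lie in the locus where \<open>1/N\<close> is not regular, which is closed. Conversely
  each orbit in this locus contains a specialization of the generic point of \<open>y = 0\<close>,
  and every open set around a specialization contains that generic point.\<close>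

lemma closure_zeroes:
  "Abstract_Topology.closure_of (space_of \<X>) (zeroes kR \<X> (of_poly \<phi>)) =
    {point_orbit G \<O> | \<O>. \<O> \<in> points \<Y> \<and> inverse N \<notin> \<O>}" (is "?L = ?Z")
proof
  define T where "T = {x. \<exists>\<O>\<in>points \<Y>. inverse N \<in> \<O> \<and> x = point_orbit G \<O>}"
  have T: "openin (space_of \<X>) T"
    unfolding T_def by (rule sch.openin_quotient_domain[OF inverse_N_invariant])
  have memT: "point_orbit G \<O> \<in> T \<longleftrightarrow> inverse N \<in> \<O>" if "\<O> \<in> points \<Y>" for \<O>
    unfolding T_def by (rule sch.orbit_mem_domain_iff[OF inverse_N_invariant that])
  have Z: "?Z = points \<X> - T"
    unfolding sch.points_quotient using memT by blast
  have "zeroes kR \<X> (of_poly \<phi>) \<subseteq> ?Z"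
  proof
    fix x assume x: "x \<in> zeroes kR \<X> (of_poly \<phi>)"
    then have "x \<in> points \<X>" unfolding zeroes_def generic_fibre_def by blast
    then obtain \<O> where \<O>: "\<O> \<in> points \<Y>" "x = point_orbit G \<O>" unfolding sch.points_quotient by blast
    note st = sch.stalk_quotient[OF \<O>(1), folded \<O>(2)]
    have "subring \<O> amb" using \<O>(1) subring_localization subring_B1 subring_B2 unfolding points_Y by blast
    note cl = subring_amb_closed[OF this]
    have "\<pi>K ^ m \<in> R" using piKm_RL K_closed(7)[OF phi(2)] by (simp add: R_eq)
    then have "of_const (\<pi>K ^ m) \<in> kR - {0}" using piK_nonzero by (simp del: of_const_simps)
    then have "inverse (of_const (\<pi>K ^ m)) \<in> \<O>"
      using x st unfolding zeroes_def generic_fibre_def by blast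
    moreover have "inverse (of_poly \<phi>) \<notin> \<O>"
    proof
      assume "inverse (of_poly \<phi>) \<in> \<O>"
      moreover have "\<forall>g\<in>G. g (inverse (of_poly \<phi>)) = inverse (of_poly \<phi>)"
        using act_invariant_of_poly_iff[of \<phi>] phi_over_K by (simp add: act.hom_inverse)
      ultimately show False using x st unfolding zeroes_def by blast
    qed
    moreover have "inverse (of_poly \<phi>) = inverse (of_const (\<pi>K ^ m)) * inverse N"
      unfolding phi_y by simp
    ultimately have "inverse N \<notin> \<O>" using cl(6) by metis
    then show "x \<in> ?Z" using \<O> by blast
  qed
  then show "?L \<subseteq> ?Z"
    by (rule closure_of_minimal) (unfold Z, rule closedin_diff[OF closedin_topspace T])
  show "?Z \<subseteq> ?L"
  proof
    fix x assume "x \<in> ?Z"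
    then obtain \<O> where \<O>: "\<O> \<in> points \<Y>" "inverse N \<notin> \<O>" "x = point_orbit G \<O>" by blast
    obtain \<O>' where \<O>': "\<O>' \<in> points \<Y>" "point_orbit G \<O>' = x" "\<O>' \<subseteq> localization B1 P\<^sub>y"
      using outside_V_specializes[OF \<O>(1,2)] \<O>(3) by blast
    have pt: "localization B1 P\<^sub>y \<in> points \<Y>" using prime_Py unfolding points_Y by blast
    have "point_orbit G (localization B1 P\<^sub>y) \<in> T" if "openin (space_of \<X>) T" "x \<in> T" for T
      using sch.specialization_open_quotient[OF that(1) \<O>'(1) pt \<O>'(3)] \<O>'(2) that(2) by simp
    moreover have "x \<in> points \<X>" using \<O> unfolding sch.points_quotient by blast
    ultimately show "x \<in> ?L"
      unfolding in_closure_of using generic_zero_mem by blast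
  qed
qed

lemma complement_closure:
  "points \<X> - {point_orbit G \<O> | \<O>. \<O> \<in> points \<Y> \<and> inverse N \<notin> \<O>} = point_orbit G ` sch.V"
proof -
  have "inverse N \<in> \<O>' \<longleftrightarrow> inverse N \<in> \<O>" if "point_orbit G \<O>' = point_orbit G \<O>" for \<O> \<O>'
    by (rule sch.mem_orbit_invariant[OF inverse_N_invariant that])
  then show ?thesis unfolding sch.points_quotient V_def' by blast
qed

end

section \<open>The point \<open>\<xi>\<close>\<close>

lemma genideal_sub_ring:
  assumes "subring A (amb :: 'a::comm_ring_1 ring)" "S \<subseteq> A"
  shows "ideal (genideal (sub_ring A) S) (sub_ring A)" "S \<subseteq> genideal (sub_ring A) S"
    "ideal J (sub_ring A) \<Longrightarrow> S \<subseteq> J \<Longrightarrow> genideal (sub_ring A) S \<subseteq> J"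
proof -
  interpret cring "sub_ring A" by (rule cring_sub_ring[OF assms(1)])
  show "ideal (genideal (sub_ring A) S) (sub_ring A)" by (rule genideal_ideal) (use assms(2) in simp)
  show "S \<subseteq> genideal (sub_ring A) S" by (rule genideal_self) (use assms(2) in simp)
  show "ideal J (sub_ring A) \<Longrightarrow> S \<subseteq> J \<Longrightarrow> genideal (sub_ring A) S \<subseteq> J" by (rule genideal_minimal)
qed

context quotient_model
begin

text \<open>The point \<open>y = \<infinity>\<close> of the special fibre. Described by the constant
  coefficient in \<open>w\<close>, its primality reduces to that of the maximal ideal of
  \<open>RL\<close>.\<close>

definition P\<^sub>w :: "'l poly fract set" where
  "P\<^sub>w = {evc f w | f. f \<in> polys_over RL \<and> poly.coeff f 0 \<in> Vge 1}"

lemma mem_Pw: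
  assumes "f \<in> polys_over RL"
  shows "evc f w \<in> P\<^sub>w \<longleftrightarrow> poly.coeff f 0 \<in> Vge 1"
proof
  assume "evc f w \<in> P\<^sub>w"
  then obtain f' where "evc f w = evc f' w" "poly.coeff f' 0 \<in> Vge 1" unfolding P\<^sub>w_def by blast
  then show "poly.coeff f 0 \<in> Vge 1" by (simp add: evc_w_inject)
qed (use assms in \<open>auto simp: P\<^sub>w_def\<close>)

lemma coeff_RL: "f \<in> polys_over RL \<Longrightarrow> poly.coeff f i \<in> Vge 0"
  by (simp add: polys_over_def RL_eq)

lemma Vge_1_prime: "a \<in> Vge 0 \<Longrightarrow> b \<in> Vge 0 \<Longrightarrow> a * b \<in> Vge 1 \<Longrightarrow> a \<in> Vge 1 \<or> b \<in> Vge 1"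
  by (cases "a = 0"; cases "b = 0") (auto simp: Vge_def v_mult)

lemma prime_Pw: "primeideal P\<^sub>w (sub_ring B2)"
  unfolding primeideal_sub_ring_iff[OF subring_B2] ideal_sub_ring_iff[OF subring_B2]
proof (intro conjI ballI impI)
  show "P\<^sub>w \<subseteq> B2" unfolding P\<^sub>w_def using mem_B2 by auto
  show "0 \<in> P\<^sub>w" using mem_Pw[OF pRL_closed(1)] by (simp add: Vge_zero)
  show "1 \<notin> P\<^sub>w" using mem_Pw[OF pRL_closed(2)] by (simp add: Vge_def v_one)
next
  fix a b assume "a \<in> P\<^sub>w" "b \<in> P\<^sub>w"
  then obtain f g where fg: "f \<in> polys_over RL" "g \<in> polys_over RL" "a = evc f w" "b = evc g w"
    "poly.coeff f 0 \<in> Vge 1" "poly.coeff g 0 \<in> Vge 1" unfolding P\<^sub>w_def by blast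
  then show "a + b \<in> P\<^sub>w" using mem_Pw[OF pRL_closed(3)[OF fg(1,2)]] Vge_add[OF fg(5,6)] by simp
next
  fix a b assume "a \<in> B2" "b \<in> P\<^sub>w"
  then obtain f g where fg: "f \<in> polys_over RL" "g \<in> polys_over RL" "a = evc f w" "b = evc g w"
    "poly.coeff g 0 \<in> Vge 1" unfolding B2_eq P\<^sub>w_def by blast
  have "poly.coeff f 0 * poly.coeff g 0 \<in> Vge 1"
    using Vge_mult[OF coeff_RL[OF fg(1)] fg(5)] by simp
  then show "a * b \<in> P\<^sub>w" using mem_Pw[OF pRL_closed(6)[OF fg(1,2)]] fg(3,4) by (simp add: coeff_mult_0)
next
  fix a b assume "a \<in> B2" "b \<in> B2" and ab: "a * b \<in> P\<^sub>w"
  then obtain f g where fg: "f \<in> polys_over RL" "g \<in> polys_over RL" "a = evc f w" "b = evc g w"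
    unfolding B2_eq by blast
  then have "poly.coeff f 0 * poly.coeff g 0 \<in> Vge 1"
    using mem_Pw[OF pRL_closed(6)[OF fg(1,2)]] ab by (simp add: coeff_mult_0)
  then show "a \<in> P\<^sub>w \<or> b \<in> P\<^sub>w"
    using Vge_1_prime[OF coeff_RL[OF fg(1)] coeff_RL[OF fg(2)]] mem_Pw[OF fg(1)] mem_Pw[OF fg(2)] fg(3,4) by simp
qed

lemma w_mem_Pw: "w \<in> P\<^sub>w"
proof -
  have "[:0, 1:] \<in> polys_over RL"
    using RL_closed(1,2) pRL_closed(1) by (simp add: pCons_mem_polys_over[OF subring_RL])
  from mem_Pw[OF this] show ?thesis by (simp add: Vge_zero)
qed

lemma const_mem_Pw: "a \<in> Vge 1 \<Longrightarrow> of_const a \<in> P\<^sub>w"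
proof -
  assume a: "a \<in> Vge 1"
  then have "a \<in> RL" using Vge_mono[of 0 1] by (simp add: RL_eq)
  then have "[:a:] \<in> polys_over RL" using pRL_closed(1) by (simp add: pCons_mem_polys_over[OF subring_RL])
  from mem_Pw[OF this] a show ?thesis by simp
qed

lemma Pw_eq_genideal: "genideal (sub_ring B2) {of_const \<pi>, w} = P\<^sub>w"
proof
  have pi: "of_const \<pi> \<in> B2" by (rule const_mem_B[OF pi_RL])
  have sub: "{of_const \<pi>, w} \<subseteq> B2" using pi w_mem_B2 by simp
  note gi = genideal_sub_ring[OF subring_B2 sub]
  show "genideal (sub_ring B2) {of_const \<pi>, w} \<subseteq> P\<^sub>w"
    using w_mem_Pw const_mem_Pw[of \<pi>] v_pi by (intro gi(3) primeideal_ideal[OF prime_Pw]) (simp add: Vge_def)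
  show "P\<^sub>w \<subseteq> genideal (sub_ring B2) {of_const \<pi>, w}"
  proof
    fix a assume "a \<in> P\<^sub>w"
    then obtain f where f: "f \<in> polys_over RL" "poly.coeff f 0 \<in> Vge 1" "a = evc f w" unfolding P\<^sub>w_def by blast
    obtain b f' where bf: "f = pCons b f'" by (cases f)
    have "f' \<in> polys_over RL" "b \<in> Vge 1" using f bf pCons_mem_polys_over[OF subring_RL] by auto
    have "b / \<pi> \<in> RL"
      using \<open>b \<in> Vge 1\<close> pi_nonzero v_pi by (cases "b = 0") (auto simp: RL_eq Vge_def v_divide)
    have "a = of_const (b / \<pi>) * of_const \<pi> + evc f' w * w"
      using pi_nonzero f(3) bf by (simp add: mult.commute)
    also have "\<dots> \<in> genideal (sub_ring B2) {of_const \<pi>, w}"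
      using gi(2) ideal_sub_ring_closed(3,6)[OF subring_B2 gi(1)] const_mem_B[OF \<open>b / \<pi> \<in> RL\<close>]
        mem_B2[OF \<open>f' \<in> polys_over RL\<close>] by (meson insert_subset)
    finally show "a \<in> genideal (sub_ring B2) {of_const \<pi>, w}" .
  qed
qed

definition \<eta> :: "'l poly fract set" where "\<eta> = localization B2 P\<^sub>w"

lemma subring_eta: "subring \<eta> amb"
  unfolding \<eta>_def by (rule subring_localization[OF subring_B2 prime_Pw])

lemmas eta_closed = subring_amb_closed[OF subring_eta]

lemma B2_subset_eta: "B2 \<subseteq> \<eta>"
  unfolding \<eta>_def by (rule subset_localization[OF subring_B2 prime_Pw])

lemma inverse_mem_eta_iff: "b \<in> B2 \<Longrightarrow> b \<noteq> 0 \<Longrightarrow> inverse b \<in> \<eta> \<longleftrightarrow> b \<notin> P\<^sub>w"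
  unfolding \<eta>_def by (rule inverse_mem_localization_iff[OF subring_B2 prime_Pw])

lemma inverse_s0_mem_eta: "inverse s\<^sub>0 \<in> \<eta>"
  using inverse_mem_eta_iff[OF s0_mem s0_nonzero] s0_not_mem_prime[OF prime_Pw w_mem_Pw] by simp

lemma eta_mem_V: "\<eta> \<in> sch.V"
proof -
  have "w ^ p * inverse s\<^sub>0 \<in> \<eta>"
    using B2_subset_eta w_mem_B2 by (intro eta_closed(6) eta_closed(7) inverse_s0_mem_eta) auto
  then have "inverse N \<in> \<eta>" using inverse_N_eq by simp
  moreover have "\<eta> \<in> points \<Y>" unfolding points_Y \<eta>_def using prime_Pw by blast
  ultimately show ?thesis unfolding V_def' by simp
qed

lemma prime_center_eta: "primeideal (center A \<eta>) (sub_ring A)"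
proof -
  obtain Q where "primeideal Q (sub_ring C)" "\<eta> = localization C Q" using eta_mem_V unfolding sch.V_def by blast
  then show ?thesis using inv.center_A_localization inv.prime_inter by simp
qed

lemma xs_mem_center: "i < p \<Longrightarrow> xs i \<in> center A \<eta>"
proof -
  assume i: "i < p"
  \<comment> \<open>The numerator \<open>w ^ p * x ^ i\<close> is split so that each
    \<open>x\<close> is paired with a \<open>w\<close>, because
    \<open>w * x = \<pi> * w + \<pi> ^ m\<close> is regular at \<eta>. As \<open>i < p\<close>, at
    least one factor \<open>w\<close> is left over, and it vanishes at \<eta>.\<close>
  define b where "b = w * (w ^ (p - i - 1) * (w * var_x) ^ i)"
  have "var_x = of_const \<pi> + y * of_const (\<pi> ^ m)"
    using of_poly_eq_evc[of "[:0, 1:]"] by (simp add: pcompose_pCons x\<^sub>y_def)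
  then have wx: "w * var_x = of_const \<pi> * w + of_const (\<pi> ^ m)"
    using y_nonzero by (simp add: field_simps)
  have wx_B2: "w * var_x \<in> B2"
    unfolding wx by (intro B2_closed(3) B2_closed(6) const_mem_B pi_RL w_mem_B2 RL_closed(7))
  have "w ^ (p - i - 1) * (w * var_x) ^ i \<in> B2"
    by (rule B2_closed(6)[OF B2_closed(7)[OF w_mem_B2] B2_closed(7)[OF wx_B2]])
  then have b: "b \<in> P\<^sub>w"
    unfolding b_def by (rule ideal_sub_ring_closed(7)[OF subring_B2 primeideal_ideal[OF prime_Pw] w_mem_Pw])
  have "w * w ^ (p - i - 1) * w ^ i = w ^ p"
    using i by (simp flip: power_Suc power_add)
  then have "b = w ^ p * var_x ^ i" unfolding b_def by (simp add: power_mult_distrib mult.assoc[symmetric])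
  then have xs_b: "xs i = b * inverse s\<^sub>0" unfolding xs_eq s\<^sub>0_def using y_nonzero N_nonzero by (simp add: field_simps)
  have "inverse (xs i) \<notin> \<eta>" if nz: "xs i \<noteq> 0"
  proof
    assume "inverse (xs i) \<in> \<eta>"
    then have "inverse (xs i) * inverse s\<^sub>0 \<in> \<eta>" using eta_closed(6) inverse_s0_mem_eta by blast
    moreover have "inverse (xs i) * inverse s\<^sub>0 = inverse b"
      unfolding xs_b using s0_nonzero by simp
    moreover have "b \<noteq> 0" "b \<in> B2" using nz xs_b b ideal_sub_ring_closed(1)[OF subring_B2 primeideal_ideal[OF prime_Pw]] by auto
    ultimately show False using inverse_mem_eta_iff b by simp
  qed
  then show "xs i \<in> center A \<eta>" using xs_mem_A[OF i] by (auto simp: center_def)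
qed

lemma piK_R: "\<pi>K \<in> R"
  using phi(2)[of 0] vK_coeff_0 by (simp add: valuation_ring_def)

lemma const_mem_center_iff:
  assumes "r \<in> R"
  shows "of_const r \<in> center A \<eta> \<longleftrightarrow> r = 0 \<or> 0 < vK r"
proof (cases "r = 0")
  case True
  then show ?thesis using ideal_sub_ring_closed(2)[OF subring_A primeideal_ideal[OF prime_center_eta]] by simp
next
  case False
  have rRL: "r \<in> RL" and rK: "r \<in> K" using assms by (simp_all add: R_eq)
  have "[:r:] \<in> polys_over RL" using rRL pRL_closed(1) by (simp add: pCons_mem_polys_over[OF subring_RL])
  from mem_Pw[OF this] have "of_const r \<in> P\<^sub>w \<longleftrightarrow> r \<in> Vge 1" by simp
  also have "\<dots> \<longleftrightarrow> 1 \<le> int p * vK r" using False ram rK by (simp add: Vge_def)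
  also have "\<dots> \<longleftrightarrow> 0 < vK r" using p_pos by (metis zero_less_mult_pos mult_pos_pos int_one_le_iff_zero_less of_nat_0_less_iff)
  finally have "of_const r \<in> P\<^sub>w \<longleftrightarrow> 0 < vK r" .
  moreover have "of_const r \<in> B2" by (rule const_mem_B[OF rRL])
  ultimately show ?thesis
    using False kR_subset_A[OF assms] inverse_mem_eta_iff[of "of_const r"] by (simp add: center_def)
qed

definition \<mm> :: "'l poly fract set" where
  "\<mm> = genideal (sub_ring A) (insert (of_const \<pi>K) (xs ` {..<p}))"

lemma mm_generators: "insert (of_const \<pi>K) (xs ` {..<p}) \<subseteq> A"
  using kR_subset_A[OF piK_R] xs_mem_A by auto

lemmas mm_genideal = genideal_sub_ring[OF subring_A mm_generators, folded \<mm>_def]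
lemmas mm_closed = ideal_sub_ring_closed[OF subring_A mm_genideal(1)]

lemma mm_cancel: "a - b \<in> \<mm> \<Longrightarrow> b \<in> \<mm> \<Longrightarrow> a \<in> \<mm>"
  using mm_closed(3)[of "a - b" b] by simp

text \<open>The elements congruent to a constant from \<open>R\<close> form a ring containing the
  generators, since each \<open>xs i\<close> is congruent to 0. Questions about the ideal are
  thereby reduced to the valuation ring \<open>R\<close>.\<close>

lemma A_eq_R_plus_mm:
  assumes "a \<in> A"
  shows "\<exists>r\<in>R. a - of_const r \<in> \<mm>"
proof -
  define T where "T = {a \<in> A. \<exists>r\<in>R. a - of_const r \<in> \<mm>}"
  note R_closed = subring_amb_closed[OF subring_R]
  have TI: "a \<in> T" if "a \<in> A" "r \<in> R" "a - of_const r \<in> \<mm>" for a r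
    unfolding T_def using that by blast
  have "subring T amb"
    unfolding subring_amb_iff
  proof (intro conjI ballI)
    show "1 \<in> T" by (rule TI[OF A_closed(2) R_closed(2)]) (simp add: mm_closed(2))
    fix a b assume "a \<in> T" "b \<in> T"
    then obtain r s where rs: "r \<in> R" "s \<in> R" "a - of_const r \<in> \<mm>" "b - of_const s \<in> \<mm>" and ab: "a \<in> A" "b \<in> A"
      unfolding T_def by blast
    show "a - b \<in> T"
    proof (rule TI[OF A_closed(4)[OF ab] R_closed(4)[OF rs(1,2)]])
      have eq: "a - b - of_const (r - s) = (a - of_const r) - (b - of_const s)" by simp
      show "a - b - of_const (r - s) \<in> \<mm>" unfolding eq by (rule mm_closed(5)[OF rs(3,4)])
    qed
    show "a * b \<in> T"
    proof (rule TI[OF A_closed(6)[OF ab] R_closed(6)[OF rs(1,2)]])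
      have eq: "a * b - of_const (r * s) = a * (b - of_const s) + of_const s * (a - of_const r)"
        by (simp add: algebra_simps)
      show "a * b - of_const (r * s) \<in> \<mm>"
        unfolding eq
        by (intro mm_closed(3) mm_closed(6)[OF ab(1) rs(4)] mm_closed(6)[OF kR_subset_A[OF rs(2)] rs(3)])
    qed
  qed
  moreover have "of_const r \<in> T" if "r \<in> R" for r
    by (rule TI[OF kR_subset_A[OF that] that]) (simp add: mm_closed(2))
  moreover have "xs i \<in> T" if "i < p" for i
    by (rule TI[OF xs_mem_A[OF that] R_closed(1)]) (use mm_genideal(2) that in auto)
  ultimately have "A \<subseteq> T" unfolding A_def by (intro adjoin_least) auto
  then show ?thesis using assms unfolding T_def by blast
qed

lemma const_mem_mm: "r \<in> R \<Longrightarrow> 0 < vK r \<or> r = 0 \<Longrightarrow> of_const r \<in> \<mm>"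
proof -
  assume r: "r \<in> R" and v: "0 < vK r \<or> r = 0"
  show ?thesis
  proof (cases "r = 0")
    case False
    have rK: "r \<in> K" using r by (simp add: R_eq)
    then have rdK: "r / \<pi>K \<in> K" using subfield_amb_closed(3)[OF K_subfield] phi(2) by blast
    have "vL (r / \<pi>K) = int p * vK r - int p"
      using False ram rK v_coeff_0 by (simp add: v_divide)
    moreover have "int p * 1 \<le> int p * vK r" using v False by (intro mult_left_mono) simp_all
    ultimately have "0 \<le> vL (r / \<pi>K)" by simp
    then have "r / \<pi>K \<in> R" using rdK by (simp add: R_eq RL_eq Vge_def)
    moreover have "of_const \<pi>K \<in> \<mm>" using mm_genideal(2) by simp
    ultimately have "of_const (r / \<pi>K) * of_const \<pi>K \<in> \<mm>"
      by (rule mm_closed(6)[OF kR_subset_A])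
    then show ?thesis using piK_nonzero by simp
  qed (simp add: mm_closed(2))
qed

text \<open>All generators vanish at \<eta>. An element vanishing there differs from a constant by
  an element of \<open>\<mm>\<close>; the constant vanishes at \<eta> as well, so it is a multiple
  of the uniformizer \<open>\<pi>K\<close>.\<close>

lemma mm_eq_center: "\<mm> = center A \<eta>"
proof
  note ci = ideal_sub_ring_closed[OF subring_A primeideal_ideal[OF prime_center_eta]]
  show 1: "\<mm> \<subseteq> center A \<eta>"
    using const_mem_center_iff[OF piK_R] vK_coeff_0 xs_mem_center
    by (intro mm_genideal(3) primeideal_ideal[OF prime_center_eta]) auto
  show "center A \<eta> \<subseteq> \<mm>"
  proof
    fix a assume a: "a \<in> center A \<eta>"
    then have "a \<in> A" by (simp add: center_def)
    then obtain r where r: "r \<in> R" "a - of_const r \<in> \<mm>" using A_eq_R_plus_mm by blast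
    have "a - (a - of_const r) \<in> center A \<eta>" using ci(5)[OF a] r(2) 1 by blast
    then have "of_const r \<in> \<mm>" using const_mem_center_iff[OF r(1)] const_mem_mm[OF r(1)] by auto
    then show "a \<in> \<mm>" by (rule mm_cancel[OF r(2)])
  qed
qed

text \<open>An element of a larger ideal can be replaced by a constant from \<open>R\<close>, which
  is either divisible by \<open>\<pi>K\<close> or a unit. Only the first is possible in a proper
  ideal.\<close>

lemma maximal_mm: "maximalideal \<mm> (sub_ring A)"
proof (rule maximalidealI[OF mm_genideal(1)])
  have "1 \<notin> \<mm>" using primeideal_sub_ring_closed(1)[OF subring_A prime_center_eta] mm_eq_center by simp
  then show "carrier (sub_ring A) \<noteq> \<mm>" using A_closed(2) by auto
  fix J assume J: "ideal J (sub_ring A)" "\<mm> \<subseteq> J" "J \<subseteq> carrier (sub_ring A)"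
  note iJ = ideal_sub_ring_closed[OF subring_A J(1)]
  show "J = \<mm> \<or> J = carrier (sub_ring A)"
  proof (rule disjCI)
    assume "J \<noteq> carrier (sub_ring A)"
    have "1 \<notin> J"
    proof
      assume "1 \<in> J"
      then have "a \<in> J" if "a \<in> A" for a using iJ(6)[OF that] by fastforce
      then show False using \<open>J \<noteq> carrier (sub_ring A)\<close> J(3) by auto
    qed
    have "J \<subseteq> \<mm>"
    proof
      fix a assume a: "a \<in> J"
      then obtain r where r: "r \<in> R" "a - of_const r \<in> \<mm>" using A_eq_R_plus_mm iJ(1) by blast
      then have rJ: "of_const r \<in> J" using iJ(5)[OF a] J(2) by fastforce
      have "0 < vK r \<or> r = 0"
      proof (rule ccontr)
        assume neg: "\<not> ?thesis"
        then have "vK r = 0" using r(1) by (auto simp: valuation_ring_def)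
        moreover have "r \<in> K" using r(1) by (simp add: R_eq)
        ultimately have "vL r = 0" using neg ram by simp
        then have "inverse r \<in> R"
          using unit_RL neg subfield_amb_closed(2)[OF K_subfield \<open>r \<in> K\<close>] by (simp add: R_eq)
        then have "of_const (inverse r) * of_const r \<in> J" using iJ(6)[OF kR_subset_A rJ] by blast
        then show False using \<open>1 \<notin> J\<close> neg by simp
      qed
      then have "of_const r \<in> \<mm>" by (rule const_mem_mm[OF r(1)])
      then show "a \<in> \<mm>" by (rule mm_cancel[OF r(2)])
    qed
    then show "J = \<mm>" using J(2) by blast
  qed
qed

end

section \<open>Relations between the generators\<close>

definition monom_eval :: "(nat \<Rightarrow> 'f::comm_ring_1) \<Rightarrow> (nat \<Rightarrow>\<^sub>0 nat) \<Rightarrow> 'f" where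
  "monom_eval s t = (\<Prod>i\<in>Poly_Mapping.keys t. s i ^ Poly_Mapping.lookup t i)"

lemma monom_eval_superset:
  assumes "finite I" "Poly_Mapping.keys t \<subseteq> I"
  shows "monom_eval s t = (\<Prod>i\<in>I. s i ^ Poly_Mapping.lookup t i)"
  unfolding monom_eval_def
  by (rule prod.mono_neutral_left) (use assms in \<open>auto simp: in_keys_iff\<close>)

lemma monom_eval_add: "monom_eval s (t + t') = monom_eval s t * monom_eval s t'"
proof -
  let ?I = "Poly_Mapping.keys t \<union> Poly_Mapping.keys t'"
  have "Poly_Mapping.keys (t + t') \<subseteq> ?I" by (rule keys_add)
  then show ?thesis
    by (simp add: monom_eval_superset[of ?I] lookup_add power_add prod.distrib)
qed

lemma monom_eval_zero [simp]: "monom_eval s 0 = 1"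
  by (simp add: monom_eval_def)

lemma monom_eval_single [simp]: "monom_eval s (Poly_Mapping.single i (Suc 0)) = s i"
  by (simp add: monom_eval_def)

lemma poly_mapping_sum_singles:
  "q = (\<Sum>t\<in>Poly_Mapping.keys q. Poly_Mapping.single t (Poly_Mapping.lookup q t))"
proof (rule poly_mapping_eqI)
  fix k
  have "(\<Sum>t\<in>Poly_Mapping.keys q. Poly_Mapping.lookup (Poly_Mapping.single t (Poly_Mapping.lookup q t)) k) =
      (\<Sum>t\<in>Poly_Mapping.keys q. if t = k then Poly_Mapping.lookup q k else 0)"
    by (intro sum.cong refl) (simp add: lookup_single when_def)
  then show "Poly_Mapping.lookup q k = Poly_Mapping.lookup (\<Sum>t\<in>Poly_Mapping.keys q. Poly_Mapping.single t (Poly_Mapping.lookup q t)) k"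
    by (simp add: lookup_sum in_keys_iff)
qed

locale mv_evaluation =
  fixes c :: "'l::comm_ring_1 \<Rightarrow> 'f::comm_ring_1" and s :: "nat \<Rightarrow> 'f"
  assumes c_add: "c (a + b) = c a + c b" and c_mult: "c (a * b) = c a * c b" and c_one: "c 1 = 1"
begin

lemma c_zero: "c 0 = 0"
  using c_add[of 0 0] by (metis add.right_neutral add_left_cancel)

lemma eval_superset:
  assumes "finite T" "Poly_Mapping.keys q \<subseteq> T"
  shows "mv_eval c s q = (\<Sum>t\<in>T. c (Poly_Mapping.lookup q t) * monom_eval s t)"
  unfolding mv_eval_def monom_eval_def[symmetric]
  by (rule sum.mono_neutral_left) (use assms in \<open>auto simp: in_keys_iff c_zero\<close>)

lemma eval_add: "mv_eval c s (q + r) = mv_eval c s q + mv_eval c s r"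
proof -
  let ?T = "Poly_Mapping.keys q \<union> Poly_Mapping.keys r"
  have "Poly_Mapping.keys (q + r) \<subseteq> ?T" by (rule keys_add)
  then show ?thesis
    by (simp add: eval_superset[of ?T] lookup_add c_add distrib_right sum.distrib)
qed

lemma eval_single: "mv_eval c s (Poly_Mapping.single t a) = c a * monom_eval s t"
  using eval_superset[of "{t}" "Poly_Mapping.single t a"] by simp

lemma eval_zero: "mv_eval c s 0 = 0"
  by (simp add: mv_eval_def)

lemma eval_one: "mv_eval c s 1 = 1"
  using eval_single[of 0 1] c_one by simp

lemma eval_sum: "mv_eval c s (sum f I) = (\<Sum>i\<in>I. mv_eval c s (f i))"
  by (induction I rule: infinite_finite_induct) (simp_all add: eval_zero eval_add)

lemma eval_mult: "mv_eval c s (q * r) = mv_eval c s q * mv_eval c s r"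
proof -
  let ?m = "\<lambda>q t. Poly_Mapping.single t (Poly_Mapping.lookup q t)"
  have "q * r = (\<Sum>t\<in>Poly_Mapping.keys q. ?m q t) * (\<Sum>t\<in>Poly_Mapping.keys r. ?m r t)"
    by (simp flip: poly_mapping_sum_singles)
  also have "mv_eval c s \<dots> = (\<Sum>t\<in>Poly_Mapping.keys q. mv_eval c s (?m q t)) * (\<Sum>t\<in>Poly_Mapping.keys r. mv_eval c s (?m r t))"
    by (simp add: sum_product eval_sum mult_single eval_single c_mult monom_eval_add ac_simps)
  also have "\<dots> = mv_eval c s q * mv_eval c s r"
    by (simp only: eval_single) (simp add: mv_eval_def monom_eval_def)
  finally show ?thesis .
qed

lemma eval_diff: "mv_eval c s (q - r) = mv_eval c s q - mv_eval c s r"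
  using eval_add[of "q - r" r] by (simp add: eq_diff_eq)

lemma eval_const: "mv_eval c s (mv_const a) = c a"
  by (simp add: mv_const_def eval_single)

lemma eval_var: "mv_eval c s (mv_var i) = s i"
  unfolding mv_var_def eval_single by (simp add: c_one)

lemma eval_power: "mv_eval c s (q ^ n) = mv_eval c s q ^ n"
  by (induction n) (simp_all add: eval_one eval_mult)

end

lemma mv_const_simps [simp]: "mv_const 0 = 0" "mv_const 1 = (1 :: 'l::comm_ring_1 mvpoly)"
  by (simp_all add: mv_const_def)

lemma mv_const_mult: "mv_const (a * b) = mv_const a * (mv_const b :: 'l::comm_ring_1 mvpoly)"
  by (simp add: mv_const_def mult_single)

lemma mv_const_uminus: "mv_const (- a) = - (mv_const a :: 'l::comm_ring_1 mvpoly)"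
  by (simp add: mv_const_def single_uminus)

context
  fixes R :: "'l::comm_ring_1 set" and n :: nat
  assumes R: "subring R amb"
begin

lemmas R_closed = subring_amb_closed[OF R]

lemma mem_mv_poly_ring_iff:
  "q \<in> mv_poly_ring R n \<longleftrightarrow> (\<forall>t. Poly_Mapping.lookup q t \<in> R \<and> (Poly_Mapping.lookup q t \<noteq> 0 \<longrightarrow> Poly_Mapping.keys t \<subseteq> {..<n}))"
  unfolding mv_poly_ring_def mem_Collect_eq Ball_def in_keys_iff using R_closed(1) by metis

lemma single_mem_mv_poly_ring: "a \<in> R \<Longrightarrow> Poly_Mapping.keys t \<subseteq> {..<n} \<Longrightarrow> Poly_Mapping.single t a \<in> mv_poly_ring R n"
  unfolding mem_mv_poly_ring_iff using R_closed(1) by (auto simp: lookup_single when_def)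

lemma add_mem_mv_poly_ring:
  assumes "q \<in> mv_poly_ring R n" "r \<in> mv_poly_ring R n"
  shows "q + r \<in> mv_poly_ring R n"
  unfolding mem_mv_poly_ring_iff
proof (intro allI conjI impI)
  note q = assms(1)[unfolded mem_mv_poly_ring_iff, rule_format] and r = assms(2)[unfolded mem_mv_poly_ring_iff, rule_format]
  fix t
  show "Poly_Mapping.lookup (q + r) t \<in> R" unfolding lookup_add using q r R_closed(3) by simp
  assume "Poly_Mapping.lookup (q + r) t \<noteq> 0"
  then have "Poly_Mapping.lookup q t \<noteq> 0 \<or> Poly_Mapping.lookup r t \<noteq> 0" by (auto simp: lookup_add)
  then show "Poly_Mapping.keys t \<subseteq> {..<n}" using q r by blast
qed

lemma sum_mem_mv_poly_ring: "(\<And>i. i \<in> I \<Longrightarrow> f i \<in> mv_poly_ring R n) \<Longrightarrow> sum f I \<in> mv_poly_ring R n"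
  by (induction I rule: infinite_finite_induct)
    (use R_closed(1) in \<open>simp_all add: add_mem_mv_poly_ring mem_mv_poly_ring_iff[of 0]\<close>)

lemma mv_poly_ring_singles:
  assumes "q \<in> mv_poly_ring R n" "t \<in> Poly_Mapping.keys q"
  shows "Poly_Mapping.lookup q t \<in> R" "Poly_Mapping.keys t \<subseteq> {..<n}"
  using assms unfolding mv_poly_ring_def by auto

lemma subring_mv_poly_ring: "subring (mv_poly_ring R n) amb"
  unfolding subring_amb_iff
proof (intro conjI ballI)
  show "1 \<in> mv_poly_ring R n"
    using single_mem_mv_poly_ring[of 1 0] R_closed(2) by simp
  fix q r assume q: "q \<in> mv_poly_ring R n" and r: "r \<in> mv_poly_ring R n"
  have "- r \<in> mv_poly_ring R n"
    using r R_closed(5) unfolding mem_mv_poly_ring_iff by auto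
  then show "q - r \<in> mv_poly_ring R n" using add_mem_mv_poly_ring[OF q, of "- r"] by simp
  let ?m = "\<lambda>q t. Poly_Mapping.single t (Poly_Mapping.lookup q t)"
  have "q * r = (\<Sum>t\<in>Poly_Mapping.keys q. ?m q t) * (\<Sum>t\<in>Poly_Mapping.keys r. ?m r t)"
    by (simp flip: poly_mapping_sum_singles)
  also have "\<dots> \<in> mv_poly_ring R n"
    unfolding sum_product mult_single
  proof (intro sum_mem_mv_poly_ring single_mem_mv_poly_ring)
    fix t t' assume t: "t \<in> Poly_Mapping.keys q" and t': "t' \<in> Poly_Mapping.keys r"
    show "Poly_Mapping.lookup q t * Poly_Mapping.lookup r t' \<in> R"
      using mv_poly_ring_singles(1)[OF q t] mv_poly_ring_singles(1)[OF r t'] by (rule R_closed(6))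
    show "Poly_Mapping.keys (t + t') \<subseteq> {..<n}"
      using keys_add[of t t'] mv_poly_ring_singles(2)[OF q t] mv_poly_ring_singles(2)[OF r t'] by blast
  qed
  finally show "q * r \<in> mv_poly_ring R n" .
qed

lemma mv_const_mem: "a \<in> R \<Longrightarrow> mv_const a \<in> mv_poly_ring R n"
  unfolding mv_const_def by (rule single_mem_mv_poly_ring) simp_all

lemma mv_var_mem: "i < n \<Longrightarrow> mv_var i \<in> mv_poly_ring R n"
  unfolding mv_var_def using R_closed(2) by (intro single_mem_mv_poly_ring) simp_all

text \<open>A single term is built by induction on its total degree, splitting off one variable at a
  time, and a polynomial by adding its terms.\<close>

lemma mv_poly_ring_induct [consumes 1, case_names const add var]:
  assumes q: "q \<in> mv_poly_ring R n"
    and const: "\<And>a. a \<in> R \<Longrightarrow> Q (mv_const a)"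
    and add: "\<And>q r. Q q \<Longrightarrow> Q r \<Longrightarrow> Q (q + r)"
    and var: "\<And>i q. i < n \<Longrightarrow> Q q \<Longrightarrow> Q (mv_var i * q)"
  shows "Q q"
proof -
  have single: "Q (Poly_Mapping.single t a)"
    if "(\<Sum>i<n. Poly_Mapping.lookup t i) = k" "Poly_Mapping.keys t \<subseteq> {..<n}" "a \<in> R" for k t a
    using that
  proof (induction k arbitrary: t)
    case 0
    then have "Poly_Mapping.lookup t i = 0" for i
      by (cases "i < n") (auto simp: in_keys_iff subset_iff)
    then have "t = 0" by (intro poly_mapping_eqI) simp
    then show ?case using const[OF 0(3)] by (simp add: mv_const_def)
  next
    case (Suc k)
    then obtain i where i: "i < n" "Poly_Mapping.lookup t i \<noteq> 0"
      by (metis lessThan_iff nat.distinct(1) sum.neutral)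
    define t' where "t' = t - Poly_Mapping.single i 1"
    have look: "Poly_Mapping.lookup t j = Poly_Mapping.lookup t' j + (if j = i then 1 else 0)" for j
      using i(2) by (simp add: t'_def lookup_minus lookup_single when_def)
    have t: "t = Poly_Mapping.single i 1 + t'"
      by (rule poly_mapping_eqI) (simp add: look lookup_add lookup_single when_def)
    have "(\<Sum>j<n. Poly_Mapping.lookup t j) = (\<Sum>j<n. Poly_Mapping.lookup t' j) + 1"
      unfolding look sum.distrib using i(1) by simp
    then have "(\<Sum>j<n. Poly_Mapping.lookup t' j) = k" using Suc.prems(1) by simp
    moreover have "Poly_Mapping.keys t' \<subseteq> {..<n}"
      using Suc.prems(2) look by (auto simp: in_keys_iff subset_iff)
    ultimately have "Q (Poly_Mapping.single t' a)" using Suc.IH Suc.prems(3) by blast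
    moreover have "Poly_Mapping.single t a = mv_var i * Poly_Mapping.single t' a"
      by (simp add: t mv_var_def mult_single)
    ultimately show ?case using var[OF i(1)] by simp
  qed
  have "Q (\<Sum>t\<in>T. Poly_Mapping.single t (Poly_Mapping.lookup q t))" if "finite T" "T \<subseteq> Poly_Mapping.keys q" for T
    using that
  proof (induction T rule: finite_induct)
    case empty
    then show ?case using const[OF R_closed(1)] by simp
  next
    case (insert t T)
    then show ?case
      using add[OF single[OF refl]] mv_poly_ring_singles[OF q, of t] by simp
  qed
  from this[of "Poly_Mapping.keys q"] show ?thesis
    using poly_mapping_sum_singles[of q] by simp
qed

end

text \<open>Modulo \<open>\<Phi>\<close> only the digit \<open>D 0\<close> survives, and its degree
  is too small for a nonzero multiple; after it has vanished a factor \<open>\<Phi>\<close> cancels.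
  The last coefficient \<open>E\<close> may have any degree, as it is what remains at the
  end.\<close>

lemma phi_adic_unique:
  fixes \<Phi> :: "'l::field poly"
  assumes "(\<Sum>j<n. D j * \<Phi> ^ j) + E * \<Phi> ^ n = 0" "\<And>j. Polynomial.degree (D j) < Polynomial.degree \<Phi>"
  shows "E = 0 \<and> (\<forall>j<n. D j = 0)"
  using assms
proof (induction n arbitrary: D)
  case (Suc n)
  define r where "r = (\<Sum>j<n. D (Suc j) * \<Phi> ^ j) + E * \<Phi> ^ n"
  have "D 0 + \<Phi> * r = 0"
    using Suc.prems(1) unfolding sum.lessThan_Suc_shift r_def by (simp add: algebra_simps sum_distrib_left)
  then have eq: "D 0 = \<Phi> * (- r)" by (simp only: eq_neg_iff_add_eq_0 mult_minus_right)
  have "r = 0"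
  proof (rule ccontr)
    assume "r \<noteq> 0"
    then have "Polynomial.degree (D 0) = Polynomial.degree \<Phi> + Polynomial.degree r"
      unfolding eq using Suc.prems(2)[of 0] by (subst degree_mult_eq) auto
    then show False using Suc.prems(2)[of 0] by simp
  qed
  then have "E = 0 \<and> (\<forall>j<n. D (Suc j) = 0)" unfolding r_def using Suc.IH[of "\<lambda>j. D (Suc j)"] Suc.prems(2) by blast
  moreover have "D 0 = 0" using eq \<open>r = 0\<close> by simp
  ultimately show ?case by (metis less_Suc_eq_0_disj)
qed simp

section \<open>The evaluation map onto the invariants and its kernel\<close>

context quotient_model
begin

abbreviation "\<P> \<equiv> mv_poly_ring R p"
abbreviation "ev \<equiv> mv_eval of_const xs"

lemmas subring_P = subring_mv_poly_ring[OF subring_R, of p]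
lemmas P_closed = subring_amb_closed[OF subring_P]
lemmas R_closed' = subring_amb_closed[OF subring_R]
lemmas const_mem_P = mv_const_mem[OF subring_R, of _ p]
lemmas var_mem_P = mv_var_mem[OF subring_R, of _ p]

sublocale mv: mv_evaluation of_const xs
  by unfold_locales simp_all

lemma ev_mem_A: "q \<in> \<P> \<Longrightarrow> ev q \<in> A"
proof (induction q rule: mv_poly_ring_induct[OF subring_R, consumes 1, case_names const add var])
  case (const a)
  then show ?case unfolding mv.eval_const by (rule kR_subset_A)
next
  case (add q r)
  then show ?case unfolding mv.eval_add by (rule A_closed(3))
next
  case (var i q)
  then show ?case unfolding mv.eval_mult mv.eval_var by (intro A_closed(6) xs_mem_A)
qed

lemma ev_hom: "ev \<in> ring_hom (sub_ring \<P>) (sub_ring A)"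
  by (rule ring_hom_memI) (simp_all add: ev_mem_A mv.eval_mult mv.eval_add mv.eval_one)

lemma ev_image: "ev ` \<P> = A"
proof
  show "ev ` \<P> \<subseteq> A" using ev_mem_A by blast
  have "subring (ev ` \<P>) amb"
    unfolding subring_amb_iff
  proof (intro conjI ballI)
    show "1 \<in> ev ` \<P>" using P_closed(2) by (intro image_eqI[of _ _ 1]) (simp_all add: mv.eval_one)
    fix a b assume "a \<in> ev ` \<P>" "b \<in> ev ` \<P>"
    then obtain q r where qr: "q \<in> \<P>" "r \<in> \<P>" "a = ev q" "b = ev r" by blast
    show "a - b \<in> ev ` \<P>" using P_closed(4)[OF qr(1,2)] qr(3,4) by (intro image_eqI[of _ _ "q - r"]) (simp_all add: mv.eval_diff)
    show "a * b \<in> ev ` \<P>" using P_closed(6)[OF qr(1,2)] qr(3,4) by (intro image_eqI[of _ _ "q * r"]) (simp_all add: mv.eval_mult)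
  qed
  moreover have "kR \<subseteq> ev ` \<P>"
  proof clarify
    fix r assume "r \<in> R"
    from const_mem_P[OF this] show "of_const r \<in> ev ` \<P>" by (intro image_eqI[of _ _ "mv_const r"]) (simp_all add: mv.eval_const)
  qed
  moreover have "xs ` {..<p} \<subseteq> ev ` \<P>"
  proof clarify
    fix i assume "i < p"
    from var_mem_P[OF this] show "xs i \<in> ev ` \<P>" by (intro image_eqI[of _ _ "mv_var i"]) (simp_all add: mv.eval_var)
  qed
  ultimately show "A \<subseteq> ev ` \<P>" unfolding A_def by (rule adjoin_least)
qed

definition Z :: "'l mvpoly" where "Z = rel_z p (\<pi>K ^ m) (poly.coeff \<phi>)"
text \<open>The entries of the relation matrix indexed by the sum of row and column, with
  \<open>z\<close> at index \<open>p\<close>; row \<open>i\<close> consists of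
  \<open>\<chi> i\<close> and \<open>\<chi> (Suc i)\<close>.\<close>

definition \<chi> :: "nat \<Rightarrow> 'l mvpoly" where "\<chi> i = (if i < p then mv_var i else Z)"
definition I :: "'l mvpoly set" where
  "I = genideal (sub_ring \<P>) (minors2 p (rel_matrix p (\<pi>K ^ m) (poly.coeff \<phi>)))"

lemma coeff_R: "i < p \<Longrightarrow> poly.coeff \<phi> i \<in> R"
  using eisenstein[of i] phi(2)[of i] Vge_mono[of 0 "int p"] by (simp add: R_eq RL_eq)

lemma Z_mem: "Z \<in> \<P>"
  unfolding Z_def rel_z_def using R_closed'(7)[OF piK_R] coeff_R
  by (intro P_closed(4) P_closed(8) P_closed(6) const_mem_P var_mem_P) auto

lemma X_mem: "\<chi> i \<in> \<P>"
  unfolding \<chi>_def using Z_mem var_mem_P by simp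

lemma minors_eq: "minors2 p (rel_matrix p (\<pi>K ^ m) (poly.coeff \<phi>)) = {\<chi> i * \<chi> (Suc j) - \<chi> (Suc i) * \<chi> j | i j. i < j \<and> j < p}"
proof -
  have "rel_matrix p (\<pi>K ^ m) (poly.coeff \<phi>) i 0 = \<chi> i" "rel_matrix p (\<pi>K ^ m) (poly.coeff \<phi>) i 1 = \<chi> (Suc i)" for i
    by (simp_all add: rel_matrix_def \<chi>_def Z_def)
  then show ?thesis unfolding minors2_def by simp
qed

lemma minors_subset: "minors2 p (rel_matrix p (\<pi>K ^ m) (poly.coeff \<phi>)) \<subseteq> \<P>"
  unfolding minors_eq using X_mem P_closed(4,6) by auto

lemmas I_genideal = genideal_sub_ring[OF subring_P minors_subset, folded I_def]
lemmas I_closed = ideal_sub_ring_closed[OF subring_P I_genideal(1)]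

text \<open>This explains the entry \<open>z\<close>: as \<phi> is monic, \<open>x ^ p\<close> is
  \<phi> minus its lower terms, and \<open>\<phi> / N\<close> is the constant
  \<open>\<pi>K ^ m\<close>. The entries evaluate to a geometric progression with ratio
  \<open>x\<close>, so the second column is \<open>x\<close> times the first and all minors
  vanish.\<close>

lemma ev_X: "i \<le> p \<Longrightarrow> ev (\<chi> i) = var_x ^ i / N"
proof (cases "i < p")
  case True
  then show ?thesis by (simp add: \<chi>_def mv.eval_var xs_eq)
next
  case False
  assume "i \<le> p"
  have phi_x: "of_poly \<phi> = (\<Sum>i<p. of_const (poly.coeff \<phi> i) * var_x ^ i) + var_x ^ p"
  proof -
    have "of_poly \<phi> = evc \<phi> var_x" by (simp add: evc_of_poly)
    also have "\<dots> = (\<Sum>i\<le>p. of_const (poly.coeff \<phi> i) * var_x ^ i)" by (rule evc_altdef) (simp add: degree_phi)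
    also have "\<dots> = (\<Sum>i<p. of_const (poly.coeff \<phi> i) * var_x ^ i) + of_const (poly.coeff \<phi> p) * var_x ^ p"
      by (simp add: lessThan_Suc_atMost[symmetric])
    also have "poly.coeff \<phi> p = 1" using phi(1) degree_phi by simp
    finally show ?thesis by (simp only: of_const_0_1 mult_1)
  qed
  have "ev Z = of_const (\<pi>K ^ m) - (\<Sum>i<p. of_const (poly.coeff \<phi> i) * xs i)"
    unfolding Z_def rel_z_def by (simp only: mv.eval_diff mv.eval_sum mv.eval_mult mv.eval_const mv.eval_var)
  also have "\<dots> = (of_const (\<pi>K ^ m) * N - (\<Sum>i<p. of_const (poly.coeff \<phi> i) * var_x ^ i)) / N"
    using N_nonzero by (simp add: xs_eq diff_divide_distrib sum_divide_distrib)
  also have "\<dots> = var_x ^ p / N"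
    unfolding phi_y[symmetric] phi_x by simp
  finally show ?thesis using False \<open>i \<le> p\<close> by (simp add: \<chi>_def)
qed

lemma ker_ideal: "ideal {q \<in> \<P>. ev q = 0} (sub_ring \<P>)"
  unfolding ideal_sub_ring_iff[OF subring_P]
proof (intro conjI ballI)
  show "{q \<in> \<P>. ev q = 0} \<subseteq> \<P>" "0 \<in> {q \<in> \<P>. ev q = 0}" using P_closed(1) by (auto simp: mv.eval_zero)
  show "a + b \<in> {q \<in> \<P>. ev q = 0}" if "a \<in> {q \<in> \<P>. ev q = 0}" "b \<in> {q \<in> \<P>. ev q = 0}" for a b
    using that P_closed(3) by (simp add: mv.eval_add)
  show "a * b \<in> {q \<in> \<P>. ev q = 0}" if "a \<in> \<P>" "b \<in> {q \<in> \<P>. ev q = 0}" for a b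
    using that P_closed(6) by (simp add: mv.eval_mult)
qed

lemma I_subset_ker: "I \<subseteq> {q \<in> \<P>. ev q = 0}"
proof (rule I_genideal(3)[OF ker_ideal])
  have "ev (\<chi> i * \<chi> (Suc j) - \<chi> (Suc i) * \<chi> j) = 0" if "i < j" "j < p" for i j
    using that by (simp add: mv.eval_diff mv.eval_mult ev_X)
  then show "minors2 p (rel_matrix p (\<pi>K ^ m) (poly.coeff \<phi>)) \<subseteq> {q \<in> \<P>. ev q = 0}"
    using minors_subset unfolding minors_eq by blast
qed

lemma minor_mem: "i < p \<Longrightarrow> j < p \<Longrightarrow> \<chi> i * \<chi> (Suc j) - \<chi> (Suc i) * \<chi> j \<in> I"
proof -
  assume ij: "i < p" "j < p"
  have gen: "\<chi> i * \<chi> (Suc j) - \<chi> (Suc i) * \<chi> j \<in> I" if "i < j" "j < p" for i j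
    using I_genideal(2) that unfolding minors_eq by blast
  consider "i < j" | "j < i" | "i = j" by linarith
  then show ?thesis
  proof cases
    case 2
    have "\<chi> i * \<chi> (Suc j) - \<chi> (Suc i) * \<chi> j = - (\<chi> j * \<chi> (Suc i) - \<chi> (Suc j) * \<chi> i)" by (simp add: mult.commute)
    also have "\<dots> \<in> I" by (rule I_closed(4)[OF gen[OF 2 ij(1)]])
    finally show ?thesis .
  qed (use gen ij I_closed(2) in \<open>auto simp: mult.commute\<close>)
qed

text \<open>Each minor allows one unit of index to be shifted from one factor to the other; here the
  first index is lowered to 0.\<close>

lemma prod_low: "i + j \<le> p \<Longrightarrow> \<chi> i * \<chi> j - \<chi> 0 * \<chi> (i + j) \<in> I"
proof (induction i arbitrary: j)
  case (Suc i)
  have "\<chi> i * \<chi> (Suc j) - \<chi> 0 * \<chi> (i + Suc j) \<in> I" using Suc.prems by (intro Suc.IH) simp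
  moreover have "\<chi> i * \<chi> (Suc j) - \<chi> (Suc i) * \<chi> j \<in> I" using Suc.prems by (intro minor_mem) auto
  ultimately have "(\<chi> i * \<chi> (Suc j) - \<chi> 0 * \<chi> (i + Suc j)) - (\<chi> i * \<chi> (Suc j) - \<chi> (Suc i) * \<chi> j) \<in> I"
    by (rule I_closed(5))
  then show ?case by (simp add: algebra_simps)
qed (simp add: I_closed(2))

text \<open>The same shifts when the sum of the indices may exceed \<open>p\<close>: the second
  index is raised in \<open>k\<close> steps until it reaches \<open>p\<close>, where the entry is
  \<open>z\<close>.\<close>

lemma prod_high: "k \<le> i \<Longrightarrow> i \<le> p \<Longrightarrow> \<chi> i * \<chi> (p - k) - \<chi> (i - k) * \<chi> p \<in> I"
proof (induction k arbitrary: i)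
  case (Suc k)
  have "\<chi> (i - 1) * \<chi> (p - k) - \<chi> (i - 1 - k) * \<chi> p \<in> I" using Suc by (intro Suc.IH) auto
  moreover have "\<chi> (i - 1) * \<chi> (Suc (p - Suc k)) - \<chi> (Suc (i - 1)) * \<chi> (p - Suc k) \<in> I"
    using Suc.prems by (intro minor_mem) auto
  then have "\<chi> (i - 1) * \<chi> (p - k) - \<chi> i * \<chi> (p - Suc k) \<in> I"
    using Suc.prems by (simp add: Suc_diff_Suc)
  ultimately have "(\<chi> (i - 1) * \<chi> (p - k) - \<chi> (i - 1 - k) * \<chi> p) - (\<chi> (i - 1) * \<chi> (p - k) - \<chi> i * \<chi> (p - Suc k)) \<in> I"
    by (rule I_closed(5))
  moreover have "i - 1 - k = i - Suc k" by simp
  ultimately show ?case by (simp add: algebra_simps)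
qed (simp add: I_closed(2))

text \<open>\<open>R\<close>-combinations of \<open>1\<close> and the monomials \<open>x i * x 0 ^ k\<close>; these form a complete
  set of representatives modulo the minors.\<close>

inductive_set S :: "'l mvpoly set" where
  const: "r \<in> R \<Longrightarrow> mv_const r \<in> S"
| monom: "r \<in> R \<Longrightarrow> i < p \<Longrightarrow> mv_const r * (mv_var i * mv_var 0 ^ k) \<in> S"
| add: "q \<in> S \<Longrightarrow> q' \<in> S \<Longrightarrow> q + q' \<in> S"

definition T :: "'l mvpoly set" where "T = {q. \<exists>s\<in>S. q - s \<in> I}"

lemma S_subset_T: "S \<subseteq> T"
  unfolding T_def using I_closed(2) by force

lemma T_cong: "q \<in> T \<Longrightarrow> q' - q \<in> I \<Longrightarrow> q' \<in> T"
proof -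
  assume "q \<in> T" "q' - q \<in> I"
  then obtain s where "s \<in> S" "q - s \<in> I" unfolding T_def by blast
  moreover have "q' - s = (q' - q) + (q - s)" by simp
  ultimately show ?thesis unfolding T_def using I_closed(3) \<open>q' - q \<in> I\<close> by (metis (mono_tags, lifting) mem_Collect_eq)
qed

lemma T_add: "q \<in> T \<Longrightarrow> q' \<in> T \<Longrightarrow> q + q' \<in> T"
proof -
  assume "q \<in> T" "q' \<in> T"
  then obtain s s' where s: "s \<in> S" "q - s \<in> I" "s' \<in> S" "q' - s' \<in> I" unfolding T_def by blast
  have "(q + q') - (s + s') = (q - s) + (q' - s')" by simp
  also have "\<dots> \<in> I" by (rule I_closed(3)[OF s(2,4)])
  finally show ?thesis unfolding T_def using S.add[OF s(1,3)] by blast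
qed

lemma zero_mem_T: "0 \<in> T"
  using S_subset_T S.const[OF R_closed'(1)] by auto

lemma T_sum: "(\<And>i. i \<in> J \<Longrightarrow> f i \<in> T) \<Longrightarrow> sum f J \<in> T"
  by (induction J rule: infinite_finite_induct) (simp_all add: zero_mem_T T_add)

text \<open>Since \<open>I\<close> is an ideal, multiplication by \<open>u\<close> has to be
  examined only on the representatives.\<close>

lemma T_mult:
  assumes u: "u \<in> \<P>" and S: "\<And>s. s \<in> S \<Longrightarrow> u * s \<in> T" and q: "q \<in> T"
  shows "u * q \<in> T"
proof -
  obtain s where s: "s \<in> S" "q - s \<in> I" using q unfolding T_def by blast
  have "u * q - u * s = u * (q - s)" by (simp add: algebra_simps)
  also have "\<dots> \<in> I" by (rule I_closed(6)[OF u s(2)])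
  finally show ?thesis by (rule T_cong[OF S[OF s(1)]])
qed

lemma T_const_mult: "r \<in> R \<Longrightarrow> q \<in> T \<Longrightarrow> mv_const r * q \<in> T"
proof (rule T_mult)
  assume r: "r \<in> R"
  then show "mv_const r \<in> \<P>" by (rule const_mem_P)
  fix s assume "s \<in> S"
  then show "mv_const r * s \<in> T"
  proof (induction s)
    case (const a)
    have "mv_const r * mv_const a \<in> S" using S.const[OF R_closed'(6)[OF r const]] by (simp add: mv_const_mult)
    then show ?case using S_subset_T by blast
  next
    case (monom a i k)
    have "mv_const r * (mv_const a * (mv_var i * mv_var 0 ^ k)) \<in> S"
      using S.monom[OF R_closed'(6)[OF r monom(1)] monom(2), of k] by (simp add: mv_const_mult mult.assoc)
    then show ?case using S_subset_T by blast
  next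
    case (add q q')
    then show ?case by (simp add: distrib_left T_add)
  qed
qed

lemma T_var0_mult: "q \<in> T \<Longrightarrow> mv_var 0 * q \<in> T"
proof (rule T_mult)
  show "mv_var 0 \<in> \<P>" by (rule var_mem_P[OF p_pos])
  fix s assume "s \<in> S"
  then show "mv_var 0 * s \<in> T"
  proof (induction s)
    case (const a)
    have "mv_var 0 * mv_const a \<in> S" using S.monom[OF const p_pos, of 0] by (simp add: mult.commute)
    then show ?case using S_subset_T by blast
  next
    case (monom a i k)
    have "mv_var 0 * (mv_const a * (mv_var i * mv_var 0 ^ k)) \<in> S"
      using S.monom[OF monom, of "Suc k"] by (simp add: ac_simps)
    then show ?case using S_subset_T by blast
  next
    case (add q q')
    then show ?case by (simp add: distrib_left T_add)
  qed
qed

text \<open>Induction on \<open>i + j\<close>. Below \<open>p\<close> the product becomes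
  \<open>x_0 * x_(i+j)\<close>. Otherwise it becomes \<open>x_l * z\<close> with
  \<open>l = i + j - p\<close>, and expanding \<open>z\<close> leaves products
  \<open>x_k * x_l\<close> with \<open>k < p\<close>, whose index sum \<open>k + l\<close> is
  smaller than \<open>i + j\<close>.\<close>

lemma T_var_var: "i < p \<Longrightarrow> j < p \<Longrightarrow> mv_var i * mv_var j \<in> T"
proof (induction "i + j" arbitrary: i j rule: less_induct)
  case less
  have \<chi>: "\<chi> i = mv_var i" "\<chi> j = mv_var j" "\<chi> 0 = mv_var 0" using less.prems p_pos by (simp_all add: \<chi>_def)
  show ?case
  proof (cases "i + j < p")
    case True
    then have "\<chi> i * \<chi> j - \<chi> 0 * \<chi> (i + j) \<in> I" by (intro prod_low) simp
    moreover have "\<chi> 0 * \<chi> (i + j) \<in> T"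
    proof -
      have "mv_const 1 * (mv_var (i + j) * mv_var 0 ^ 1) \<in> S" by (rule S.monom[OF R_closed'(2) True])
      then show ?thesis using S_subset_T True p_pos by (auto simp: \<chi>_def mult.commute)
    qed
    ultimately show ?thesis using T_cong \<chi> by metis
  next
    case False
    define l where "l = i + j - p"
    have l: "l < p" "p - (p - j) = j" "i - (p - j) = l" using False less.prems by (auto simp: l_def)
    have "\<chi> i * \<chi> j - \<chi> l * \<chi> p \<in> I"
      using prod_high[of "p - j" i] False less.prems l by simp
    moreover have "mv_var l * Z \<in> T"
    proof -
      have "mv_var l * Z = mv_const (\<pi>K ^ m) * mv_var l +
          mv_const (- 1) * (\<Sum>k<p. mv_const (poly.coeff \<phi> k) * (mv_var k * mv_var l))"
        by (simp add: Z_def rel_z_def mv_const_uminus algebra_simps sum_distrib_left sum_negf)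
      also have "\<dots> \<in> T"
      proof (intro T_add T_const_mult T_sum)
        show "\<pi>K ^ m \<in> R" by (rule R_closed'(7)[OF piK_R])
        show "- 1 \<in> R" by (rule R_closed'(5)[OF R_closed'(2)])
        have "mv_const 1 * (mv_var l * mv_var 0 ^ 0) \<in> S" by (rule S.monom[OF R_closed'(2) l(1)])
        then show "mv_var l \<in> T" using S_subset_T by auto
        fix k assume k: "k \<in> {..<p}"
        then show "poly.coeff \<phi> k \<in> R" using coeff_R by simp
        have "k + l < i + j" using k False by (simp add: l_def)
        then show "mv_var k * mv_var l \<in> T" using less.hyps k l(1) by simp
      qed
      finally show ?thesis .
    qed
    ultimately show ?thesis using T_cong \<chi> l(1) by (simp add: \<chi>_def)
  qed
qed

lemma T_var_mult: "j < p \<Longrightarrow> q \<in> T \<Longrightarrow> mv_var j * q \<in> T"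
proof (rule T_mult)
  assume j: "j < p"
  then show "mv_var j \<in> \<P>" by (rule var_mem_P)
  fix s assume "s \<in> S"
  then show "mv_var j * s \<in> T"
  proof (induction s)
    case (const a)
    have "mv_var j * mv_const a \<in> S" using S.monom[OF const j, of 0] by (simp add: mult.commute)
    then show ?case using S_subset_T by blast
  next
    case (monom a i k)
    have "mv_var 0 ^ k * (mv_var j * mv_var i) \<in> T"
      by (induction k) (simp_all add: T_var_var[OF j monom(2)] T_var0_mult mult.assoc)
    from T_const_mult[OF monom(1) this] show ?case by (simp add: ac_simps)
  next
    case (add q q')
    then show ?case by (simp add: distrib_left T_add)
  qed
qed

lemma P_subset_T: "q \<in> \<P> \<Longrightarrow> q \<in> T"
proof (induction q rule: mv_poly_ring_induct[OF subring_R, consumes 1, case_names const add var])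
  case (const a)
  then show ?case using S.const S_subset_T by blast
qed (simp_all add: T_add T_var_mult)

definition nf :: "'l \<Rightarrow> nat \<Rightarrow> (nat \<Rightarrow> nat \<Rightarrow> 'l) \<Rightarrow> 'l mvpoly" where
  "nf r n b = mv_const r + (\<Sum>k<n. \<Sum>i<p. mv_const (b k i) * (mv_var i * mv_var 0 ^ k))"

lemma mv_const_add: "mv_const (a + b) = mv_const a + mv_const b"
  by (simp add: mv_const_def single_add)

lemma S_nf: "s \<in> S \<Longrightarrow> \<exists>r n b. (\<forall>k\<ge>n. \<forall>i. b k i = 0) \<and> s = nf r n b"
proof (induction rule: S.induct)
  case (const r)
  have "mv_const r = nf r 0 (\<lambda>_ _. 0)" by (simp add: nf_def)
  then show ?case by (metis (full_types))
next
  case (monom r i k)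
  define b where "b k' i' = (if k' = k \<and> i' = i then r else 0)" for k' i'
  have "(\<Sum>i'<p. mv_const (b k' i') * (mv_var i' * mv_var 0 ^ k')) =
      (if k' = k then mv_const r * (mv_var i * mv_var 0 ^ k) else 0)" for k'
  proof -
    have "(\<Sum>i'<p. mv_const (b k' i') * (mv_var i' * mv_var 0 ^ k')) =
        (\<Sum>i'<p. if i' = i then (if k' = k then mv_const r * (mv_var i * mv_var 0 ^ k) else 0) else 0)"
      by (intro sum.cong refl) (simp add: b_def)
    then show ?thesis using monom(2) by simp
  qed
  then have "mv_const r * (mv_var i * mv_var 0 ^ k) = nf 0 (Suc k) b"
    by (simp add: nf_def)
  moreover have "\<forall>k'\<ge>Suc k. \<forall>i. b k' i = 0" by (simp add: b_def)
  ultimately show ?case by blast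
next
  case (add q q')
  then obtain r n b r' n' b' where 1: "\<forall>k\<ge>n. \<forall>i. b k i = 0" "q = nf r n b"
    and 2: "\<forall>k\<ge>n'. \<forall>i. b' k i = 0" "q' = nf r' n' b'" by blast
  \<comment> \<open>Vanishing beyond the stated length allows both families to be brought to the
    same length before they are added.\<close>
  have pad: "nf r n b = nf r n' b" if "n \<le> n'" "\<forall>k\<ge>n. \<forall>i. b k i = 0" for r n n' b
    unfolding nf_def using that by (intro arg_cong2[of _ _ _ _ "(+)"] refl sum.mono_neutral_left) auto
  have "q + q' = nf r (max n n') b + nf r' (max n n') b'"
    using pad[OF _ 1(1), of "max n n'" r] pad[OF _ 2(1), of "max n n'" r'] 1(2) 2(2) by simp
  also have "\<dots> = nf (r + r') (max n n') (\<lambda>k i. b k i + b' k i)"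
    by (simp add: nf_def mv_const_add distrib_right sum.distrib)
  finally show ?case using 1(1) 2(1)
    by (intro exI[of _ "r + r'"] exI[of _ "max n n'"] exI[of _ "\<lambda>k i. b k i + b' k i"]) simp
qed

text \<open>The monomial \<open>x_i * x_0 ^ k\<close> evaluates to
  \<open>x ^ i / N ^ (k + 1)\<close>. Multiplication by \<open>N ^ n\<close> turns the vanishing
  value into an expansion of 0 in powers of \<open>\<Phi>\<close> with digits of degree below
  \<open>p\<close>, and such an expansion is unique.\<close>

lemma nf_eval_zero:
  assumes "ev (nf r n b) = 0"
  shows "nf r n b = 0"
proof -
  define B where "B k = (\<Sum>i<p. Polynomial.monom (b k i) i)" for k
  have of_B: "of_poly (B k) = (\<Sum>i<p. of_const (b k i) * var_x ^ i)" for k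
  proof -
    have "of_poly (B k) = evc (B k) var_x" by (simp add: evc_of_poly)
    then show ?thesis by (simp add: B_def evc_monom)
  qed
  have "ev (nf r n b) = of_const r + (\<Sum>k<n. \<Sum>i<p. of_const (b k i) * (xs i * xs 0 ^ k))"
    unfolding nf_def by (simp only: mv.eval_add mv.eval_sum mv.eval_mult mv.eval_const mv.eval_var mv.eval_power)
  also have "\<dots> = of_const r + (\<Sum>k<n. of_poly (B k) * inverse N ^ Suc k)"
    unfolding of_B sum_distrib_right by (simp add: xs_eq divide_inverse mult.assoc)
  finally have "0 = (of_const r + (\<Sum>k<n. of_poly (B k) * inverse N ^ Suc k)) * N ^ n"
    using assms by simp
  also have "\<dots> = of_const r * N ^ n + (\<Sum>k<n. of_poly (B k) * N ^ (n - Suc k))"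
    unfolding distrib_right sum_distrib_right
  proof (intro arg_cong2[of _ _ _ _ "(+)"] refl sum.cong)
    fix k assume "k \<in> {..<n}"
    then have "Suc k + (n - Suc k) = n" by simp
    then have "N ^ n = N ^ Suc k * N ^ (n - Suc k)" by (metis power_add)
    then have "of_poly (B k) * inverse N ^ Suc k * N ^ n =
        of_poly (B k) * (inverse N ^ Suc k * N ^ Suc k) * N ^ (n - Suc k)"
      by (simp only: mult.assoc)
    also have "inverse N ^ Suc k * N ^ Suc k = 1"
      by (simp only: power_mult_distrib[symmetric] left_inverse[OF N_nonzero] power_one)
    finally show "of_poly (B k) * inverse N ^ Suc k * N ^ n = of_poly (B k) * N ^ (n - Suc k)"
      by (simp only: mult_1_right)
  qed
  \<comment> \<open>Reversing the order of summation: the digit at \<open>N ^ j\<close> is the one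
    with index \<open>n - 1 - j\<close>.\<close>
  also have "(\<Sum>k<n. of_poly (B k) * N ^ (n - Suc k)) = (\<Sum>j<n. of_poly (B (n - Suc j)) * N ^ j)"
    by (subst sum.nat_diff_reindex[symmetric]) (intro sum.cong, auto)
  also have "of_const r * N ^ n + (\<Sum>j<n. of_poly (B (n - Suc j)) * N ^ j) =
      of_poly ((\<Sum>j<n. B (n - Suc j) * \<Phi> ^ j) + [:r:] * \<Phi> ^ n)"
    by (simp only: of_poly_simps of_poly_sum of_poly_power N_eq add.commute)
  finally have 0: "(\<Sum>j<n. B (n - Suc j) * \<Phi> ^ j) + [:r:] * \<Phi> ^ n = 0"
    by (metis of_poly_eq_0_iff)
  have cf: "poly.coeff (B k) i = (if i < p then b k i else 0)" for k i
    by (auto simp: B_def coeff_sum)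
  have "Polynomial.degree (B k) < Polynomial.degree \<Phi>" for k
    unfolding degree_Phi using p_pos by (intro degree_lessI) (auto simp: cf)
  from phi_adic_unique[OF 0 this] have "[:r:] = 0" and Bz: "\<forall>j<n. B (n - Suc j) = 0" by auto
  then have "r = 0" by simp
  moreover have "b k i = 0" if "k < n" "i < p" for k i
  proof -
    have "n - Suc k < n" "n - Suc (n - Suc k) = k" using that(1) by auto
    then have "B k = 0" using Bz by metis
    then show ?thesis using cf[of k i] that(2) by simp
  qed
  ultimately show ?thesis by (simp add: nf_def)
qed

text \<open>Reduction modulo the minors does not change the value, so a relation reduces to a normal
  form with value 0. That normal form is 0, hence the relation itself lies in
  \<open>I\<close>.\<close>

lemma kernel_eq: "a_kernel (sub_ring \<P>) (sub_ring A) ev = I"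
proof -
  have "{q \<in> \<P>. ev q = 0} \<subseteq> I"
  proof
    fix q assume q: "q \<in> {q \<in> \<P>. ev q = 0}"
    then obtain s where s: "s \<in> S" "q - s \<in> I" using P_subset_T unfolding T_def by blast
    then have "ev (q - s) = 0" using I_subset_ker by blast
    then have "ev s = 0" using q by (simp add: mv.eval_diff)
    then have "s = 0" using S_nf[OF s(1)] nf_eval_zero by blast
    then show "q \<in> I" using s(2) by simp
  qed
  then show ?thesis using I_subset_ker by (auto simp: a_kernel_def')
qed

end

section \<open>Transfer from the valued field extension to the number field\<close>

theorem proposition3p4:
  fixes p m :: nat
    and K OK \<pp> R RL :: "'l::field_char_0 set"
    and vK vL :: "'l \<Rightarrow> int"
    and \<sigma> :: "'l \<Rightarrow> 'l"
    and \<pi>L \<pi>K :: 'l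
    and \<phi> :: "'l poly"
    and y :: "'l poly fract"
    and G :: "('l poly fract \<Rightarrow> 'l poly fract) set"
    and \<Y> :: "('l poly fract set, 'l poly fract) scheme_in"
    and \<X> \<U> :: "('l poly fract set set, 'l poly fract) scheme_in"
    and \<eta> :: "'l poly fract set"
    and \<xi> :: "'l poly fract set set"
    and D\<^sub>K D :: "'l poly fract set set set"
    and xs :: "nat \<Rightarrow> 'l poly fract"
    and A \<mm> :: "'l poly fract set"
  assumes "Factorial_Ring.prime p"
    and "number_field K"
    and "OK = ring_of_integers K"
    and "primeideal \<pp> (sub_ring OK)" and "of_nat p \<in> \<pp>"
    and "discrete_valuation K vK" and "\<pp> = {a \<in> OK. a = 0 \<or> 0 < vK a}"
    and "R = valuation_ring K vK"
    \<comment> \<open>The type is the field L, Galois of degree p over K and totally ramified.\<close>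
    and "ring.dimension amb p K (UNIV :: 'l set)" and "galois_over K"
    and "discrete_valuation UNIV vL" and "\<forall>a\<in>K - {0}. vL a = int p * vK a"
    and "RL = valuation_ring UNIV vL"
    and "\<pi>L \<noteq> 0" and "vL \<pi>L = 1"
    and "\<sigma> \<in> Gal K" and "Gal K = {\<sigma> ^^ j | j. True}"
    and "int m = vL (\<sigma> \<pi>L - \<pi>L)"
    and "is_min_poly K \<pi>L \<phi>" and "\<pi>K = poly.coeff \<phi> 0"
    and "y = (var_x - of_const \<pi>L) / of_const \<pi>L ^ m"
    and "\<Y> = proj_line (of_const ` RL) y"
    and "\<eta> = localization (adjoin (of_const ` RL) {inverse y})
               (genideal (sub_ring (adjoin (of_const ` RL) {inverse y})) {of_const \<pi>L, inverse y})"
    and "G = extend_aut ` Gal K"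
    and "\<X> = quotient_scheme \<Y> G"
    and "\<xi> = point_orbit G \<eta>"
    and "D\<^sub>K = zeroes (of_const ` R) \<X> (of_poly \<phi>)"
    and "D = Abstract_Topology.closure_of (space_of \<X>) D\<^sub>K"
    and "\<U> = open_subscheme \<X> (points \<X> - D)"
    and "\<forall>i. xs i = of_const \<pi>K ^ m * var_x ^ i / of_poly \<phi>"
    and "A = adjoin (of_const ` R) (xs ` {..<p})"
    and "\<mm> = genideal (sub_ring A) (insert (of_const \<pi>K) (xs ` {..<p}))"
  shows "(\<exists>h. scheme_iso \<U> (Spec A) h \<and>
              \<xi> \<in> points \<U> \<and> maximalideal \<mm> (sub_ring A) \<and> h \<xi> = \<mm>) \<and>
         mv_eval of_const xs \<in> ring_hom (sub_ring (mv_poly_ring R p)) (sub_ring A) \<and>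
         mv_eval of_const xs ` mv_poly_ring R p = A \<and>
         a_kernel (sub_ring (mv_poly_ring R p)) (sub_ring A) (mv_eval of_const xs) =
           genideal (sub_ring (mv_poly_ring R p))
             (minors2 p (rel_matrix p (\<pi>K ^ m) (poly.coeff \<phi>)))"
proof -
  have K: "subfield K amb" using assms(2) by (simp add: number_field_def)
  have p: "0 < p" using assms(1) by (rule prime_gt_0_nat)
  interpret M: quotient_model p K vK vL \<pi>L \<phi> \<sigma> m
    by (intro quotient_model.intro galois_totally_ramified.intro totally_ramified.intro
        galois_totally_ramified_axioms.intro quotient_model_axioms.intro) (fact assms p K)+
  have y: "y = M.y" using assms by (simp only: M.y_def)
  have Y: "\<Y> = M.\<Y>" using assms by (simp only: M.\<Y>_def y)
  have G: "G = M.G" using assms by (simp only: M.G_def)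
  have eta: "\<eta> = M.\<eta>" using assms M.Pw_eq_genideal by (simp only: M.\<eta>_def y)
  have xs: "xs = M.xs" using assms by (intro ext) (simp only: M.xs_def)
  have A: "A = M.A" using assms by (simp only: M.A_def xs)
  have mm: "\<mm> = M.\<mm>" using assms by (simp only: M.\<mm>_def A xs)
  have X: "\<X> = M.\<X>" using assms by (simp only: Y G)
  have xi: "\<xi> = point_orbit M.G M.\<eta>" using assms by (simp only: G eta)
  have "D = {point_orbit M.G \<O> | \<O>. \<O> \<in> points M.\<Y> \<and> inverse M.N \<notin> \<O>}"
    using assms M.closure_zeroes by (simp only: X)
  then have U: "\<U> = open_subscheme M.\<X> (point_orbit M.G ` M.sch.V)"
    using assms M.complement_closure by (simp only: X)
  have "scheme_iso \<U> (Spec A) M.sch.chart_map"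
    unfolding U A by (rule M.sch.scheme_iso_chart)
  moreover have "\<xi> \<in> points \<U>"
    unfolding U xi using M.eta_mem_V M.sch.V_subset
    by (auto simp: open_subscheme_def M.sch.points_quotient)
  moreover have "maximalideal \<mm> (sub_ring A)"
    unfolding mm A by (rule M.maximal_mm)
  moreover have "M.sch.chart_map \<xi> = \<mm>"
    unfolding xi M.sch.chart_map_orbit mm by (rule M.mm_eq_center[symmetric])
  moreover have "mv_eval of_const xs \<in> ring_hom (sub_ring (mv_poly_ring R p)) (sub_ring A)"
    using M.ev_hom unfolding xs A assms(8) .
  moreover have "mv_eval of_const xs ` mv_poly_ring R p = A"
    using M.ev_image unfolding xs A assms(8) .
  moreover have "a_kernel (sub_ring (mv_poly_ring R p)) (sub_ring A) (mv_eval of_const xs) =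
      genideal (sub_ring (mv_poly_ring R p)) (minors2 p (rel_matrix p (\<pi>K ^ m) (poly.coeff \<phi>)))"
    using M.kernel_eq assms by (simp only: M.I_def xs A)
  ultimately show ?thesis by blast
qed

end
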